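(* Let $r,h\in\mathbb{N}$ with $r\geq 7$, and let $F(x,y)=(\alpha x+\beta y)^r-(\gamma x+\delta y)^r\in\mathbb{Z}[x,y]$, where $\alpha,\beta,\gamma,\delta$ are algebraic constants with $\alpha\delta-\beta\gamma\neq 0$. Let $D=D(F)$, $\Delta'$ and $N_F(h)$ be as defined in the context. Suppose that $$\Delta'\geq r^{13r^2(r-1)/(r^2-5r-2)}\,h^{4(r-1)(r^2-r+2)/(r^2-5r-2)}.$$ Then $$N_F(h)\leq \begin{cases} 2r & \text{if } D<0,\\ 4 & \text{if } D>0,\ r \text{ is even and } F \text{ is indefinite},\\ 2 & \text{if } D>0,\ r \text{ is odd and } F \text{ is indefinite},\\ 1 & \text{if } D>0 \text{ and } F \text{ is definite}.\end{cases}$$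
   Context: For $F$ as in the statement, it is known that one can write $$(\alpha x+\beta y)(\gamma x+\delta y)=\chi(Ax^2+Bxy+Cy^2)$$ with $A,B,C\in\mathbb{Z}$ and a constant $\chi$ with $\chi^r\in\mathbb{Q}$; put $D=D(F)=B^2-4AC$. Then $(\alpha\delta-\beta\gamma)^2=\chi^2D$, so $D\neq0$ (only the sign of $D$ matters, and it does not depend on the choice of $A,B,C,\chi$). Let $\Delta=\Delta(F)$ be the discriminant of the binary form $F$, and put $$\Delta'=\frac{|\Delta|}{2^{r^2-r}\,r^r\,h^{2r-2}}.$$ $N_F(h)$ is the number of primitive solutions of the inequality $0<|F(x,y)|\leq h$, i.e. of pairs $(x,y)\in\mathbb{Z}^2$ with $\gcd(x,y)=1$ satisfying the inequality, where $(x,y)$ and $(-x,-y)$ are counted as one solution. $F$ is definite if $F(x,y)$ is nonzero and of constant sign for all real $(x,y)\neq(0,0)$, and indefinite if it takes both positive and negative values on $\mathbb{R}^2$. *)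

theory Defs
  imports Complex_Main "HOL-Computational_Algebra.Polynomial" "HOL-Library.Extended_Nat"
begin

section \<open>Binary forms and primitive solutions\<close>

text \<open>A binary form of degree \<open>r\<close> in \<open>\<int>[x,y]\<close> is given by its coefficients:
  \<open>a i\<close> is the coefficient of \<open>x^(r-i) y^i\<close>; the values \<open>a i\<close> for \<open>i > r\<close> play no role.\<close>

definition binary_form :: "nat \<Rightarrow> (nat \<Rightarrow> int) \<Rightarrow> 'a \<Rightarrow> 'a \<Rightarrow> 'a::comm_ring_1" where
  "binary_form r a x y = (\<Sum>i\<le>r. of_int (a i) * x ^ (r - i) * y ^ i)"

definition definite_form :: "nat \<Rightarrow> (nat \<Rightarrow> int) \<Rightarrow> bool" where
  "definite_form r a \<longleftrightarrow>
     (\<forall>x y :: real. (x, y) \<noteq> (0, 0) \<longrightarrow> binary_form r a x y > 0) \<or>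
     (\<forall>x y :: real. (x, y) \<noteq> (0, 0) \<longrightarrow> binary_form r a x y < 0)"

definition indefinite_form :: "nat \<Rightarrow> (nat \<Rightarrow> int) \<Rightarrow> bool" where
  "indefinite_form r a \<longleftrightarrow>
     (\<exists>x y :: real. binary_form r a x y > 0) \<and> (\<exists>x y :: real. binary_form r a x y < 0)"

definition primitive_solutions :: "nat \<Rightarrow> (nat \<Rightarrow> int) \<Rightarrow> nat \<Rightarrow> (int \<times> int) set" where
  "primitive_solutions r a h =
     {(x, y). coprime x y \<and> 0 < \<bar>binary_form r a x y\<bar> \<and> \<bar>binary_form r a x y\<bar> \<le> int h}"

text \<open>Solutions are counted modulo \<open>(x,y) \<sim> (-x,-y)\<close>. The count is extended-valued because
  \<^const>\<open>card\<close> is 0 on infinite sets: a finite bound on it includes finiteness.\<close>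

definition num_primitive_solutions :: "nat \<Rightarrow> (nat \<Rightarrow> int) \<Rightarrow> nat \<Rightarrow> enat" where
  "num_primitive_solutions r a h =
     (let S = (\<lambda>(x, y). {(x, y), (- x, - y)}) ` primitive_solutions r a h
      in if finite S then enat (card S) else \<infinity>)"


section \<open>The discriminant of a binary form\<close>

definition linear_factorization ::
    "nat \<Rightarrow> (nat \<Rightarrow> int) \<Rightarrow> (nat \<Rightarrow> complex) \<Rightarrow> (nat \<Rightarrow> complex) \<Rightarrow> bool" where
  "linear_factorization r a p q \<longleftrightarrow>
     (\<forall>x y :: complex. binary_form r a x y = (\<Prod>i<r. p i * x - q i * y))"

definition factor_disc :: "nat \<Rightarrow> (nat \<Rightarrow> complex) \<Rightarrow> (nat \<Rightarrow> complex) \<Rightarrow> complex" where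
  "factor_disc r p q = (\<Prod>j<r. \<Prod>i<j. (p i * q j - p j * q i)\<^sup>2)"

text \<open>For a form that does not vanish identically this is independent of the factorization,
  see \<open>form_disc_eq\<close> below.\<close>

definition form_disc :: "nat \<Rightarrow> (nat \<Rightarrow> int) \<Rightarrow> complex" where
  "form_disc r a = (THE d. \<exists>p q. linear_factorization r a p q \<and> d = factor_disc r p q)"

definition normalized_disc :: "nat \<Rightarrow> (nat \<Rightarrow> int) \<Rightarrow> nat \<Rightarrow> real" where
  "normalized_disc r a h =
     cmod (form_disc r a) / (2 ^ (r\<^sup>2 - r) * real r ^ r * real h ^ (2 * r - 2))"

lemma binary_form_one:
  "binary_form r a (1 :: complex) t = poly (\<Sum>i\<le>r. monom (of_int (a i)) i) t"
  by (simp add: binary_form_def poly_sum poly_monom)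

lemma linear_form_cancel:
  fixes p q :: complex and P Q :: "'i \<Rightarrow> complex"
  assumes nz: "(p, q) \<noteq> (0, 0)"
    and eq: "\<And>x y. (p * x - q * y) * (\<Prod>i\<in>I. P i * x - Q i * y) =
                     k * (p * x - q * y) * (\<Prod>j\<in>J. P' j * x - Q' j * y)"
  shows "(\<Prod>i\<in>I. P i * x - Q i * y) = k * (\<Prod>j\<in>J. P' j * x - Q' j * y)"
proof -
  obtain u v where uv: "p * u - q * v \<noteq> 0"
  proof (cases "p = 0")
    case True
    then show ?thesis using nz that[of 0 1] by simp
  next
    case False
    then show ?thesis using that[of 1 0] by simp
  qed
  define L where "L = [:p * x - q * y, p * u - q * v:]"
  define G where "G = (\<Prod>i\<in>I. [:P i * x - Q i * y, P i * u - Q i * v:])"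
  define H where "H = smult k (\<Prod>j\<in>J. [:P' j * x - Q' j * y, P' j * u - Q' j * v:])"
  have "poly (L * G) t = poly (L * H) t" for t
    using eq[of "x + t * u" "y + t * v"]
    by (simp add: L_def G_def H_def poly_prod algebra_simps)
  then have "L * G = L * H" by (intro poly_eq_poly_eq_iff[THEN iffD1] ext)
  moreover have "L \<noteq> 0" using uv by (simp add: L_def)
  ultimately have "G = H" by simp
  then have "poly G 0 = poly H 0" by simp
  then show ?thesis by (simp add: G_def H_def poly_prod)
qed

lemma linear_factors_unique:
  fixes p q :: "'i \<Rightarrow> complex" and p' q' :: "'j \<Rightarrow> complex"
  assumes "finite I" "finite J" "k \<noteq> 0"
    and "\<And>i. i \<in> I \<Longrightarrow> (p i, q i) \<noteq> (0, 0)"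
    and "\<And>x y. (\<Prod>i\<in>I. p i * x - q i * y) = k * (\<Prod>j\<in>J. p' j * x - q' j * y)"
  shows "\<exists>\<sigma> c. bij_betw \<sigma> I J \<and> k * (\<Prod>i\<in>I. c i) = 1 \<and>
           (\<forall>i\<in>I. p' (\<sigma> i) = c i * p i \<and> q' (\<sigma> i) = c i * q i)"
  using assms
proof (induction I arbitrary: J k rule: finite_induct)
  case empty
  have J: "J = {}"
  proof (rule ccontr)
    assume "J \<noteq> {}"
    then have "card J > 0" using empty.prems(1) by (simp add: card_gt_0_iff)
    then show False using empty.prems(4)[of 0 0] by (simp add: power_0_left)
  qed
  then have "k = 1" using empty.prems(4)[of 0 0] by simp
  then show ?case using J by (auto simp: bij_betw_def)
next
  case (insert i0 I)
  have nz: "(p i0, q i0) \<noteq> (0, 0)" using insert.prems by blast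
  have "(\<Prod>i\<in>insert i0 I. p i * q i0 - q i * p i0) = 0"
    using insert.hyps by (simp add: algebra_simps)
  then have "(\<Prod>j\<in>J. p' j * q i0 - q' j * p i0) = 0"
    using insert.prems(4)[of "q i0" "p i0"] insert.prems(2) by simp
  then obtain j0 where j0: "j0 \<in> J" "p' j0 * q i0 = q' j0 * p i0"
    using insert.prems(1) by auto
  obtain c0 where c0: "p' j0 = c0 * p i0" "q' j0 = c0 * q i0"
  proof (cases "p i0 = 0")
    case True
    then have "q i0 \<noteq> 0" "p' j0 = 0" using nz j0 by auto
    then show ?thesis using that[of "q' j0 / q i0"] True by simp
  next
    case False
    then show ?thesis using that[of "p' j0 / p i0"] j0 by (simp add: field_simps)
  qed
  have eq: "(p i0 * x - q i0 * y) * (\<Prod>i\<in>I. p i * x - q i * y) =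
        (k * c0) * (p i0 * x - q i0 * y) * (\<Prod>j\<in>J - {j0}. p' j * x - q' j * y)" for x y
  proof -
    have "(p i0 * x - q i0 * y) * (\<Prod>i\<in>I. p i * x - q i * y) =
        (\<Prod>i\<in>insert i0 I. p i * x - q i * y)" using insert.hyps by simp
    also have "\<dots> = k * (\<Prod>j\<in>J. p' j * x - q' j * y)" by (rule insert.prems(4))
    also have "(\<Prod>j\<in>J. p' j * x - q' j * y) =
        (p' j0 * x - q' j0 * y) * (\<Prod>j\<in>J - {j0}. p' j * x - q' j * y)"
      using insert.prems(1) j0(1) by (rule prod.remove)
    also have "p' j0 * x - q' j0 * y = c0 * (p i0 * x - q i0 * y)"
      by (simp add: c0 algebra_simps)
    finally show ?thesis by (simp add: algebra_simps)
  qed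
  have eq': "(\<Prod>i\<in>I. p i * x - q i * y) =
      (k * c0) * (\<Prod>j\<in>J - {j0}. p' j * x - q' j * y)" for x y
    by (rule linear_form_cancel[OF nz eq])
  have c0nz: "c0 \<noteq> 0"
  proof
    assume "c0 = 0"
    then have z: "(\<Prod>i\<in>I. p i * x - q i * y) = 0" for x y using eq'[of x y] by simp
    have "\<exists>i\<in>I. (p i, q i) = (0, 0)"
    proof (rule ccontr)
      assume no: "\<not> ?thesis"
      define N where "N = (\<Prod>i\<in>I. [:p i, - q i:])"
      have "poly N t = 0" for t using z[of 1 t] by (simp add: N_def poly_prod algebra_simps)
      then have "N = 0" using poly_all_0_iff_0 by blast
      then show False using no insert.hyps(1) by (auto simp: N_def)
    qed
    then show False using insert.prems(3) by blast
  qed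
  have "\<exists>\<sigma> c. bij_betw \<sigma> I (J - {j0}) \<and> k * c0 * (\<Prod>i\<in>I. c i) = 1 \<and>
           (\<forall>i\<in>I. p' (\<sigma> i) = c i * p i \<and> q' (\<sigma> i) = c i * q i)"
    using insert.prems insert.hyps c0nz eq' by (intro insert.IH) auto
  then obtain \<sigma> c where \<sigma>: "bij_betw \<sigma> I (J - {j0})" "k * c0 * (\<Prod>i\<in>I. c i) = 1"
    "\<forall>i\<in>I. p' (\<sigma> i) = c i * p i \<and> q' (\<sigma> i) = c i * q i" by blast
  define \<sigma>' where "\<sigma>' = \<sigma>(i0 := j0)"
  define c' where "c' = c(i0 := c0)"
  have "bij_betw \<sigma>' I (J - {j0})"
    using \<sigma>(1) insert.hyps by (subst bij_betw_cong[of I \<sigma>' \<sigma>]) (auto simp: \<sigma>'_def)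
  then have "bij_betw \<sigma>' (insert i0 I) (insert j0 (J - {j0}))"
    using notIn_Un_bij_betw[of i0 I \<sigma>' "J - {j0}"] insert.hyps by (simp add: \<sigma>'_def)
  then have "bij_betw \<sigma>' (insert i0 I) J" using j0(1) by (simp add: insert_absorb)
  moreover have "(\<Prod>i\<in>I. c' i) = (\<Prod>i\<in>I. c i)"
    using insert.hyps by (intro prod.cong) (auto simp: c'_def)
  then have "k * (\<Prod>i\<in>insert i0 I. c' i) = 1"
    using \<sigma>(2) insert.hyps by (simp add: c'_def mult.assoc)
  moreover have "\<forall>i\<in>insert i0 I. p' (\<sigma>' i) = c' i * p i \<and> q' (\<sigma>' i) = c' i * q i"
    using \<sigma>(3) insert.hyps c0 by (auto simp: \<sigma>'_def c'_def)
  ultimately show ?case by blast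
qed

lemma factor_disc_symmetric:
  "factor_disc r p q * (\<Prod>j<r. \<Prod>i<j. - 1) =
     (\<Prod>i<r. \<Prod>j\<in>{..<r} - {i}. p i * q j - p j * q i)"
proof (induction r)
  case 0
  then show ?case by (simp add: factor_disc_def)
next
  case (Suc r)
  let ?A = "\<lambda>i j. p i * q j - p j * q i"
  have "(\<Prod>i<r. \<Prod>j\<in>{..<Suc r} - {i}. ?A i j) = (\<Prod>i<r. ?A i r * (\<Prod>j\<in>{..<r} - {i}. ?A i j))"
  proof (rule prod.cong[OF refl])
    fix i assume "i \<in> {..<r}"
    then have "{..<Suc r} - {i} = insert r ({..<r} - {i})" by auto
    then show "(\<Prod>j\<in>{..<Suc r} - {i}. ?A i j) = ?A i r * (\<Prod>j\<in>{..<r} - {i}. ?A i j)" by simp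
  qed
  moreover have "{..<Suc r} - {r} = {..<r}" by auto
  ultimately have "(\<Prod>i<Suc r. \<Prod>j\<in>{..<Suc r} - {i}. ?A i j) =
      (\<Prod>i<r. ?A i r) * (\<Prod>i<r. \<Prod>j\<in>{..<r} - {i}. ?A i j) * (\<Prod>j<r. ?A r j)"
    by (simp add: prod.distrib)
  also have "(\<Prod>j<r. ?A r j) = (\<Prod>j<r. - 1 * ?A j r)" by (simp add: algebra_simps)
  also have "\<dots> = (\<Prod>j<r. - 1) * (\<Prod>j<r. ?A j r)" by (rule prod.distrib)
  finally show ?case using Suc.IH
    by (simp add: factor_disc_def power2_eq_square prod.distrib mult_ac del: prod_constant)
qed

lemma factor_disc_unique:
  assumes "linear_factorization r a p q" "linear_factorization r a p' q'"
    and nz: "binary_form r a x0 y0 \<noteq> (0 :: complex)"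
  shows "factor_disc r p q = factor_disc r p' q'"
proof -
  have "(\<Prod>i<r. p i * x0 - q i * y0) \<noteq> 0"
    using assms by (simp add: linear_factorization_def)
  then have "p i * x0 - q i * y0 \<noteq> 0" if "i < r" for i using that by auto
  then have "(p i, q i) \<noteq> (0, 0)" if "i < r" for i using that by fastforce
  then have "\<exists>\<sigma> c. bij_betw \<sigma> {..<r} {..<r} \<and> 1 * (\<Prod>i<r. c i) = 1 \<and>
           (\<forall>i\<in>{..<r}. p' (\<sigma> i) = c i * p i \<and> q' (\<sigma> i) = c i * q i)"
    using assms by (intro linear_factors_unique) (auto simp: linear_factorization_def)
  then obtain \<sigma> c where \<sigma>: "bij_betw \<sigma> {..<r} {..<r}" "(\<Prod>i<r. c i) = 1"
    "\<And>i. i < r \<Longrightarrow> p' (\<sigma> i) = c i * p i \<and> q' (\<sigma> i) = c i * q i" by auto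
  let ?A = "\<lambda>i j. p i * q j - p j * q i" and ?A' = "\<lambda>i j. p' i * q' j - p' j * q' i"
  have others: "(\<Prod>j\<in>{..<r} - {i}. c i * c j) = c i ^ (r - 2) * (\<Prod>j<r. c j)" 
    if "i < r" "r \<ge> 2" for i
  proof -
    have "(\<Prod>j\<in>{..<r} - {i}. c i * c j) = c i ^ (r - 1) * (\<Prod>j\<in>{..<r} - {i}. c j)"
      using that by (simp add: prod.distrib)
    also have "r - 1 = Suc (r - 2)" using that by simp
    also have "c i ^ Suc (r - 2) = c i ^ (r - 2) * c i" by (rule power_Suc2)
    also have "c i ^ (r - 2) * c i * (\<Prod>j\<in>{..<r} - {i}. c j) = c i ^ (r - 2) * (\<Prod>j<r. c j)"
      using prod.remove[of "{..<r}" i c] that by (simp add: mult.assoc)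
    finally show ?thesis .
  qed
  have scale: "(\<Prod>i<r. \<Prod>j\<in>{..<r} - {i}. c i * c j) = 1"
  proof (cases "r \<ge> 2")
    case True
    then have "(\<Prod>i<r. \<Prod>j\<in>{..<r} - {i}. c i * c j) = (\<Prod>i<r. c i ^ (r - 2))"
      using others \<sigma>(2) by (intro prod.cong) auto
    then show ?thesis using \<sigma>(2) by (simp add: prod_power_distrib[symmetric])
  next
    case False
    then have "r = 0 \<or> r = 1" by auto
    then show ?thesis by (auto simp: lessThan_Suc)
  qed
  have inj: "inj_on \<sigma> {..<r}" using \<sigma>(1) by (simp add: bij_betw_def)
  have "(\<Prod>i<r. \<Prod>j\<in>{..<r} - {i}. ?A' i j) = (\<Prod>i<r. \<Prod>j\<in>{..<r} - {\<sigma> i}. ?A' (\<sigma> i) j)"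
    using prod.reindex_bij_betw[OF \<sigma>(1), of "\<lambda>i. \<Prod>j\<in>{..<r} - {i}. ?A' i j"] by simp
  also have "\<dots> = (\<Prod>i<r. \<Prod>j\<in>{..<r} - {i}. (c i * c j) * ?A i j)"
  proof (rule prod.cong[OF refl])
    fix i assume i: "i \<in> {..<r}"
    have "bij_betw \<sigma> ({..<r} - {i}) ({..<r} - {\<sigma> i})"
      using \<sigma>(1) inj i by (auto simp: bij_betw_def inj_on_def)
    then have "(\<Prod>j\<in>{..<r} - {\<sigma> i}. ?A' (\<sigma> i) j) = (\<Prod>j\<in>{..<r} - {i}. ?A' (\<sigma> i) (\<sigma> j))"
      by (rule prod.reindex_bij_betw[symmetric])
    also have "\<dots> = (\<Prod>j\<in>{..<r} - {i}. (c i * c j) * ?A i j)"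
      using i \<sigma>(3) by (intro prod.cong) (auto simp: algebra_simps)
    finally show "(\<Prod>j\<in>{..<r} - {\<sigma> i}. ?A' (\<sigma> i) j) = (\<Prod>j\<in>{..<r} - {i}. (c i * c j) * ?A i j)" .
  qed
  also have "\<dots> = (\<Prod>i<r. \<Prod>j\<in>{..<r} - {i}. ?A i j)"
    using scale by (simp only: prod.distrib mult_1)
  finally have "factor_disc r p' q' * (\<Prod>j<r. \<Prod>i<j. - 1) = factor_disc r p q * (\<Prod>j<r. \<Prod>i<j. - 1)"
    by (simp only: factor_disc_symmetric)
  moreover have "(\<Prod>j<r. \<Prod>i<j. - 1) \<noteq> (0 :: complex)" by simp
  ultimately show ?thesis by (simp del: prod_constant)
qed

lemma form_disc_eq:
  assumes "linear_factorization r a p q" "binary_form r a x0 y0 \<noteq> (0 :: complex)"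
  shows "form_disc r a = factor_disc r p q"
  unfolding form_disc_def
  using assms by (intro the_equality) (auto intro: factor_disc_unique)


section \<open>The quadratic form attached to a diagonal form\<close>

definition quadratic_rep ::
    "nat \<Rightarrow> complex \<Rightarrow> complex \<Rightarrow> complex \<Rightarrow> complex \<Rightarrow> complex \<Rightarrow> int \<Rightarrow> int \<Rightarrow> int \<Rightarrow> bool" where
  "quadratic_rep r \<alpha> \<beta> \<gamma> \<delta> \<chi> A B C \<longleftrightarrow> \<chi> ^ r \<in> \<rat> \<and>
     (\<forall>x y. (\<alpha> * x + \<beta> * y) * (\<gamma> * x + \<delta> * y) =
        \<chi> * (of_int A * x\<^sup>2 + of_int B * x * y + of_int C * y\<^sup>2))"

text \<open>The discriminant of a chosen representation. Only its sign is meaningful: a representation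
  exists for the forms considered (\<open>quadratic_rep_exists\<close> below), and all
  representations give the same sign (\<open>sgn_quadratic_disc\<close> below).\<close>

definition quadratic_disc :: "nat \<Rightarrow> complex \<Rightarrow> complex \<Rightarrow> complex \<Rightarrow> complex \<Rightarrow> int" where
  "quadratic_disc r \<alpha> \<beta> \<gamma> \<delta> =
     (SOME D. \<exists>\<chi> A B C. quadratic_rep r \<alpha> \<beta> \<gamma> \<delta> \<chi> A B C \<and> D = B\<^sup>2 - 4 * A * C)"

lemma quadratic_rep_coeffs:
  assumes "quadratic_rep r \<alpha> \<beta> \<gamma> \<delta> \<chi> A B C"
  shows "\<alpha> * \<gamma> = \<chi> * of_int A" "\<alpha> * \<delta> + \<beta> * \<gamma> = \<chi> * of_int B" "\<beta> * \<delta> = \<chi> * of_int C"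
    and "(\<alpha> * \<delta> - \<beta> * \<gamma>)\<^sup>2 = \<chi>\<^sup>2 * of_int (B\<^sup>2 - 4 * A * C)"
proof -
  have *: "(\<alpha> * x + \<beta> * y) * (\<gamma> * x + \<delta> * y) =
        \<chi> * (of_int A * x\<^sup>2 + of_int B * x * y + of_int C * y\<^sup>2)" for x y
    using assms by (simp add: quadratic_rep_def)
  show 1: "\<alpha> * \<gamma> = \<chi> * of_int A" using *[of 1 0] by simp
  show 3: "\<beta> * \<delta> = \<chi> * of_int C" using *[of 0 1] by simp
  show 2: "\<alpha> * \<delta> + \<beta> * \<gamma> = \<chi> * of_int B" using *[of 1 1] 1 3 by (simp add: algebra_simps)
  have "(\<alpha> * \<delta> - \<beta> * \<gamma>)\<^sup>2 = (\<alpha> * \<delta> + \<beta> * \<gamma>)\<^sup>2 - 4 * (\<alpha> * \<gamma>) * (\<beta> * \<delta>)"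
    by (simp add: power2_eq_square algebra_simps)
  then show "(\<alpha> * \<delta> - \<beta> * \<gamma>)\<^sup>2 = \<chi>\<^sup>2 * of_int (B\<^sup>2 - 4 * A * C)"
    by (simp add: 1 2 3 power2_eq_square algebra_simps)
qed

lemma quadratic_rep_sgn_unique:
  assumes "quadratic_rep r \<alpha> \<beta> \<gamma> \<delta> \<chi> A B C" "quadratic_rep r \<alpha> \<beta> \<gamma> \<delta> \<chi>' A' B' C'"
    and nz: "\<alpha> * \<delta> - \<beta> * \<gamma> \<noteq> 0"
  shows "sgn (B\<^sup>2 - 4 * A * C) = sgn (B'\<^sup>2 - 4 * A' * C')"
proof -
  note 1 = quadratic_rep_coeffs[OF assms(1)] and 2 = quadratic_rep_coeffs[OF assms(2)]
  define D D' where "D = B\<^sup>2 - 4 * A * C" and "D' = B'\<^sup>2 - 4 * A' * C'"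
  have "\<chi> \<noteq> 0" "D \<noteq> 0" using nz 1(4)[folded D_def] by auto
  have "\<chi>' \<noteq> 0" "D' \<noteq> 0" using nz 2(4)[folded D'_def] by auto
  have "\<exists>m n :: int. n \<noteq> 0 \<and> \<chi> * of_int n = \<chi>' * of_int m"
  proof (cases "A = 0 \<and> B = 0")
    case True
    then have "D = 0" by (simp add: D_def)
    then show ?thesis using \<open>D \<noteq> 0\<close> by simp
  next
    case False
    then show ?thesis using 1 2 by metis
  qed
  then obtain m n :: int where mn: "n \<noteq> 0" "\<chi> * of_int n = \<chi>' * of_int m" by blast
  have "\<chi>\<^sup>2 * of_int D = \<chi>'\<^sup>2 * of_int D'" using 1(4) 2(4) by (simp add: D_def D'_def)
  then have "(\<chi> * of_int n)\<^sup>2 * of_int D = \<chi>'\<^sup>2 * of_int (n\<^sup>2 * D')"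
    by (simp add: power2_eq_square algebra_simps)
  then have "\<chi>'\<^sup>2 * of_int (m\<^sup>2 * D) = \<chi>'\<^sup>2 * of_int (n\<^sup>2 * D')"
    by (simp only: mn(2)) (simp add: power2_eq_square algebra_simps)
  then have "(of_int (m\<^sup>2 * D) :: complex) = of_int (n\<^sup>2 * D')"
    using \<open>\<chi>' \<noteq> 0\<close> by (metis mult_left_cancel power_not_zero)
  then have "m\<^sup>2 * D = n\<^sup>2 * D'" by (simp only: of_int_eq_iff)
  moreover have "m \<noteq> 0" using mn \<open>\<chi> \<noteq> 0\<close> by auto
  ultimately have "sgn D = sgn D'" using mn(1)
    by (metis mult_1 sgn_mult sgn_pos zero_less_power2)
  then show ?thesis by (simp add: D_def D'_def)
qed

lemma sgn_quadratic_disc: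
  assumes "quadratic_rep r \<alpha> \<beta> \<gamma> \<delta> \<chi> A B C" "\<alpha> * \<delta> - \<beta> * \<gamma> \<noteq> 0"
  shows "sgn (quadratic_disc r \<alpha> \<beta> \<gamma> \<delta>) = sgn (B\<^sup>2 - 4 * A * C)"
proof -
  have "\<exists>D \<chi> A B C. quadratic_rep r \<alpha> \<beta> \<gamma> \<delta> \<chi> A B C \<and> D = B\<^sup>2 - 4 * A * C"
    using assms by blast
  then have "\<exists>\<chi> A B C. quadratic_rep r \<alpha> \<beta> \<gamma> \<delta> \<chi> A B C \<and>
      quadratic_disc r \<alpha> \<beta> \<gamma> \<delta> = B\<^sup>2 - 4 * A * C"
    unfolding quadratic_disc_def by (rule someI_ex)
  then show ?thesis using quadratic_rep_sgn_unique[OF _ assms] by auto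
qed

text \<open>Existence: the Hessian of the form, dehomogenized, is a polynomial with rational
  coefficients and a constant multiple of \<open>((\<alpha> + \<beta> t) (\<gamma> + \<delta> t))^(r-2)\<close>.\<close>

abbreviation rat_poly :: "complex poly \<Rightarrow> bool" where
  "rat_poly p \<equiv> (\<forall>i. coeff p i \<in> \<rat>)"

lemma rat_poly_mult: "rat_poly p \<Longrightarrow> rat_poly q \<Longrightarrow> rat_poly (p * q)"
  by (auto simp: coeff_mult intro!: Rats_sum Rats_mult)

lemma rat_poly_power: "rat_poly p \<Longrightarrow> rat_poly (p ^ n)"
  by (induction n) (auto simp: rat_poly_mult)

lemma rat_poly_pderiv: "rat_poly p \<Longrightarrow> rat_poly (pderiv p)"
  by (auto simp: coeff_pderiv intro!: Rats_mult)

lemma diagonal_hessian: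
  fixes u v :: "complex poly"
  assumes "u = [:\<alpha>, \<beta>:]" "v = [:\<gamma>, \<delta>:]" "f = u ^ (n + 2) - v ^ (n + 2)"
  shows "of_nat (n + 2) * f * pderiv (pderiv f) - of_nat (n + 1) * (pderiv f)\<^sup>2 =
     smult (- of_nat ((n + 2)\<^sup>2 * (n + 1)) * (\<alpha> * \<delta> - \<beta> * \<gamma>)\<^sup>2) ((u * v) ^ n)"
proof -
  have f': "pderiv f = smult (of_nat (n + 2)) (smult \<beta> (u ^ (n + 1)) - smult \<delta> (v ^ (n + 1)))"
    using pderiv_power_Suc[of u "n + 1"] pderiv_power_Suc[of v "n + 1"]
    by (simp add: assms pderiv_diff pderiv_pCons smult_diff_right mult.commute)
  have f'': "pderiv (pderiv f) = smult (of_nat ((n + 2) * (n + 1)))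
      (smult (\<beta>\<^sup>2) (u ^ n) - smult (\<delta>\<^sup>2) (v ^ n))"
    using pderiv_power_Suc[of u n] pderiv_power_Suc[of v n] unfolding f'
    by (simp add: assms(1,2) pderiv_diff pderiv_smult pderiv_pCons smult_diff_right
        power2_eq_square algebra_simps)
  have "poly (of_nat (n + 2) * f * pderiv (pderiv f) - of_nat (n + 1) * (pderiv f)\<^sup>2) t =
     poly (smult (- of_nat ((n + 2)\<^sup>2 * (n + 1)) * (\<alpha> * \<delta> - \<beta> * \<gamma>)\<^sup>2) ((u * v) ^ n)) t" for t
  proof -
    define U V where "U = poly u t" and "V = poly v t"
    define N M P Q where "N = (of_nat (n + 2) :: complex)" and "M = (of_nat (n + 1) :: complex)"
      and "P = U ^ n" and "Q = V ^ n"
    have j: "\<alpha> * \<delta> - \<beta> * \<gamma> = \<delta> * U - \<beta> * V"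
      by (simp add: U_def V_def assms algebra_simps)
    have "N * (U\<^sup>2 * P - V\<^sup>2 * Q) * (N * M * (\<beta>\<^sup>2 * P - \<delta>\<^sup>2 * Q)) -
        M * (N * (\<beta> * (U * P) - \<delta> * (V * Q)))\<^sup>2 =
      - (N\<^sup>2 * M) * (\<delta> * U - \<beta> * V)\<^sup>2 * (P * Q)" by algebra
    moreover have "poly f t = U\<^sup>2 * P - V\<^sup>2 * Q"
      by (simp add: assms(3) U_def V_def P_def Q_def power_add power2_eq_square mult.commute)
    moreover have "poly (pderiv f) t = N * (\<beta> * (U * P) - \<delta> * (V * Q))"
      by (simp add: f' U_def V_def P_def Q_def N_def)
    moreover have "poly (pderiv (pderiv f)) t = N * M * (\<beta>\<^sup>2 * P - \<delta>\<^sup>2 * Q)"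
      unfolding f'' by (simp add: U_def V_def P_def Q_def N_def M_def algebra_simps)
    moreover have "poly (of_nat (n + 2)) t = N" "poly (of_nat (n + 1)) t = M"
      by (simp_all add: N_def M_def)
    moreover have "(poly u t * poly v t) ^ n = P * Q"
      by (simp add: U_def V_def P_def Q_def power_mult_distrib)
    moreover have "(of_nat ((n + 2)\<^sup>2 * (n + 1)) :: complex) = N\<^sup>2 * M"
      unfolding N_def M_def of_nat_mult of_nat_power ..
    ultimately show ?thesis
      unfolding poly_diff poly_mult poly_power poly_smult j by (simp only:)
  qed
  then show ?thesis by (intro poly_eq_poly_eq_iff[THEN iffD1] ext)
qed

lemma quadratic_power_rational_aux:
  fixes a b c K :: complex
  assumes rat: "rat_poly (smult K ([:a, b, c:] ^ n))" and "n > 0" "K \<noteq> 0" "a \<noteq> 0"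
  shows "b / a \<in> \<rat>" "c / a \<in> \<rat>"
proof -
  define q where "q = [:a, b, c:]"
  define G where "G = smult K (q ^ n)"
  have G: "coeff G i \<in> \<rat>" for i using rat by (simp add: G_def q_def)
  obtain m where m: "n = Suc m" using \<open>n > 0\<close> by (cases n) auto
  have "q * pderiv G = smult (of_nat n) (pderiv q * G)"
    unfolding G_def m pderiv_smult pderiv_power_Suc by (simp add: mult_ac)
  then have ode: "coeff (q * pderiv G) i = coeff (smult (of_nat n) (pderiv q * G)) i" for i by simp
  have q': "pderiv q = [:b, 2 * c:]" by (simp add: q_def pderiv_pCons)
  have "coeff G 0 = K * a ^ n" by (simp add: G_def q_def coeff_0_power)
  then have G0: "coeff G 0 \<noteq> 0" using assms by simp
  have e0: "a * coeff G 1 = of_nat n * b * coeff G 0"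
    using ode[of 0] by (simp add: q' coeff_mult coeff_pderiv) (simp add: q_def)
  have e1: "a * (2 * coeff G 2) + b * coeff G 1 = of_nat n * (b * coeff G 1 + 2 * c * coeff G 0)"
    using ode[of 1] by (simp add: q' coeff_mult coeff_pderiv numeral_2_eq_2) (simp add: q_def)
  have b: "b / a = coeff G 1 / (of_nat n * coeff G 0)"
    using e0 G0 \<open>a \<noteq> 0\<close> \<open>n > 0\<close> by (simp add: field_simps)
  then show ba: "b / a \<in> \<rat>" using G by simp
  have "c / a = (2 * coeff G 2 + b / a * coeff G 1 - of_nat n * (b / a) * coeff G 1) /
      (2 * of_nat n * coeff G 0)"
    using e1 G0 \<open>a \<noteq> 0\<close> \<open>n > 0\<close> by (simp add: field_simps)
  also have "\<dots> \<in> \<rat>"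
    by (intro Rats_divide Rats_diff Rats_add Rats_mult G ba) auto
  finally show "c / a \<in> \<rat>" .
qed

lemma quadratic_power_rational:
  fixes a b c K :: complex
  assumes rat: "rat_poly (smult K ([:a, b, c:] ^ n))" and "n > 0" "K \<noteq> 0"
    and "a \<noteq> 0 \<or> b \<noteq> 0"
  obtains e where "e \<noteq> 0" "a / e \<in> \<rat>" "b / e \<in> \<rat>" "c / e \<in> \<rat>"
proof (cases "a = 0")
  case False
  then show ?thesis using quadratic_power_rational_aux[OF assms(1-3)] that[of a] by simp
next
  case True
  have q: "[:a, b, c:] = monom 1 1 * [:b, c, 0:]" by (simp add: True monom_altdef)
  have "smult K ([:a, b, c:] ^ n) = monom 1 n * smult K ([:b, c, 0:] ^ n)"
    unfolding q power_mult_distrib monom_power by simp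
  then have eq: "coeff (smult K ([:b, c, 0:] ^ n)) i = coeff (smult K ([:a, b, c:] ^ n)) (i + n)" for i
    by (simp add: coeff_monom_mult)
  have "rat_poly (smult K ([:b, c, 0:] ^ n))" unfolding eq using rat by blast
  then show ?thesis
    using quadratic_power_rational_aux[of K b c 0 n] assms True that[of b] by simp
qed

lemma Rats_int_multiple:
  assumes "z \<in> (\<rat> :: complex set)"
  obtains m n :: int where "n \<noteq> 0" "z * of_int n = of_int m"
proof -
  obtain s where "z = of_rat s" using assms by (auto elim: Rats_cases)
  moreover obtain m n where "s = Rat.Fract m n" "n > 0" by (cases s) auto
  ultimately show ?thesis using that[of n m] by (simp add: of_rat_rat)
qed

lemma quadratic_rep_exists:
  fixes \<alpha> \<beta> \<gamma> \<delta> :: complex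
  assumes "r \<ge> 3" and nz: "\<alpha> * \<delta> - \<beta> * \<gamma> \<noteq> 0"
    and F: "\<And>x y :: complex.
      binary_form r a x y = (\<alpha> * x + \<beta> * y) ^ r - (\<gamma> * x + \<delta> * y) ^ r"
  shows "\<exists>\<chi> A B C. quadratic_rep r \<alpha> \<beta> \<gamma> \<delta> \<chi> A B C"
proof -
  define n where "n = r - 2"
  have n: "r = n + 2" "n > 0" using assms(1) by (auto simp: n_def)
  define u v where "u = [:\<alpha>, \<beta>:]" and "v = [:\<gamma>, \<delta>:]"
  define f where "f = u ^ (n + 2) - v ^ (n + 2)"
  define J where "J = - of_nat ((n + 2)\<^sup>2 * (n + 1)) * (\<alpha> * \<delta> - \<beta> * \<gamma>)\<^sup>2"
  have "(of_nat ((n + 2)\<^sup>2 * (n + 1)) :: complex) \<noteq> 0"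
    by (simp only: of_nat_eq_0_iff) simp
  then have J: "J \<noteq> 0" using nz by (simp add: J_def del: of_nat_mult of_nat_power of_nat_add)
  have "poly f t = poly (\<Sum>i\<le>r. monom (of_int (a i)) i) t" for t
  proof -
    have "poly f t = (\<alpha> * 1 + \<beta> * t) ^ r - (\<gamma> * 1 + \<delta> * t) ^ r"
      unfolding f_def n(1) poly_diff poly_power by (simp only: u_def v_def) (simp add: mult.commute)
    then show ?thesis by (simp only: F[symmetric] binary_form_one)
  qed
  then have f_eq: "f = (\<Sum>i\<le>r. monom (of_int (a i)) i)"
    by (intro poly_eq_poly_eq_iff[THEN iffD1] ext)
  have "rat_poly f" by (auto simp: f_eq coeff_sum intro!: Rats_sum)
  moreover have "rat_poly (of_nat k)" for k
    by (auto simp: of_nat_poly coeff_pCons split: nat.split)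
  ultimately have "rat_poly (of_nat (n + 2) * f * pderiv (pderiv f))"
      "rat_poly (of_nat (n + 1) * (pderiv f)\<^sup>2)"
    by (intro rat_poly_mult rat_poly_power rat_poly_pderiv; blast)+
  then have "rat_poly (of_nat (n + 2) * f * pderiv (pderiv f) - of_nat (n + 1) * (pderiv f)\<^sup>2)"
    unfolding coeff_diff by (blast intro: Rats_diff)
  then have hess: "rat_poly (smult J ((u * v) ^ n))"
    unfolding diagonal_hessian[OF u_def v_def f_def] J_def .
  have uv: "u * v = [:\<alpha> * \<gamma>, \<alpha> * \<delta> + \<beta> * \<gamma>, \<beta> * \<delta>:]" by (simp add: u_def v_def)
  have "\<alpha> * \<gamma> \<noteq> 0 \<or> \<alpha> * \<delta> + \<beta> * \<gamma> \<noteq> 0" using nz by auto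
  then obtain e where e: "e \<noteq> 0" "\<alpha> * \<gamma> / e \<in> \<rat>" "(\<alpha> * \<delta> + \<beta> * \<gamma>) / e \<in> \<rat>" "\<beta> * \<delta> / e \<in> \<rat>"
    using quadratic_power_rational[OF hess[unfolded uv] n(2) J] by blast
  obtain A1 n1 where 1: "n1 \<noteq> 0" "\<alpha> * \<gamma> / e * of_int n1 = of_int A1"
    using Rats_int_multiple[OF e(2)] by blast
  obtain B1 n2 where 2: "n2 \<noteq> 0" "(\<alpha> * \<delta> + \<beta> * \<gamma>) / e * of_int n2 = of_int B1"
    using Rats_int_multiple[OF e(3)] by blast
  obtain C1 n3 where 3: "n3 \<noteq> 0" "\<beta> * \<delta> / e * of_int n3 = of_int C1"
    using Rats_int_multiple[OF e(4)] by blast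
  define A B C where "A = A1 * n2 * n3" and "B = B1 * n1 * n3" and "C = C1 * n1 * n2"
  define \<chi> where "\<chi> = e / of_int (n1 * n2 * n3)"
  have \<chi>: "\<chi> \<noteq> 0" using e 1 2 3 by (simp add: \<chi>_def)
  have cA: "\<alpha> * \<gamma> = \<chi> * of_int A" using e(1) 1(1) 2(1) 3(1)
    by (simp add: \<chi>_def A_def 1(2)[symmetric])
  have cB: "\<alpha> * \<delta> + \<beta> * \<gamma> = \<chi> * of_int B" using e(1) 1(1) 2(1) 3(1)
    by (simp add: \<chi>_def B_def 2(2)[symmetric])
  have cC: "\<beta> * \<delta> = \<chi> * of_int C" using e(1) 1(1) 2(1) 3(1)
    by (simp add: \<chi>_def C_def 3(2)[symmetric])
  have rep: "(\<alpha> * x + \<beta> * y) * (\<gamma> * x + \<delta> * y) =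
        \<chi> * (of_int A * x\<^sup>2 + of_int B * x * y + of_int C * y\<^sup>2)" for x y
  proof -
    have "(\<alpha> * x + \<beta> * y) * (\<gamma> * x + \<delta> * y) =
        (\<alpha> * \<gamma>) * x\<^sup>2 + (\<alpha> * \<delta> + \<beta> * \<gamma>) * x * y + (\<beta> * \<delta>) * y\<^sup>2"
      by (simp add: power2_eq_square algebra_simps)
    then show ?thesis by (simp add: cA cB cC algebra_simps)
  qed
  define D where "D = B\<^sup>2 - 4 * A * C"
  have "(\<alpha> * \<delta> - \<beta> * \<gamma>)\<^sup>2 = (\<alpha> * \<delta> + \<beta> * \<gamma>)\<^sup>2 - 4 * (\<alpha> * \<gamma>) * (\<beta> * \<delta>)"
    by (simp add: power2_eq_square algebra_simps)
  then have disc: "(\<alpha> * \<delta> - \<beta> * \<gamma>)\<^sup>2 = \<chi>\<^sup>2 * of_int D"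
    by (simp add: cA cB cC D_def power2_eq_square algebra_simps)
  define Q :: "complex poly" where "Q = [:of_int A, of_int B, of_int C:]"
  have uvQ: "u * v = smult \<chi> Q" by (simp add: uv cA cB cC Q_def)
  have "Q \<noteq> 0" using nz disc by (auto simp: Q_def D_def)
  then have "Q ^ n \<noteq> 0" by simp
  then obtain i where i: "coeff (Q ^ n) i \<noteq> 0" by (auto simp: poly_eq_iff)
  have "rat_poly Q" by (auto simp: Q_def coeff_pCons split: nat.split)
  then have Qn: "coeff (Q ^ n) i \<in> \<rat>" using rat_poly_power by blast
  define K where "K = - of_nat ((n + 2)\<^sup>2 * (n + 1)) * (of_int D :: complex)"
  have "J * \<chi> ^ n = K * \<chi> ^ r" unfolding J_def K_def disc n(1) power_add
    by (simp only: mult_ac)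
  moreover have "coeff (smult J ((u * v) ^ n)) i = J * \<chi> ^ n * coeff (Q ^ n) i"
    by (simp add: uvQ smult_power mult.assoc)
  ultimately have "K * \<chi> ^ r * coeff (Q ^ n) i \<in> \<rat>" using hess by metis
  moreover have "K \<noteq> 0"
    using J disc by (auto simp: J_def K_def)
  moreover have "K \<in> \<rat>" unfolding K_def by (intro Rats_mult Rats_minus_iff[THEN iffD2]) auto
  ultimately have "K * \<chi> ^ r * coeff (Q ^ n) i / (K * coeff (Q ^ n) i) \<in> \<rat>"
    using Qn by (blast intro: Rats_divide Rats_mult)
  then have "\<chi> ^ r \<in> \<rat>" using \<open>K \<noteq> 0\<close> i by simp
  then show ?thesis using rep by (auto simp: quadratic_rep_def)
qed

end

theory Submission
  imports Defs "HOL-Analysis.Complex_Transcendental"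
    "HOL-Computational_Algebra.Formal_Power_Series"
begin

text \<open>The proof is the hypergeometric method of Thue and Siegel. Write \<open>F = u^r - v^r\<close> with linear
  forms \<open>u, v\<close> and \<open>j = \<alpha>\<delta> - \<beta>\<gamma>\<close>, so that \<open>|\<Delta>| = |j|^(r(r-1)) r^r\<close>. Two independent solutions
  satisfy \<open>|u\<^sub>1 v\<^sub>2 - v\<^sub>1 u\<^sub>2| \<ge> |j|\<close>, so up to sign at most one solution has
  \<open>max(|u|,|v|)\<^sup>2 < |j|/2\<close>. Any other solution has \<open>v/u\<close> very close to an \<open>r\<close>-th root of unity, and it
  remains to see that two independent such solutions cannot be close to the same root. Otherwise,
  multiplying \<open>v\<close> by a root of unity, both \<open>v\<^sub>i/u\<^sub>i\<close> are close to 1. With the diagonal Pade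
  approximants \<open>A\<^sub>n(1,T) / A\<^sub>n(T,1)\<close> of \<open>T^(1/r)\<close>, the number
  \<open>u\<^sub>1 v\<^sub>2 A\<^sub>n(u\<^sub>1^r, v\<^sub>1^r) - v\<^sub>1 u\<^sub>2 A\<^sub>n(v\<^sub>1^r, u\<^sub>1^r)\<close> is, up to a controlled factor, a difference of
  conjugate quadratic integers, which bounds it from below unless it vanishes, and it does not vanish
  for two consecutive \<open>n\<close>. Comparing with the upper bound from the approximation property shows by
  induction on \<open>n\<close> that the second solution exceeds every power of the first.

  When \<open>D > 0\<close>, the roots of unity that occur agree up to sign, so only one or two of them occur; for a
  definite form none does.\<close>

text \<open>The obstacle is integrality. Neither u, v nor their r-th powers need be quadratic
  integers; \<open>r (w - w') u^r\<close> and \<open>u p * v q / \<kappa>\<close> are, where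
  \<open>w\<close>, \<open>w'\<close> are the roots of z^2 - B z + A C, and the coefficients of A_n
  have denominators dividing r^(2n). Clearing everything costs (r^3 |w - w'|)^n, so |w - w'| = sqrt
  |D| must be small against the discriminant. For arbitrary (A, B, C) this fails, as scaling changes
  D but not the form. For coprime A, B, C the number (r (w - w'))^2 \<kappa>^r is a nonzero integer,
  which together with j = \<kappa> (w - w') gives |w - w'|^(r-2) <= r^2 |j|^r. The hypothesis acts
  through \<Omega> = (|j|/2)^r alone, since \<Delta>' = (\<Omega> / h^2)^(r-1).\<close>

unbundle fps_syntax

section \<open>Coefficients of the Pade approximants\<close>

text \<open>The binomial series of (1 + r^2 X)^a; the scaling by r^2 makes its coefficients integers
  as soon as r a is a natural number.\<close>

definition scaled_binomial_fps :: "nat \<Rightarrow> real \<Rightarrow> real fps" where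
  "scaled_binomial_fps r a = Abs_fps (\<lambda>m. real r ^ (2 * m) * (a gchoose m))"

lemma scaled_binomial_fps_add:
  "scaled_binomial_fps r (a + b) = scaled_binomial_fps r a * scaled_binomial_fps r b"
proof (rule fps_ext)
  fix m
  have "real r ^ (2 * m) * (\<Sum>k\<le>m. (a gchoose k) * (b gchoose (m - k))) =
     (\<Sum>k\<le>m. (real r ^ (2 * k) * (a gchoose k)) * (real r ^ (2 * (m - k)) * (b gchoose (m - k))))"
    unfolding sum_distrib_left
  proof (rule sum.cong[OF refl])
    fix k assume "k \<in> {..m}"
    then have "2 * m = 2 * k + 2 * (m - k)" by simp
    then have "real r ^ (2 * m) = real r ^ (2 * k) * real r ^ (2 * (m - k))"
      by (simp only: power_add)
    then show "real r ^ (2 * m) * ((a gchoose k) * (b gchoose (m - k))) =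
        (real r ^ (2 * k) * (a gchoose k)) * (real r ^ (2 * (m - k)) * (b gchoose (m - k)))"
      by (simp only: mult_ac)
  qed
  then show "scaled_binomial_fps r (a + b) $ m =
      (scaled_binomial_fps r a * scaled_binomial_fps r b) $ m"
    by (simp add: scaled_binomial_fps_def fps_mult_nth gbinomial_Vandermonde[symmetric] atLeast0AtMost)
qed

lemma scaled_binomial_fps_power:
  "scaled_binomial_fps r (real k * a) = scaled_binomial_fps r a ^ k"
proof (induction k)
  case 0
  show ?case by (rule fps_ext) (simp add: scaled_binomial_fps_def gbinomial_0_left)
next
  case (Suc k)
  have "real (Suc k) * a = a + real k * a" by (simp add: algebra_simps)
  then show ?case using Suc by (simp only: scaled_binomial_fps_add power_Suc)
qed

lemma scaled_binomial_fps_1: "scaled_binomial_fps r 1 = 1 + fps_const (real r ^ 2) * fps_X"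
proof (rule fps_ext)
  fix m
  have "((1::real) gchoose m) = (if m \<le> 1 then 1 else 0)"
    using binomial_gbinomial[of 1 m, where 'a = real]
    by (cases "m \<le> 1") (auto simp: le_Suc_eq binomial_eq_0)
  then show "scaled_binomial_fps r 1 $ m = (1 + fps_const (real r ^ 2) * fps_X) $ m"
    by (auto simp: scaled_binomial_fps_def fps_X_def le_Suc_eq)
qed

lemma fps_mult_nth_Ints:
  fixes g h :: "real fps"
  assumes "\<And>i. i \<le> N \<Longrightarrow> g $ i \<in> \<int>" "\<And>i. i \<le> N \<Longrightarrow> h $ i \<in> \<int>" "m \<le> N"
  shows "(g * h) $ m \<in> \<int>"
  unfolding fps_mult_nth using assms by (auto intro!: Ints_sum Ints_mult)

lemma fps_power_nth_Ints:
  fixes g :: "real fps"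
  assumes "\<And>i. i \<le> N \<Longrightarrow> g $ i \<in> \<int>" "m \<le> N"
  shows "(g ^ k) $ m \<in> \<int>"
  using assms(2)
proof (induction k arbitrary: m)
  case 0
  then show ?case by simp
next
  case (Suc k)
  then show ?case unfolding power_Suc by (intro fps_mult_nth_Ints[of N]) (use assms in auto)
qed

text \<open>Writing the \<open>r\<close>-th root of \<open>1 + r\<^sup>2 X\<close> as \<open>1 + r g\<close>, the equation
  \<open>(1 + r g)^r = 1 + r\<^sup>2 X\<close> determines \<open>g\<close> recursively with integer coefficients.\<close>

lemma scaled_binomial_root_Ints:
  assumes "r \<ge> 2"
  shows "scaled_binomial_fps r (1 / real r) $ m \<in> \<int>"
proof -
  define f where "f = scaled_binomial_fps r (1 / real r)"
  define g where "g = fps_const (1 / real r) * (f - 1)"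
  have r: "real r \<noteq> 0" using assms by simp
  have f0: "f $ 0 = 1" by (simp add: f_def scaled_binomial_fps_def)
  have g0: "g $ 0 = 0" by (simp add: g_def f0)
  have fg: "f = fps_const (real r) * g + 1"
    using r by (simp add: g_def mult.assoc[symmetric])
  have fr: "f ^ r = 1 + fps_const (real r ^ 2) * fps_X"
    using scaled_binomial_fps_power[of r r "1 / real r"] r scaled_binomial_fps_1
    by (simp add: f_def)
  \<comment> \<open>An integer because k >= 2: in the expansion of (1 + r g)^r the linear term is
    r^2 g, so dividing by r^2 leaves g with coefficient 1 and integer coefficients
    elsewhere.\<close>
  define c where "c k = real (r choose k) * real r ^ (k - 2)" for k
  have "g = fps_X - (\<Sum>k=2..r. fps_const (c k) * g ^ k)"
  proof -
    have split: "{..r} = {0, 1} \<union> {2..r}" using assms by auto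
    have "f ^ r = (\<Sum>k\<le>r. of_nat (r choose k) * (fps_const (real r) * g) ^ k * 1 ^ (r - k))"
      unfolding fg by (rule binomial_ring)
    also have "\<dots> = 1 + fps_const (real r ^ 2) * g +
        (\<Sum>k=2..r. of_nat (r choose k) * (fps_const (real r) * g) ^ k)"
      unfolding split
      by (subst sum.union_disjoint)
         (auto simp: fps_of_nat[symmetric] power2_eq_square simp flip: fps_const_mult)
    also have "(\<Sum>k=2..r. of_nat (r choose k) * (fps_const (real r) * g) ^ k) =
        fps_const (real r ^ 2) * (\<Sum>k=2..r. fps_const (c k) * g ^ k)"
      unfolding sum_distrib_left
    proof (rule sum.cong[OF refl])
      fix k assume "k \<in> {2..r}"
      then obtain l where "k = 2 + l" by (auto simp: le_iff_add)
      then have "real r ^ k = real r ^ 2 * real r ^ (k - 2)" by (simp only: power_add) simp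
      then have eqc: "real (r choose k) * real r ^ k = real r ^ 2 * c k"
        by (simp only: c_def mult.left_commute)
      have "of_nat (r choose k) * (fps_const (real r) * g) ^ k =
          fps_const (real (r choose k) * real r ^ k) * g ^ k"
        by (simp only: power_mult_distrib fps_const_power fps_const_mult[symmetric]
            fps_of_nat[of "r choose k", symmetric] mult.assoc)
      then show "of_nat (r choose k) * (fps_const (real r) * g) ^ k =
          fps_const (real r ^ 2) * (fps_const (c k) * g ^ k)"
        unfolding eqc fps_const_mult[symmetric] mult.assoc .
    qed
    finally have "fps_const (real r ^ 2) * fps_X =
        fps_const (real r ^ 2) * (g + (\<Sum>k=2..r. fps_const (c k) * g ^ k))"
      unfolding fr by (simp add: algebra_simps)
    moreover have "fps_const (real r ^ 2) \<noteq> 0" using r by simp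
    ultimately have "fps_X = g + (\<Sum>k=2..r. fps_const (c k) * g ^ k)"
      by (metis mult_left_cancel)
    then show ?thesis by (simp add: algebra_simps)
  qed
  then have rec: "g $ m = fps_X $ m - (\<Sum>k=2..r. c k * (g ^ k) $ m)" for m
    by (metis (no_types, lifting) fps_sub_nth fps_sum_nth fps_mult_left_const_nth sum.cong)
  have gi: "g $ m \<in> \<int>" for m
  proof (induction m rule: less_induct)
    case (less m)
    have "(g ^ k) $ m \<in> \<int>" if k: "k \<ge> 2" for k
    proof -
      \<comment> \<open>\<open>g\<close> has no constant term, so coefficient \<open>m\<close> of
        \<open>g ^ k\<close> with k >= 2 involves only coefficients of \<open>g\<close> of index at
        most m - k + 1 < m.\<close>
      define h where "h = fps_shift 1 g"
      have gh: "g = fps_X * h" using g0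
        by (intro fps_ext) (simp add: h_def)
      have "(g ^ k) $ m = (if m < k then 0 else (h ^ k) $ (m - k))"
        unfolding gh power_mult_distrib by (simp add: fps_X_power_mult_nth)
      moreover have "(h ^ k) $ (m - k) \<in> \<int>" if "k \<le> m"
        using k that less by (intro fps_power_nth_Ints[of "m - k"]) (auto simp: h_def)
      ultimately show ?thesis by auto
    qed
    moreover have "c k \<in> \<int>" for k by (simp add: c_def)
    moreover have "fps_X $ m \<in> (\<int> :: real set)" by (simp add: fps_X_def)
    ultimately show ?case unfolding rec[of m]
      by (intro Ints_diff Ints_sum Ints_mult) auto
  qed
  have "f $ m = real r * g $ m + (1 :: real fps) $ m" by (simp add: fg)
  also have "\<dots> \<in> \<int>" by (intro Ints_add Ints_mult gi) (auto simp: fps_one_nth)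
  finally show ?thesis by (simp add: f_def)
qed

lemma scaled_gbinomial_Ints:
  assumes "r \<ge> 2"
  shows "real r ^ (2 * m) * ((real c / real r) gchoose m) \<in> \<int>"
proof -
  have "scaled_binomial_fps r (real c / real r) = scaled_binomial_fps r (1 / real r) ^ c"
    using scaled_binomial_fps_power[of r c "1 / real r"] by simp
  moreover have "(scaled_binomial_fps r (1 / real r) ^ c) $ m \<in> \<int>"
    by (rule fps_power_nth_Ints[of m]) (use assms scaled_binomial_root_Ints in auto)
  ultimately have "scaled_binomial_fps r (real c / real r) $ m \<in> \<int>" by simp
  then show ?thesis by (simp add: scaled_binomial_fps_def)
qed

text \<open>Coefficients of the hypergeometric polynomial 2F1(-n, -n - 1/r; 1 - 1/r; T), multiplied
  by (n - 1/r choose n). The product form displays positivity, the common denominator r^(2n) and, by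
  Vandermonde, the sum.\<close>

definition pade_coeff :: "nat \<Rightarrow> nat \<Rightarrow> nat \<Rightarrow> real" where
  "pade_coeff r n m = ((real n + 1 / real r) gchoose m) * ((real n - 1 / real r) gchoose (n - m))"

lemma pade_coeff_Ints:
  assumes "r \<ge> 2" "m \<le> n"
  shows "real r ^ (2 * n) * pade_coeff r n m \<in> \<int>"
proof (cases "n = 0")
  case True
  then show ?thesis using assms by (simp add: pade_coeff_def)
next
  case False
  have 1: "real n + 1 / real r = real (n * r + 1) / real r" using assms by (simp add: field_simps)
  have "n * r \<ge> 1" using False assms by simp
  then have 2: "real n - 1 / real r = real (n * r - 1) / real r"
    using assms by (simp add: field_simps of_nat_diff)
  have "2 * n = 2 * m + 2 * (n - m)" using assms by simp
  then have "real r ^ (2 * n) = real r ^ (2 * m) * real r ^ (2 * (n - m))" by (simp only: power_add)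
  then have "real r ^ (2 * n) * pade_coeff r n m =
      (real r ^ (2 * m) * ((real n + 1 / real r) gchoose m)) *
      (real r ^ (2 * (n - m)) * ((real n - 1 / real r) gchoose (n - m)))"
    by (simp add: pade_coeff_def mult_ac)
  then show ?thesis unfolding 1 2
    using Ints_mult[OF scaled_gbinomial_Ints[OF assms(1)] scaled_gbinomial_Ints[OF assms(1)]]
    by (simp only:)
qed

lemma pade_coeff_pos:
  assumes "r \<ge> 2" "m \<le> n"
  shows "pade_coeff r n m > 0"
proof -
  have r: "1 / real r < 1" "1 / real r > 0" using assms by auto
  have "(\<Prod>i = 0..<m. real n + 1 / real r - real i) > 0"
  proof (rule prod_pos)
    fix i assume "i \<in> {0..<m}"
    then have "real i \<le> real n" using assms by simp
    then show "real n + 1 / real r - real i > 0" using r by linarith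
  qed
  moreover have "(\<Prod>i = 0..<n - m. real n - 1 / real r - real i) > 0"
  proof (rule prod_pos)
    fix i assume "i \<in> {0..<n - m}"
    then have "real i + 1 \<le> real n" by simp
    then show "real n - 1 / real r - real i > 0" using r by linarith
  qed
  ultimately show ?thesis by (simp add: pade_coeff_def gbinomial_prod_rev)
qed

lemma pade_coeff_sum: "(\<Sum>m\<le>n. pade_coeff r n m) \<le> 4 ^ n"
proof -
  have "(\<Sum>m\<le>n. pade_coeff r n m) =
      ((real n + 1 / real r) + (real n - 1 / real r)) gchoose n"
    unfolding pade_coeff_def using gbinomial_Vandermonde[of "real n + 1 / real r"]
    by (simp only: atLeast0AtMost)
  also have "\<dots> = real (2 * n choose n)" by (simp add: binomial_gbinomial)
  also have "\<dots> \<le> real (2 ^ (2 * n))"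
    unfolding of_nat_le_iff by (rule binomial_le_pow2)
  finally show ?thesis by (simp add: power_mult)
qed

section \<open>Pade coefficients as interpolation weights\<close>

lemma sum_lagrange_weights:
  fixes S :: "real set" and p :: "real poly"
  assumes "finite S" "degree p + 1 < card S"
  shows "(\<Sum>e\<in>S. poly p e / (\<Prod>f\<in>S - {e}. e - f)) = 0"
proof -
  define W where "W e = (\<Prod>f\<in>S - {e}. [:- f, 1:])" for e
  define q where "q = (\<Sum>e\<in>S. smult (poly p e / (\<Prod>f\<in>S - {e}. e - f)) (W e))"
  have degW: "degree (W e) = card S - 1" if "e \<in> S" for e
    using assms(1) that by (simp add: W_def degree_prod_sum_eq)
  have leadW: "coeff (W e) (card S - 1) = 1" if "e \<in> S" for e
  proof -
    have "lead_coeff (W e) = 1" by (simp add: W_def lead_coeff_prod)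
    then show ?thesis using degW[OF that] by simp
  qed
  have pq: "poly q x = poly p x" if x: "x \<in> S" for x
  proof -
    have W0: "poly (W e) x = 0" if "e \<in> S" "e \<noteq> x" for e
      using assms(1) x that by (auto simp: W_def poly_prod prod_zero_iff)
    have nz: "(\<Prod>f\<in>S - {x}. x - f) \<noteq> 0" using assms(1) by auto
    have "poly q x = (\<Sum>e\<in>S. poly p e / (\<Prod>f\<in>S - {e}. e - f) * poly (W e) x)"
      by (simp add: q_def poly_sum)
    also have "\<dots> = poly p x / (\<Prod>f\<in>S - {x}. x - f) * poly (W x) x"
      using assms(1) x W0 by (subst sum.remove[of S x]) auto
    also have "poly (W x) x = (\<Prod>f\<in>S - {x}. x - f)" by (simp add: W_def poly_prod)
    finally show ?thesis using nz by simp
  qed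
  have "degree q \<le> card S - 1"
    unfolding q_def by (intro degree_sum_le assms(1)) (auto simp: degW intro: degree_smult_le order_trans)
  have "q = p"
  proof (rule ccontr)
    assume "q \<noteq> p"
    then have nz: "q - p \<noteq> 0" by simp
    have "S \<subseteq> {x. poly (q - p) x = 0}" using pq by auto
    then have "card S \<le> card {x. poly (q - p) x = 0}" by (intro card_mono poly_roots_finite nz)
    also have "\<dots> \<le> degree (q - p)" by (rule card_poly_roots_bound[OF nz])
    also have "\<dots> \<le> card S - 1"
      using \<open>degree q \<le> card S - 1\<close> assms(2) by (intro degree_diff_le) auto
    finally show False using assms(2) by simp
  qed
  \<comment> \<open>The asserted sum is the top coefficient of the Lagrange interpolant
    \<open>q\<close>, that is, the divided difference of \<open>p\<close> over \<open>S\<close>; the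
    degree of \<open>p\<close> is too small for it.\<close>
  then have "coeff q (card S - 1) = 0" using assms(2) by (simp add: coeff_eq_0)
  moreover have "coeff q (card S - 1) = (\<Sum>e\<in>S. poly p e / (\<Prod>f\<in>S - {e}. e - f))"
    unfolding q_def coeff_sum by (intro sum.cong) (auto simp: leadW simp del: One_nat_def)
  ultimately show ?thesis by simp
qed

lemma prod_differences:
  assumes "m \<le> n"
  shows "(\<Prod>k\<in>{..n} - {m}. real m - real k) = (- 1) ^ (n - m) * fact m * fact (n - m)"
proof -
  have split: "{..n} - {m} = {0..<m} \<union> {m<..n}" using assms by auto
  have "(\<Prod>k\<in>{m<..n}. real m - real k) = (\<Prod>i\<in>{1..n - m}. - real i)"
    by (rule prod.reindex_bij_witness[of _ "\<lambda>i. i + m" "\<lambda>k. k - m"]) (auto simp: of_nat_diff)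
  also have "\<dots> = (\<Prod>i\<in>{1..n - m}. (- 1) * real i)" by simp
  also have "\<dots> = (- 1) ^ (n - m) * fact (n - m)"
    by (simp only: prod.distrib fact_prod) simp
  finally have "(\<Prod>k\<in>{m<..n}. real m - real k) = (- 1) ^ (n - m) * fact (n - m)" .
  moreover have "(\<Prod>k\<in>{0..<m}. real m - real k) = fact m"
    by (simp add: fact_prod_rev of_nat_diff)
  ultimately show ?thesis unfolding split by (subst prod.union_disjoint) auto
qed

text \<open>The right-hand side is independent of \<open>m\<close>: up to one constant, the Pade
  coefficients are the reciprocals of the products of differences from m to all other nodes among 0,
  ..., n and \<mu>, ..., n + \<mu>. It is used with \<mu> = 1/r at the integer nodes and \<mu> =
  -1/r at the shifted ones.\<close>

lemma pade_weight:
  fixes \<mu> :: real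
  assumes "m \<le> n"
  shows "((real n + \<mu>) gchoose m) * ((real n - \<mu>) gchoose (n - m)) *
     ((\<Prod>k\<in>{..n} - {m}. real m - real k) * (\<Prod>k\<le>n. real m - real k - \<mu>)) =
     (\<Prod>i\<le>n. real i - \<mu>) * (\<Prod>i\<in>{0<..n}. real i + \<mu>)"
proof -
  have A1: "(\<Prod>i = 0..<m. real n + \<mu> - real i) = (\<Prod>k\<in>{n - m<..n}. real k + \<mu>)"
    by (rule prod.reindex_bij_witness[of _ "\<lambda>k. n - k" "\<lambda>i. n - i"])
       (use assms in \<open>auto simp: of_nat_diff\<close>)
  have A2: "(\<Prod>i = 0..<n - m. real n - \<mu> - real i) = (\<Prod>k\<in>{m<..n}. real k - \<mu>)"
    by (rule prod.reindex_bij_witness[of _ "\<lambda>k. n - k" "\<lambda>i. n - i"])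
       (use assms in \<open>auto simp: of_nat_diff\<close>)
  have A3: "(\<Prod>k\<le>m. real m - real k - \<mu>) = (\<Prod>i\<le>m. real i - \<mu>)"
    by (rule prod.reindex_bij_witness[of _ "\<lambda>k. m - k" "\<lambda>i. m - i"]) (auto simp: of_nat_diff)
  have "(\<Prod>k\<in>{m<..n}. real m - real k - \<mu>) = (\<Prod>i\<in>{0<..n - m}. (- 1) * (real i + \<mu>))"
    by (rule prod.reindex_bij_witness[of _ "\<lambda>i. i + m" "\<lambda>k. k - m"]) (auto simp: of_nat_diff)
  then have A4: "(\<Prod>k\<in>{m<..n}. real m - real k - \<mu>) =
      (- 1) ^ (n - m) * (\<Prod>i\<in>{0<..n - m}. real i + \<mu>)"
    by (simp only: prod.distrib) simp
  have s1: "{..n} = {..m} \<union> {m<..n}" "{0<..n} = {0<..n - m} \<union> {n - m<..n}" using assms by auto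
  have e1: "(\<Prod>k\<le>n. real m - real k - \<mu>) =
      (\<Prod>i\<le>m. real i - \<mu>) * ((- 1) ^ (n - m) * (\<Prod>i\<in>{0<..n - m}. real i + \<mu>))"
    unfolding s1(1) A3[symmetric] A4[symmetric] by (rule prod.union_disjoint) auto
  have e2: "(\<Prod>i\<le>n. real i - \<mu>) = (\<Prod>i\<le>m. real i - \<mu>) * (\<Prod>k\<in>{m<..n}. real k - \<mu>)"
    unfolding s1(1) by (rule prod.union_disjoint) auto
  have e3: "(\<Prod>i\<in>{0<..n}. real i + \<mu>) =
      (\<Prod>i\<in>{0<..n - m}. real i + \<mu>) * (\<Prod>k\<in>{n - m<..n}. real k + \<mu>)"
    unfolding s1(2) by (rule prod.union_disjoint) auto
  have e4: "((real n + \<mu>) gchoose m) * fact m = (\<Prod>k\<in>{n - m<..n}. real k + \<mu>)"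
    unfolding gbinomial_mult_fact' A1 ..
  have e5: "((real n - \<mu>) gchoose (n - m)) * fact (n - m) = (\<Prod>k\<in>{m<..n}. real k - \<mu>)"
    unfolding gbinomial_mult_fact' A2 ..
  have e6: "((- 1) ^ (n - m) * (- 1) ^ (n - m) :: real) = 1"
    by (simp add: power_mult_distrib[symmetric])
  have e7: "a * b * ((e * f * g) * (p * (e * q))) = (p * (b * g)) * (q * (a * f))"
    if "e * e = 1" for a b e f g p q :: real
    using that by algebra
  show ?thesis unfolding prod_differences[OF assms] e1 e2 e3 e4[symmetric] e5[symmetric]
    by (rule e7[OF e6])
qed

text \<open>The divided difference over the 2n + 2 nodes 0, ..., n and 1/r, ..., n + 1/r kills
  polynomials of degree up to 2n; by \<open>pade_weight\<close> its weights are the Pade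
  coefficients on one half and, with opposite sign, the reversed ones on the other.\<close>

lemma pade_moments:
  assumes "r \<ge> 2" "degree p \<le> 2 * n"
  shows "(\<Sum>m\<le>n. pade_coeff r n m * poly p (real m)) =
     (\<Sum>m\<le>n. pade_coeff r n (n - m) * poly p (real m + 1 / real r))"
proof -
  define \<nu> where "\<nu> = 1 / real r"
  have \<nu>: "0 < \<nu>" "\<nu> < 1" using assms by (auto simp: \<nu>_def)
  define S1 S2 where "S1 = real ` {..n}" and "S2 = (\<lambda>m. real m + \<nu>) ` {..n}"
  define S where "S = S1 \<union> S2"
  have ne: "real i \<noteq> real j + \<nu>" for i j :: nat
  proof
    assume "real i = real j + \<nu>"
    then have "real j < real i" "real i < real (j + 1)" using \<nu> by auto
    then show False by (simp only: of_nat_less_iff)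
  qed
  have disj: "S1 \<inter> S2 = {}" using ne by (auto simp: S1_def S2_def)
  have fin: "finite S1" "finite S2" by (auto simp: S1_def S2_def)
  have inj: "inj_on real {..n}" "inj_on (\<lambda>m. real m + \<nu>) {..n}" by (auto simp: inj_on_def)
  have "card S = 2 * n + 2" unfolding S_def using card_Un_disjoint[OF fin disj] inj
    by (simp add: S1_def S2_def card_image)
  then have lag: "(\<Sum>e\<in>S. poly p e / (\<Prod>f\<in>S - {e}. e - f)) = 0"
    using assms(2) fin by (intro sum_lagrange_weights) (auto simp: S_def)
  define K where "K \<mu> = (\<Prod>i\<le>n. real i - \<mu>) * (\<Prod>i\<in>{0<..n}. real i + \<mu>)" for \<mu>
  have "(\<Prod>i\<in>{0<..n}. real i + \<nu>) \<noteq> 0" using \<nu> by (auto intro!: less_imp_neq[symmetric] add_nonneg_pos)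
  moreover have "real i \<noteq> \<nu>" for i using ne[of i 0] by simp
  ultimately have K0: "K \<nu> \<noteq> 0" by (auto simp: K_def)
  \<comment> \<open>All factors of \<open>K\<close> pair up to i^2 - \<mu>^2 except the one for i =
    0, which is odd in \<mu>.\<close>
  have K_minus: "K (- \<nu>) = - K \<nu>"
  proof -
    have "{..n} = insert 0 {0<..n}" by auto
    then show ?thesis by (simp add: K_def)
  qed
  have inverse_weight: "1 / b = a / k" if "a * b = k" "k \<noteq> 0" for a b k :: real
    using that by auto
  have w1: "1 / (\<Prod>f\<in>S - {real m}. real m - f) = pade_coeff r n m / K \<nu>" if m: "m \<le> n" for m
  proof -
    have "S - {real m} = real ` ({..n} - {m}) \<union> S2" using ne by (auto simp: S_def S1_def S2_def)
    moreover have "real ` ({..n} - {m}) \<inter> S2 = {}" using disj by (auto simp: S1_def)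
    ultimately have "(\<Prod>f\<in>S - {real m}. real m - f) =
        (\<Prod>f\<in>real ` ({..n} - {m}). real m - f) * (\<Prod>f\<in>S2. real m - f)"
      using fin by (simp add: prod.union_disjoint)
    also have "(\<Prod>f\<in>real ` ({..n} - {m}). real m - f) = (\<Prod>k\<in>{..n} - {m}. real m - real k)"
      by (subst prod.reindex) (auto simp: inj_on_def)
    also have "(\<Prod>f\<in>S2. real m - f) = (\<Prod>k\<le>n. real m - real k - \<nu>)"
      unfolding S2_def by (subst prod.reindex) (auto simp: inj_on_def algebra_simps)
    finally have "pade_coeff r n m * (\<Prod>f\<in>S - {real m}. real m - f) = K \<nu>"
      using pade_weight[OF m, of \<nu>] by (simp add: pade_coeff_def \<nu>_def K_def)
    then show ?thesis by (rule inverse_weight[OF _ K0])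
  qed
  have w2: "1 / (\<Prod>f\<in>S - {real m + \<nu>}. real m + \<nu> - f) = - pade_coeff r n (n - m) / K \<nu>"
    if m: "m \<le> n" for m
  proof -
    have "S - {real m + \<nu>} = (\<lambda>k. real k + \<nu>) ` ({..n} - {m}) \<union> S1"
      using ne ne[symmetric] by (auto simp: S_def S1_def S2_def)
    moreover have "(\<lambda>k. real k + \<nu>) ` ({..n} - {m}) \<inter> S1 = {}" using disj by (auto simp: S2_def)
    ultimately have "(\<Prod>f\<in>S - {real m + \<nu>}. real m + \<nu> - f) =
        (\<Prod>f\<in>(\<lambda>k. real k + \<nu>) ` ({..n} - {m}). real m + \<nu> - f) * (\<Prod>f\<in>S1. real m + \<nu> - f)"
      using fin by (simp add: prod.union_disjoint)
    also have "(\<Prod>f\<in>(\<lambda>k. real k + \<nu>) ` ({..n} - {m}). real m + \<nu> - f) =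
        (\<Prod>k\<in>{..n} - {m}. real m - real k)"
      by (subst prod.reindex) (auto simp: inj_on_def)
    also have "(\<Prod>f\<in>S1. real m + \<nu> - f) = (\<Prod>k\<le>n. real m - real k - (- \<nu>))"
      unfolding S1_def by (subst prod.reindex) (auto simp: inj_on_def algebra_simps)
    finally have "pade_coeff r n (n - m) * (\<Prod>f\<in>S - {real m + \<nu>}. real m + \<nu> - f) = K (- \<nu>)"
      using pade_weight[OF m, of "- \<nu>"] m by (simp add: pade_coeff_def \<nu>_def K_def mult_ac)
    then have "- pade_coeff r n (n - m) * (\<Prod>f\<in>S - {real m + \<nu>}. real m + \<nu> - f) = K \<nu>"
      unfolding K_minus by simp
    then show ?thesis by (rule inverse_weight[OF _ K0])
  qed
  have "0 = (\<Sum>e\<in>S1. poly p e * (1 / (\<Prod>f\<in>S - {e}. e - f))) +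
            (\<Sum>e\<in>S2. poly p e * (1 / (\<Prod>f\<in>S - {e}. e - f)))"
    using lag fin disj by (subst (asm) S_def) (simp add: sum.union_disjoint)
  also have "(\<Sum>e\<in>S1. poly p e * (1 / (\<Prod>f\<in>S - {e}. e - f))) =
      (\<Sum>m\<le>n. poly p (real m) * (pade_coeff r n m / K \<nu>))"
    unfolding S1_def by (subst sum.reindex) (auto simp: inj w1 simp del: times_divide_eq_right)
  also have "(\<Sum>e\<in>S2. poly p e * (1 / (\<Prod>f\<in>S - {e}. e - f))) =
      (\<Sum>m\<le>n. poly p (real m + \<nu>) * (- pade_coeff r n (n - m) / K \<nu>))"
    unfolding S2_def by (subst sum.reindex) (auto simp: inj w2 simp del: times_divide_eq_right)
  finally have "0 = ((\<Sum>m\<le>n. pade_coeff r n m * poly p (real m)) -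
      (\<Sum>m\<le>n. pade_coeff r n (n - m) * poly p (real m + \<nu>))) / K \<nu>"
    by (simp add: sum_divide_distrib diff_divide_distrib sum_negf mult.commute)
  then show ?thesis using K0 by (simp add: \<nu>_def)
qed

text \<open>The binomials are the Taylor coefficients of t^(r m) and t^(r m + 1) at t = 1. So the
  identity says that A_n(1, t^r) - t A_n(t^r, 1) vanishes at 1 to order at least 2n + 1; it is
  \<open>pade_moments\<close> for the polynomial x -> (r x choose k) of degree k.\<close>

lemma pade_moments_binomial:
  assumes "r \<ge> 2" "k \<le> 2 * n"
  shows "(\<Sum>m\<le>n. pade_coeff r n m * real (r * m choose k)) =
     (\<Sum>m\<le>n. pade_coeff r n (n - m) * real (r * m + 1 choose k))"
proof -
  define p :: "real poly" where "p = smult (1 / fact k) (\<Prod>i = 0..<k. [:- real i, real r:])"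
  have "degree p \<le> degree (\<Prod>i = 0..<k. [:- real i, real r:])"
    unfolding p_def by (rule degree_smult_le)
  also have "\<dots> \<le> (\<Sum>i = 0..<k. degree [:- real i, real r:])"
    using degree_prod_sum_le[of "{0..<k}" "\<lambda>i. [:- real i, real r:]"] by (simp only: o_def) simp
  also have "\<dots> \<le> (\<Sum>i = 0..<k. 1)" by (intro sum_mono) auto
  finally have deg: "degree p \<le> 2 * n" using assms by simp
  have p: "poly p x = (real r * x) gchoose k" for x
    by (simp add: p_def poly_prod gbinomial_prod_rev algebra_simps)
  have "real r * (real m + 1 / real r) = real (r * m + 1)" for m
    using assms by (simp add: field_simps)
  then show ?thesis using pade_moments[OF assms(1) deg] unfolding p
    by (simp add: binomial_gbinomial)
qed

section \<open>Approximation and determinant\<close>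

text \<open>Homogenized, so that evaluation at (u^r, v^r) needs no division. Exchanging the
  arguments turns the numerator of the approximant into the denominator, which makes the two
  conjugate when the arguments are.\<close>

definition padeA :: "nat \<Rightarrow> nat \<Rightarrow> complex \<Rightarrow> complex \<Rightarrow> complex" where
  "padeA r n X Y = (\<Sum>m\<le>n. of_real (pade_coeff r n m) * Y ^ m * X ^ (n - m))"

lemma padeA_swap:
  "padeA r n Y X = (\<Sum>m\<le>n. of_real (pade_coeff r n (n - m)) * Y ^ m * X ^ (n - m))"
  unfolding padeA_def
  by (rule sum.reindex_bij_witness[of _ "\<lambda>m. n - m" "\<lambda>m. n - m"]) auto

text \<open>Writing \<open>t = 1 + s\<close> and expanding, the first \<open>N\<close> coefficients in \<open>s\<close> cancel; the tail is
  compared with the value of the majorant at \<open>1 + \<rho>\<close>.\<close>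

lemma vanishing_sum_bound:
  fixes t :: complex and c :: "'i \<Rightarrow> real" and e :: "'i \<Rightarrow> nat"
  assumes fin: "finite I"
    and van: "\<And>k. k < N \<Longrightarrow> (\<Sum>i\<in>I. c i * real (e i choose k)) = 0"
    and t: "cmod (t - 1) \<le> \<rho>" and "\<rho> > 0"
  shows "cmod (\<Sum>i\<in>I. of_real (c i) * t ^ e i) \<le>
     (cmod (t - 1) / \<rho>) ^ N * (\<Sum>i\<in>I. \<bar>c i\<bar> * (1 + \<rho>) ^ e i)"
proof -
  define M where "M = (\<Sum>i\<in>I. e i)"
  define s where "s = t - 1"
  have e_le: "e i \<le> M" if "i \<in> I" for i unfolding M_def using fin that by (simp add: member_le_sum)
  have expand: "(1 + x) ^ e i = (\<Sum>k\<le>M. of_nat (e i choose k) * x ^ k)" if "i \<in> I"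
    for i and x :: "'b::comm_ring_1"
  proof -
    have "(1 + x) ^ e i = (\<Sum>k\<le>e i. of_nat (e i choose k) * x ^ k)"
      using binomial_ring[of x 1 "e i"] by (simp add: add.commute)
    also have "\<dots> = (\<Sum>k\<le>M. of_nat (e i choose k) * x ^ k)"
      using e_le[OF that] by (intro sum.mono_neutral_left) (auto simp: binomial_eq_0)
    finally show ?thesis .
  qed
  define d where "d k = (\<Sum>i\<in>I. c i * real (e i choose k))" for k
  define D where "D k = (\<Sum>i\<in>I. \<bar>c i\<bar> * real (e i choose k))" for k
  have dD: "\<bar>d k\<bar> \<le> D k" "0 \<le> D k" for k
  proof -
    have "\<bar>d k\<bar> \<le> (\<Sum>i\<in>I. \<bar>c i * real (e i choose k)\<bar>)" unfolding d_def by (rule sum_abs)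
    then show "\<bar>d k\<bar> \<le> D k" by (simp add: D_def abs_mult)
    then show "0 \<le> D k" by simp
  qed
  have "(\<Sum>i\<in>I. of_real (c i) * t ^ e i) =
      (\<Sum>i\<in>I. of_real (c i) * (\<Sum>k\<le>M. of_nat (e i choose k) * s ^ k))"
    using expand[of _ s] by (intro sum.cong) (auto simp: s_def)
  also have "\<dots> = (\<Sum>k\<le>M. of_real (d k) * s ^ k)"
    unfolding d_def of_real_sum sum_distrib_left sum_distrib_right
    by (subst sum.swap) (simp add: mult.assoc)
  finally have eq: "(\<Sum>i\<in>I. of_real (c i) * t ^ e i) = (\<Sum>k\<le>M. of_real (d k) * s ^ k)" .
  have "cmod (\<Sum>k\<le>M. of_real (d k) * s ^ k) \<le> (\<Sum>k\<le>M. cmod (of_real (d k) * s ^ k))"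
    by (rule norm_sum)
  also have "\<dots> \<le> (\<Sum>k\<le>M. (cmod s / \<rho>) ^ N * (D k * \<rho> ^ k))"
  proof (rule sum_mono)
    fix k
    show "cmod (of_real (d k) * s ^ k) \<le> (cmod s / \<rho>) ^ N * (D k * \<rho> ^ k)"
    proof (cases "k < N")
      case True
      then have "d k = 0" using van by (simp add: d_def)
      then show ?thesis using dD(2)[of k] \<open>\<rho> > 0\<close> by simp
    next
      case False
      have "cmod s ^ k = (cmod s / \<rho>) ^ k * \<rho> ^ k" using \<open>\<rho> > 0\<close> by (simp add: power_divide)
      also have "\<dots> \<le> (cmod s / \<rho>) ^ N * \<rho> ^ k"
        using False t \<open>\<rho> > 0\<close>
        by (intro mult_right_mono power_decreasing) (auto simp: s_def)
      finally have "\<bar>d k\<bar> * cmod s ^ k \<le> D k * ((cmod s / \<rho>) ^ N * \<rho> ^ k)"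
        using dD[of k] by (intro mult_mono) auto
      then show ?thesis by (simp add: norm_mult norm_power mult_ac)
    qed
  qed
  also have "\<dots> = (cmod s / \<rho>) ^ N * (\<Sum>k\<le>M. D k * \<rho> ^ k)" by (simp add: sum_distrib_left)
  also have "(\<Sum>k\<le>M. D k * \<rho> ^ k) =
      (\<Sum>i\<in>I. \<bar>c i\<bar> * (\<Sum>k\<le>M. of_nat (e i choose k) * \<rho> ^ k))"
    unfolding D_def sum_distrib_left sum_distrib_right
    by (subst sum.swap) (simp add: mult.assoc)
  also have "\<dots> = (\<Sum>i\<in>I. \<bar>c i\<bar> * (1 + \<rho>) ^ e i)"
    using expand[of _ \<rho>] by (intro sum.cong) auto
  finally show ?thesis unfolding eq s_def .
qed

text \<open>The expansion in powers of t - 1 once more, read as divisibility of polynomials, as the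
  determinant requires.\<close>

lemma vanishing_sum_dvd:
  fixes c :: "'i \<Rightarrow> real" and e :: "'i \<Rightarrow> nat"
  assumes fin: "finite I"
    and van: "\<And>k. k < N \<Longrightarrow> (\<Sum>i\<in>I. c i * real (e i choose k)) = 0"
  shows "[:- 1, 1:] ^ N dvd (\<Sum>i\<in>I. smult (of_real (c i)) (monom (1 :: complex) (e i)))"
proof -
  define M where "M = (\<Sum>i\<in>I. e i)"
  define s :: "complex poly" where "s = [:- 1, 1:]"
  have e_le: "e i \<le> M" if "i \<in> I" for i unfolding M_def using fin that by (simp add: member_le_sum)
  have expand: "monom 1 (e i) = (\<Sum>k\<le>M. of_nat (e i choose k) * s ^ k)" if "i \<in> I" for i
  proof -
    have "monom 1 (e i) = (s + 1) ^ e i" by (simp add: monom_altdef s_def one_pCons)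
    also have "\<dots> = (\<Sum>k\<le>e i. of_nat (e i choose k) * s ^ k)"
      using binomial_ring[of s 1 "e i"] by simp
    also have "\<dots> = (\<Sum>k\<le>M. of_nat (e i choose k) * s ^ k)"
      using e_le[OF that] by (intro sum.mono_neutral_left) (auto simp: binomial_eq_0)
    finally show ?thesis .
  qed
  define d where "d k = (\<Sum>i\<in>I. c i * real (e i choose k))" for k
  have smult_sum_right: "smult x (\<Sum>k\<le>M. g k) = (\<Sum>k\<le>M. smult x (g k))"
    for x and g :: "nat \<Rightarrow> complex poly"
    by (simp add: poly_eq_iff coeff_sum sum_distrib_left)
  have "(\<Sum>i\<in>I. smult (of_real (c i)) (monom 1 (e i))) =
      (\<Sum>i\<in>I. smult (of_real (c i)) (\<Sum>k\<le>M. of_nat (e i choose k) * s ^ k))"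
    using expand by (intro sum.cong) auto
  also have "\<dots> = (\<Sum>k\<le>M. smult (of_real (d k)) (s ^ k))"
    unfolding smult_sum_right d_def of_real_sum smult_sum
    by (subst sum.swap) (simp add: of_nat_poly)
  finally have eq: "(\<Sum>i\<in>I. smult (of_real (c i)) (monom 1 (e i))) =
      (\<Sum>k\<le>M. smult (of_real (d k)) (s ^ k))" .
  have "s ^ N dvd smult (of_real (d k)) (s ^ k)" for k
  proof (cases "k < N")
    case True
    then have "d k = 0" using van by (simp add: d_def)
    then show ?thesis by simp
  next
    case False
    then show ?thesis by (intro dvd_smult le_imp_power_dvd) simp
  qed
  then show ?thesis unfolding eq s_def[symmetric] by (intro dvd_sum)
qed

text \<open>Both sums merged into one family, True marking the terms of A_n(1, t^r) and False those
  of - t A_n(t^r, 1): the shape on which both vanishing lemmas act.\<close>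

lemma pade_remainder_moments:
  assumes "r \<ge> 2" "k < 2 * n + 1"
  shows "(\<Sum>(b, m)\<in>UNIV \<times> {..n}. (if b then pade_coeff r n m else - pade_coeff r n (n - m)) *
     real ((if b then r * m else r * m + 1) choose k)) = 0"
proof -
  have "k \<le> 2 * n" using assms by simp
  from pade_moments_binomial[OF assms(1) this] show ?thesis
    by (subst sum.cartesian_product[symmetric]) (simp add: UNIV_bool sum_negf)
qed

text \<open>The radius 1/r keeps the majorant small, since (1 + 1/r)^(r m) <= e^m <= 3^n; with 4^n
  for the sum of the coefficients this is the origin of 12^n. The factor 3 is 1 + 2, the 2 bounding
  the extra 1 + 1/r in the second half.\<close>

lemma pade_remainder_bound:
  fixes t :: complex
  assumes "r \<ge> 2" and t: "real r * cmod (t - 1) \<le> 1"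
  shows "cmod (padeA r n 1 (t ^ r) - t * padeA r n (t ^ r) 1) \<le>
     3 * 12 ^ n * (real r * cmod (t - 1)) ^ (2 * n + 1)"
proof -
  define I :: "(bool \<times> nat) set" where "I = UNIV \<times> {..n}"
  define c where "c = (\<lambda>(b, m). if b then pade_coeff r n m else - pade_coeff r n (n - m))"
  define e where "e = (\<lambda>(b, m). if b then r * m else r * m + 1)"
  have r: "real r > 0" using assms by simp
  have fin: "finite I" by (simp add: I_def)
  have van: "(\<Sum>i\<in>I. c i * real (e i choose k)) = 0" if "k < 2 * n + 1" for k
    using pade_remainder_moments[OF assms(1) that]
    by (simp add: I_def c_def e_def case_prod_unfold)
  have split: "(\<Sum>i\<in>I. f i) = (\<Sum>m\<le>n. f (True, m)) + (\<Sum>m\<le>n. f (False, m))"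
    for f :: "bool \<times> nat \<Rightarrow> 'a::comm_monoid_add"
    unfolding I_def using sum.cartesian_product[of "\<lambda>b m. f (b, m)" "{..n}" UNIV]
    by (simp add: UNIV_bool add.commute)
  have eq: "(\<Sum>i\<in>I. of_real (c i) * t ^ e i) = padeA r n 1 (t ^ r) - t * padeA r n (t ^ r) 1"
    unfolding split padeA_swap[of r n "t ^ r" 1] unfolding padeA_def
    by (simp add: c_def e_def power_mult[symmetric] sum_negf sum_distrib_left mult_ac)
  have "(1 + 1 / real r) ^ r \<le> exp (1 / real r) ^ r"
    by (intro power_mono exp_ge_add_one_self) auto
  also have "\<dots> = exp 1" using r by (simp add: exp_of_nat_mult[symmetric])
  also have "\<dots> \<le> 3" by (rule exp_le)
  finally have e3: "(1 + 1 / real r) ^ r \<le> 3" .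
  have p3: "(1 + 1 / real r) ^ (r * m) \<le> 3 ^ n" if "m \<le> n" for m
  proof -
    have "(1 + 1 / real r) ^ (r * m) \<le> 3 ^ m"
      unfolding power_mult using e3 by (intro power_mono) auto
    also have "\<dots> \<le> 3 ^ n" using that by (intro power_increasing) auto
    finally show ?thesis .
  qed
  have "(\<Sum>i\<in>I. \<bar>c i\<bar> * (1 + 1 / real r) ^ e i) =
      (\<Sum>m\<le>n. pade_coeff r n m * (1 + 1 / real r) ^ (r * m)) +
      (\<Sum>m\<le>n. pade_coeff r n (n - m) * (1 + 1 / real r) ^ (r * m + 1))"
    unfolding split using pade_coeff_pos[OF assms(1)]
    by (intro arg_cong2[where f = "(+)"] sum.cong)
       (auto simp: c_def e_def abs_of_pos)
  also have "\<dots> \<le> (\<Sum>m\<le>n. pade_coeff r n m * 3 ^ n) + (\<Sum>m\<le>n. pade_coeff r n (n - m) * (2 * 3 ^ n))"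
  proof (intro add_mono sum_mono mult_left_mono)
    fix m assume m: "m \<in> {..n}"
    show "(1 + 1 / real r) ^ (r * m) \<le> 3 ^ n" using p3 m by simp
    have "(1 + 1 / real r) * (1 + 1 / real r) ^ (r * m) \<le> 2 * 3 ^ n"
      using p3[of m] m assms(1) by (intro mult_mono) auto
    then show "(1 + 1 / real r) ^ (r * m + 1) \<le> 2 * 3 ^ n" by simp
    show "pade_coeff r n m \<ge> 0" "pade_coeff r n (n - m) \<ge> 0"
      using pade_coeff_pos[OF assms(1)] m by (auto intro: less_imp_le)
  qed
  also have "(\<Sum>m\<le>n. pade_coeff r n (n - m) * (2 * 3 ^ n)) = (\<Sum>m\<le>n. pade_coeff r n m * (2 * 3 ^ n))"
    by (rule sum.reindex_bij_witness[of _ "\<lambda>m. n - m" "\<lambda>m. n - m"]) auto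
  also have "(\<Sum>m\<le>n. pade_coeff r n m * 3 ^ n) + (\<Sum>m\<le>n. pade_coeff r n m * (2 * 3 ^ n)) =
      3 * 3 ^ n * (\<Sum>m\<le>n. pade_coeff r n m)"
    by (simp add: sum_distrib_left sum.distrib[symmetric] algebra_simps)
  also have "\<dots> \<le> 3 * 3 ^ n * 4 ^ n" by (intro mult_left_mono pade_coeff_sum) auto
  also have "\<dots> = 3 * 12 ^ n" by (simp add: power_mult_distrib[symmetric])
  finally have maj: "(\<Sum>i\<in>I. \<bar>c i\<bar> * (1 + 1 / real r) ^ e i) \<le> 3 * 12 ^ n" .
  have "cmod (\<Sum>i\<in>I. of_real (c i) * t ^ e i) \<le>
      (cmod (t - 1) / (1 / real r)) ^ (2 * n + 1) * (\<Sum>i\<in>I. \<bar>c i\<bar> * (1 + 1 / real r) ^ e i)"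
    using t r by (intro vanishing_sum_bound fin van) (auto simp: field_simps)
  also have "\<dots> \<le> (cmod (t - 1) / (1 / real r)) ^ (2 * n + 1) * (3 * 12 ^ n)"
    by (intro mult_left_mono maj) auto
  finally show ?thesis unfolding eq by (simp add: mult_ac)
qed

lemma padeA_bound:
  assumes "r \<ge> 2" "cmod Y \<le> 3"
  shows "cmod (padeA r n 1 Y) \<le> 12 ^ n"
proof -
  have "cmod (padeA r n 1 Y) \<le> (\<Sum>m\<le>n. cmod (of_real (pade_coeff r n m) * Y ^ m))"
    unfolding padeA_def by (simp add: norm_sum)
  also have "\<dots> \<le> (\<Sum>m\<le>n. pade_coeff r n m * 3 ^ n)"
  proof (rule sum_mono)
    fix m assume m: "m \<in> {..n}"
    have "cmod Y ^ m \<le> 3 ^ m" using assms by (intro power_mono) auto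
    also have "\<dots> \<le> 3 ^ n" using m by (intro power_increasing) auto
    finally show "cmod (of_real (pade_coeff r n m) * Y ^ m) \<le> pade_coeff r n m * 3 ^ n"
      using pade_coeff_pos[OF assms(1)] m by (simp add: norm_mult norm_power abs_of_pos)
  qed
  also have "\<dots> = 3 ^ n * (\<Sum>m\<le>n. pade_coeff r n m)" by (simp add: sum_distrib_left mult.commute)
  also have "\<dots> \<le> 3 ^ n * 4 ^ n" by (intro mult_left_mono pade_coeff_sum) auto
  also have "\<dots> = 12 ^ n" by (simp add: power_mult_distrib[symmetric])
  finally show ?thesis .
qed

text \<open>t^r - 1 is t - 1 times 1 + t + ... + t^(r-1), which takes the value r at 1; so
  substituting T = t^r does not change the order of vanishing at 1.\<close>

lemma linear_power_dvd_pcompose_monom: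
  fixes p :: "complex poly"
  assumes "r > 0" "[:- 1, 1:] ^ k dvd pcompose p (monom 1 r)"
  shows "[:- 1, 1:] ^ k dvd p"
  using assms(2)
proof (induction k arbitrary: p)
  case 0
  then show ?case by simp
next
  case (Suc k)
  let ?M = "monom (1 :: complex) r" and ?l = "[:- 1, 1:] :: complex poly"
  define S where "S = (\<Sum>i<r. monom (1 :: complex) i)"
  have "poly (pcompose p ?M) 1 = 0"
    using Suc.prems by (auto simp: dvd_def)
  then have "poly p 1 = 0" by (simp add: poly_pcompose poly_monom)
  then obtain q where q: "p = ?l * q"
    by (metis dvd_def dvd_iff_poly_eq_0 minus_minus)
  have "poly (pcompose ?l ?M) x = poly (?l * S) x" for x
    using power_diff_1_eq[of x r] by (simp add: S_def poly_pcompose poly_monom poly_sum algebra_simps)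
  then have "pcompose ?l ?M = ?l * S" by (intro poly_eq_poly_eq_iff[THEN iffD1] ext)
  then have "pcompose p ?M = ?l * (S * pcompose q ?M)" by (simp only: q pcompose_mult mult.assoc)
  then have "?l ^ k dvd S * pcompose q ?M"
    using Suc.prems by (metis dvd_mult_cancel_left power_Suc pCons_eq_0_iff one_neq_zero)
  moreover have "?l ^ k dvd pcompose q ?M" if "pcompose q ?M \<noteq> 0" "?l ^ k dvd S * pcompose q ?M"
  proof -
    have S1: "poly S 1 \<noteq> 0" using assms(1) by (simp add: S_def poly_sum poly_monom)
    then have "S * pcompose q ?M \<noteq> 0" using that by auto
    then have "order 1 (S * pcompose q ?M) = order 1 (pcompose q ?M)"
      using S1 by (simp add: order_mult order_0I)
    then show ?thesis
      using that \<open>S * pcompose q ?M \<noteq> 0\<close> order_divides[of 1 k] by metis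
  qed
  ultimately have "?l ^ k dvd pcompose q ?M" by (cases "pcompose q ?M = 0") auto
  then have "?l ^ k dvd q" by (rule Suc.IH)
  then show ?case unfolding q power_Suc by (rule mult_dvd_mono[OF dvd_refl])
qed

text \<open>Both \<open>A\<^sub>n - t B\<^sub>n\<close> and \<open>A\<^sub>n\<^sub>+\<^sub>1 - t B\<^sub>n\<^sub>+\<^sub>1\<close> vanish at \<open>t = 1\<close> to order at least \<open>2n+1\<close>, so
  the determinant, of degree \<open>2n+1\<close> in \<open>T = t^r\<close>, is a constant times \<open>(T - 1)^(2n+1)\<close>.\<close>

lemma padeA_determinant_nonzero:
  assumes "r \<ge> 2" "X \<noteq> 0" "X \<noteq> Y"
  shows "padeA r n X Y * padeA r (Suc n) Y X - padeA r (Suc n) X Y * padeA r n Y X \<noteq> 0"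
proof -
  define A where "A n = (\<Sum>m\<le>n. monom (of_real (pade_coeff r n m) :: complex) m)" for n
  define B where "B n = (\<Sum>m\<le>n. monom (of_real (pade_coeff r n (n - m)) :: complex) m)" for n
  have coeffs: "coeff (A n) k = (if k \<le> n then of_real (pade_coeff r n k) else 0)"
    "coeff (B n) k = (if k \<le> n then of_real (pade_coeff r n (n - k)) else 0)" for n k
    by (auto simp: A_def B_def coeff_sum if_distrib sum.delta cong: if_cong)
  have pos: "pade_coeff r n n > 0" "pade_coeff r n 0 > 0" for n
    using pade_coeff_pos[OF assms(1)] by auto
  have degs: "degree (A n) = n" "degree (B n) = n" for n
    using pos[of n] by (auto intro!: antisym degree_le le_degree simp: coeffs)
  define p where "p = A n * B (Suc n) - A (Suc n) * B n"
  let ?M = "monom (1 :: complex) r"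
  define Q where "Q n = pcompose (A n) ?M - monom 1 1 * pcompose (B n) ?M" for n
  have Qdvd: "[:- 1, 1:] ^ (2 * n + 1) dvd Q n" for n
  proof -
    let ?I = "(UNIV :: bool set) \<times> {..n}"
    define c where "c = (\<lambda>(b, m). if b then pade_coeff r n m else - pade_coeff r n (n - m))"
    define e where "e = (\<lambda>(b, m). if b then r * m else r * m + 1)"
    have "poly (Q n) t = poly (\<Sum>i\<in>?I. smult (of_real (c i)) (monom 1 (e i))) t" for t
    proof -
      have "poly (\<Sum>i\<in>?I. smult (of_real (c i)) (monom 1 (e i))) t =
          (\<Sum>b\<in>UNIV. \<Sum>m\<le>n. of_real (c (b, m)) * t ^ e (b, m))"
        by (simp add: poly_sum poly_monom sum.cartesian_product case_prod_unfold)
      also have "\<dots> = poly (Q n) t"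
        by (simp add: UNIV_bool Q_def A_def B_def c_def e_def poly_pcompose poly_sum poly_monom
            power_mult sum_negf sum_distrib_left mult.left_commute)
      finally show ?thesis by simp
    qed
    then have eq: "Q n = (\<Sum>i\<in>?I. smult (of_real (c i)) (monom 1 (e i)))"
      by (intro poly_eq_poly_eq_iff[THEN iffD1] ext)
    show ?thesis unfolding eq
      using pade_remainder_moments[OF assms(1), of _ n]
      by (intro vanishing_sum_dvd) (auto simp: c_def e_def case_prod_unfold)
  qed
  \<comment> \<open>The factor t cancels in the determinant, which is thus a combination of the two
    remainders.\<close>
  have pM: "pcompose p ?M = Q n * pcompose (B (Suc n)) ?M - Q (Suc n) * pcompose (B n) ?M"
    by (simp add: p_def Q_def pcompose_diff pcompose_mult algebra_simps)
  have "[:- 1, 1:] ^ (2 * n + 1) dvd Q (Suc n)"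
    using Qdvd[of "Suc n"] by (rule power_le_dvd) simp
  from dvd_diff[OF dvd_mult2[OF Qdvd[of n]] dvd_mult2[OF this]]
  have "[:- 1, 1:] ^ (2 * n + 1) dvd pcompose p ?M" unfolding pM .
  then have "[:- 1, 1:] ^ (2 * n + 1) dvd p"
    by (rule linear_power_dvd_pcompose_monom[rotated]) (use assms(1) in simp)
  then obtain g where g: "p = [:- 1, 1:] ^ (2 * n + 1) * g" by (auto simp: dvd_def)
  define \<nu> where "\<nu> = 1 / real r"
  have \<nu>: "\<nu> > 0" using assms by (simp add: \<nu>_def)
  have top: "coeff (A k * B l) (k + l) = of_real (pade_coeff r k k * pade_coeff r l 0)" for k l
    using coeff_mult_degree_sum[of "A k" "B l"] by (simp add: degs coeffs)
  have cp: "coeff p (2 * n + 1) = of_real (pade_coeff r n n * pade_coeff r (Suc n) 0 -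
      pade_coeff r (Suc n) (Suc n) * pade_coeff r n 0)"
    using top[of n "Suc n"] top[of "Suc n" n] by (simp add: p_def mult_2)
  have s: "real (Suc n) + \<mu> = (real n + \<mu>) + 1" for \<mu> by simp
  have rec: "((real (Suc n) + \<mu>) gchoose Suc n) =
      ((real n + \<mu>) gchoose n) * ((real n + \<mu> + 1) / real (Suc n))" for \<mu> :: real
    unfolding s by (rule gbinomial_rec)
  have r1: "pade_coeff r (Suc n) 0 = pade_coeff r n 0 * ((real n - \<nu> + 1) / real (Suc n))"
    using rec[of "- \<nu>"] by (simp add: pade_coeff_def \<nu>_def)
  have r2: "pade_coeff r (Suc n) (Suc n) = pade_coeff r n n * ((real n + \<nu> + 1) / real (Suc n))"
    using rec[of \<nu>] by (simp add: pade_coeff_def \<nu>_def)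
  have cancel: "x * (y * ((n' - \<nu> + 1) / k)) - (x * ((n' + \<nu> + 1) / k)) * y = x * y * (- 2 * \<nu> / k)"
    if "k \<noteq> 0" for x y k n' :: real
    using that by (simp add: field_simps)
  \<comment> \<open>The two products in the top coefficient differ only in the sign of 1/r, so it is
    not zero. This excludes p = 0 and, with the degree bound, leaves a constant cofactor
    \<open>g\<close>.\<close>
  have "pade_coeff r n n * pade_coeff r (Suc n) 0 -
      pade_coeff r (Suc n) (Suc n) * pade_coeff r n 0 =
      pade_coeff r n n * pade_coeff r n 0 * (- 2 * \<nu> / real (Suc n))"
    unfolding r1 r2 by (rule cancel) simp
  then have "coeff p (2 * n + 1) \<noteq> 0"
    using pos[of n] \<nu> unfolding cp of_real_eq_0_iff by (simp del: of_nat_Suc)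
  have "p \<noteq> 0" using \<open>coeff p (2 * n + 1) \<noteq> 0\<close> by auto
  have "degree p \<le> 2 * n + 1"
    unfolding p_def using degree_mult_le[of "A n" "B (Suc n)"] degree_mult_le[of "A (Suc n)" "B n"]
    by (intro degree_diff_le) (simp_all add: degs)
  moreover have "[:- 1, 1:] ^ (2 * n + 1) \<noteq> (0 :: complex poly)" "g \<noteq> 0"
    using \<open>p \<noteq> 0\<close> g by auto
  then have "degree p = (2 * n + 1) + degree g"
    using degree_mult_eq degree_linear_power[of "- 1 :: complex" "2 * n + 1"] unfolding g by metis
  ultimately have "degree g = 0" by simp
  then obtain k where k: "g = [:k:]" by (rule degree_eq_zeroE)
  have "k \<noteq> 0" using \<open>p \<noteq> 0\<close> g k by auto
  then have nz: "poly p T \<noteq> 0" if "T \<noteq> 1" for T using that by (simp add: g k)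
  have hA: "padeA r n X Y = X ^ n * poly (A n) (Y / X)" for n
    unfolding padeA_def A_def poly_sum sum_distrib_left
  proof (rule sum.cong[OF refl])
    fix m assume "m \<in> {..n}"
    then have "X ^ n = X ^ (n - m) * X ^ m" by (simp add: power_add[symmetric])
    then show "of_real (pade_coeff r n m) * Y ^ m * X ^ (n - m) =
        X ^ n * poly (monom (of_real (pade_coeff r n m)) m) (Y / X)"
      using assms(2) by (simp add: poly_monom power_divide)
  qed
  have hB: "padeA r n Y X = X ^ n * poly (B n) (Y / X)" for n
    unfolding padeA_swap B_def poly_sum sum_distrib_left
  proof (rule sum.cong[OF refl])
    fix m assume "m \<in> {..n}"
    then have "X ^ n = X ^ (n - m) * X ^ m" by (simp add: power_add[symmetric])
    then show "of_real (pade_coeff r n (n - m)) * Y ^ m * X ^ (n - m) =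
        X ^ n * poly (monom (of_real (pade_coeff r n (n - m))) m) (Y / X)"
      using assms(2) by (simp add: poly_monom power_divide)
  qed
  have "padeA r n X Y * padeA r (Suc n) Y X - padeA r (Suc n) X Y * padeA r n Y X =
      X ^ n * X ^ Suc n * poly p (Y / X)"
    unfolding hA hB p_def by (simp add: algebra_simps)
  then show ?thesis using nz[of "Y / X"] assms by auto
qed

section \<open>Conjugate pairs\<close>

text \<open>If \<open>w, w'\<close> are the roots of a monic integer quadratic, this says that \<open>P, P'\<close> are conjugate
  elements of \<open>\<int>[w]\<close>; it is meaningful also when \<open>w\<close> is rational.\<close>

definition conj_pair :: "complex \<Rightarrow> complex \<Rightarrow> complex \<Rightarrow> complex \<Rightarrow> bool" where
  "conj_pair w w' P P' \<longleftrightarrow>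
     (\<exists>m n :: int. P = of_int m + of_int n * w \<and> P' = of_int m + of_int n * w')"

lemma conj_pair_of_int: "conj_pair w w' (of_int k) (of_int k)"
  unfolding conj_pair_def by (intro exI[of _ k] exI[of _ 0]) simp

lemma conj_pair_swap:
  assumes w: "w + w' = of_int b" and "conj_pair w w' P P'"
  shows "conj_pair w w' P' P"
proof -
  obtain m n where 1: "P = of_int m + of_int n * w" "P' = of_int m + of_int n * w'"
    using assms(2) by (auto simp: conj_pair_def)
  have "P' = of_int (m + n * b) + of_int (- n) * w" "P = of_int (m + n * b) + of_int (- n) * w'"
    by (simp_all add: 1 w[symmetric] algebra_simps)
  then show ?thesis unfolding conj_pair_def by blast
qed

lemma conj_pair_add:
  assumes "conj_pair w w' P P'" "conj_pair w w' R R'"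
  shows "conj_pair w w' (P + R) (P' + R')"
proof -
  obtain m n where 1: "P = of_int m + of_int n * w" "P' = of_int m + of_int n * w'"
    using assms(1) by (auto simp: conj_pair_def)
  obtain k l where 2: "R = of_int k + of_int l * w" "R' = of_int k + of_int l * w'"
    using assms(2) by (auto simp: conj_pair_def)
  show ?thesis unfolding conj_pair_def
    by (intro exI[of _ "m + k"] exI[of _ "n + l"]) (simp add: 1 2 algebra_simps)
qed

lemma conj_pair_mult:
  assumes w: "w + w' = of_int b" "w * w' = of_int c"
    and "conj_pair w w' P P'" "conj_pair w w' R R'"
  shows "conj_pair w w' (P * R) (P' * R')"
proof -
  obtain m n where 1: "P = of_int m + of_int n * w" "P' = of_int m + of_int n * w'"
    using assms(3) by (auto simp: conj_pair_def)
  obtain k l where 2: "R = of_int k + of_int l * w" "R' = of_int k + of_int l * w'"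
    using assms(4) by (auto simp: conj_pair_def)
  have sq: "w * w = of_int b * w - of_int c" "w' * w' = of_int b * w' - of_int c"
    unfolding w[symmetric] by (simp_all add: algebra_simps)
  have "P * R = of_int (m * k) + of_int (m * l + n * k) * w + of_int (n * l) * (w * w)"
    by (simp add: 1 2 algebra_simps)
  moreover have "P' * R' = of_int (m * k) + of_int (m * l + n * k) * w' + of_int (n * l) * (w' * w')"
    by (simp add: 1 2 algebra_simps)
  ultimately show ?thesis unfolding conj_pair_def sq
    by (intro exI[of _ "m * k - n * l * c"] exI[of _ "m * l + n * k + n * l * b"])
       (simp add: algebra_simps)
qed

lemma conj_pair_power:
  assumes "w + w' = of_int b" "w * w' = of_int c" "conj_pair w w' P P'"
  shows "conj_pair w w' (P ^ k) (P' ^ k)"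
  using conj_pair_of_int[of w w' 1] conj_pair_mult[OF assms(1,2,3)] by (induction k) auto

lemma conj_pair_sum:
  assumes "\<And>i. i \<in> I \<Longrightarrow> conj_pair w w' (f i) (g i)"
  shows "conj_pair w w' (sum f I) (sum g I)"
  using assms conj_pair_of_int[of w w' 0]
  by (induction I rule: infinite_finite_induct) (auto intro: conj_pair_add)

lemma conj_pair_norm_Ints:
  assumes w: "w + w' = of_int b" "w * w' = of_int c" and "conj_pair w w' P P'"
  shows "P * P' \<in> \<int>"
proof -
  obtain m n where 1: "P = of_int m + of_int n * w" "P' = of_int m + of_int n * w'"
    using assms(3) by (auto simp: conj_pair_def)
  have "P * P' = of_int m * of_int m + of_int m * of_int n * (w + w') + of_int n * of_int n * (w * w')"
    by (simp add: 1 algebra_simps)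
  then show ?thesis unfolding w by simp
qed

text \<open>The arithmetic input, in the place of |k| >= 1 for a nonzero integer k: the difference
  of conjugates is an integer multiple of w - w'.\<close>

lemma conj_pair_diff_norm:
  assumes "conj_pair w w' P P'" "P \<noteq> P'"
  shows "cmod (w - w') \<le> cmod (P - P')"
proof -
  obtain m n where 1: "P = of_int m + of_int n * w" "P' = of_int m + of_int n * w'"
    using assms(1) by (auto simp: conj_pair_def)
  have "P - P' = of_int n * (w - w')" by (simp add: 1 algebra_simps)
  moreover have "n \<noteq> 0" using assms(2) 1 by auto
  then have "\<bar>real_of_int n\<bar> \<ge> 1" by linarith
  then have "1 * cmod (w - w') \<le> \<bar>real_of_int n\<bar> * cmod (w - w')"
    by (intro mult_right_mono) auto
  ultimately show ?thesis by (simp add: norm_mult)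
qed

text \<open>\<open>\<kappa>\<close> is the constant \<open>\<chi>\<close> of \<^const>\<open>quadratic_rep\<close>.\<close>

locale diagonal_form =
  fixes r :: nat and a :: "nat \<Rightarrow> int" and \<alpha> \<beta> \<gamma> \<delta> \<kappa> :: complex and A B C :: int
  assumes r3: "r \<ge> 3"
    and jac_nonzero: "\<alpha> * \<delta> - \<beta> * \<gamma> \<noteq> 0"
    and form: "\<And>x y :: complex. binary_form r a x y = (\<alpha> * x + \<beta> * y) ^ r - (\<gamma> * x + \<delta> * y) ^ r"
    and quad: "\<alpha> * \<gamma> = \<kappa> * of_int A" "\<alpha> * \<delta> + \<beta> * \<gamma> = \<kappa> * of_int B" "\<beta> * \<delta> = \<kappa> * of_int C"
begin

definition jac :: complex where "jac = \<alpha> * \<delta> - \<beta> * \<gamma>"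
definition u :: "int \<times> int \<Rightarrow> complex" where "u p = \<alpha> * of_int (fst p) + \<beta> * of_int (snd p)"
definition v :: "int \<times> int \<Rightarrow> complex" where "v p = \<gamma> * of_int (fst p) + \<delta> * of_int (snd p)"
definition w :: complex where "w = \<alpha> * \<delta> / \<kappa>"
definition w' :: complex where "w' = \<beta> * \<gamma> / \<kappa>"

definition form_val :: "int \<times> int \<Rightarrow> int" where "form_val p = binary_form r a (fst p) (snd p)"

lemma form_val: "of_int (form_val p) = u p ^ r - v p ^ r"
proof -
  have "of_int (form_val p) = (binary_form r a (of_int (fst p)) (of_int (snd p)) :: complex)"
    by (simp add: form_val_def binary_form_def)
  then show ?thesis by (simp add: form u_def v_def)
qed

lemma kappa_nonzero: "\<kappa> \<noteq> 0"
proof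
  assume "\<kappa> = 0"
  then have "\<alpha> * \<delta> + \<beta> * \<gamma> = 0" "\<alpha> * \<gamma> = 0" "\<beta> * \<delta> = 0" using quad by auto
  then have "\<alpha> * \<delta> = 0" "\<beta> * \<gamma> = 0" by auto
  then show False using jac_nonzero by (metis diff_zero)
qed

lemma w_sum: "w + w' = of_int B" and w_prod: "w * w' = of_int (A * C)"
  and w_diff: "\<kappa> * (w - w') = jac"
proof -
  show "w + w' = of_int B" using quad(2) kappa_nonzero
    by (simp add: w_def w'_def add_divide_distrib[symmetric])
  have "\<alpha> * \<delta> * (\<beta> * \<gamma>) = \<kappa> * of_int A * (\<kappa> * of_int C)"
    unfolding quad(1,3)[symmetric] by (simp only: mult_ac)
  then show "w * w' = of_int (A * C)" using kappa_nonzero by (simp add: w_def w'_def field_simps)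
  show "\<kappa> * (w - w') = jac" using kappa_nonzero by (simp add: w_def w'_def jac_def field_simps)
qed

lemma w_diff_nonzero: "w - w' \<noteq> 0"
  using w_diff jac_nonzero by (auto simp: jac_def)

lemma w_diff_sq: "(w - w')\<^sup>2 = of_int (B\<^sup>2 - 4 * A * C)"
proof -
  have "(w - w')\<^sup>2 = (w + w')\<^sup>2 - 4 * (w * w')" by (simp add: power2_eq_square algebra_simps)
  then show ?thesis by (simp add: w_sum w_prod)
qed

text \<open>Expanding gives the coefficients \<alpha> \<gamma> / \<kappa> = A, \<beta> \<delta> /
  \<kappa> = C, w and w'; exchanging u and v exchanges w and w'.\<close>

lemma cross_pair: "conj_pair w w' (u p * v q / \<kappa>) (v p * u q / \<kappa>)"
proof -
  obtain x y z t where pq: "p = (x, y)" "q = (z, t)" by (cases p, cases q) auto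
  have AC: "\<alpha> * \<gamma> / \<kappa> = of_int A" "\<beta> * \<delta> / \<kappa> = of_int C"
    using quad(1,3) kappa_nonzero by auto
  have w': "w' = of_int B - w" and w: "w = of_int B - w'" using w_sum by (auto simp: algebra_simps)
  have "u p * v q / \<kappa> = (\<alpha> * \<gamma> / \<kappa>) * of_int (x * z) + (\<beta> * \<delta> / \<kappa>) * of_int (y * t) +
      w * of_int (x * t) + w' * of_int (y * z)"
    using kappa_nonzero by (simp add: u_def v_def pq w_def w'_def field_simps)
  then have 1: "u p * v q / \<kappa> = of_int (A * x * z + C * y * t + B * y * z) + of_int (x * t - y * z) * w"
    unfolding AC w' by (simp add: algebra_simps)
  have "v p * u q / \<kappa> = (\<alpha> * \<gamma> / \<kappa>) * of_int (x * z) + (\<beta> * \<delta> / \<kappa>) * of_int (y * t) +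
      w' * of_int (x * t) + w * of_int (y * z)"
    using kappa_nonzero by (simp add: u_def v_def pq w_def w'_def field_simps)
  then have 2: "v p * u q / \<kappa> = of_int (A * x * z + C * y * t + B * y * z) + of_int (x * t - y * z) * w'"
    unfolding AC w by (simp add: algebra_simps)
  show ?thesis unfolding conj_pair_def using 1 2 by blast
qed

text \<open>These are the partial derivatives of the form at an integer point, computed from u^r -
  v^r; computed from the coefficients they are visibly integers.\<close>

lemma gradient_Ints:
  "of_nat r * (\<alpha> * u p ^ (r - 1) - \<gamma> * v p ^ (r - 1)) \<in> \<int>" (is ?Fx)
  "of_nat r * (\<beta> * u p ^ (r - 1) - \<delta> * v p ^ (r - 1)) \<in> \<int>" (is ?Fy)
proof -
  obtain x y where p: "p = (x, y)" by (cases p)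
  define X Y :: complex where "X = of_int x" and "Y = of_int y"
  have "((\<lambda>z. binary_form r a z Y) has_field_derivative
      (\<Sum>i\<le>r. of_int (a i) * (of_nat (r - i) * X ^ (r - i - 1)) * Y ^ i)) (at X)"
    unfolding binary_form_def by (auto intro!: derivative_eq_intros sum.cong)
  moreover have "((\<lambda>z. binary_form r a z Y) has_field_derivative
      of_nat r * (\<alpha> * u p ^ (r - 1) - \<gamma> * v p ^ (r - 1))) (at X)"
    unfolding form by (auto intro!: derivative_eq_intros simp: u_def v_def p X_def Y_def algebra_simps)
  ultimately have "of_nat r * (\<alpha> * u p ^ (r - 1) - \<gamma> * v p ^ (r - 1)) =
      (\<Sum>i\<le>r. of_int (a i) * (of_nat (r - i) * X ^ (r - i - 1)) * Y ^ i)"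
    by (rule DERIV_unique[symmetric])
  then show ?Fx by (auto simp: X_def Y_def intro!: Ints_sum Ints_mult Ints_power)
  have "((\<lambda>z. binary_form r a X z) has_field_derivative
      (\<Sum>i\<le>r. of_int (a i) * X ^ (r - i) * (of_nat i * Y ^ (i - 1)))) (at Y)"
    unfolding binary_form_def by (auto intro!: derivative_eq_intros sum.cong)
  moreover have "((\<lambda>z. binary_form r a X z) has_field_derivative
      of_nat r * (\<beta> * u p ^ (r - 1) - \<delta> * v p ^ (r - 1))) (at Y)"
    unfolding form by (auto intro!: derivative_eq_intros simp: u_def v_def p X_def Y_def algebra_simps)
  ultimately have "of_nat r * (\<beta> * u p ^ (r - 1) - \<delta> * v p ^ (r - 1)) =
      (\<Sum>i\<le>r. of_int (a i) * X ^ (r - i) * (of_nat i * Y ^ (i - 1)))"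
    by (rule DERIV_unique[symmetric])
  then show ?Fy by (auto simp: X_def Y_def intro!: Ints_sum Ints_mult Ints_power)
qed

text \<open>The Jacobian of the form and of the quadratic form has integer coefficients and equals, up to
  sign, \<open>r (w - w') (u^r + v^r)\<close>.\<close>

lemma power_pair:
  "conj_pair w w' (of_nat r * (w - w') * u p ^ r) (of_nat r * (w - w') * v p ^ r)"
proof -
  obtain x y where p: "p = (x, y)" by (cases p)
  define Fx Fy where "Fx = of_nat r * (\<alpha> * u p ^ (r - 1) - \<gamma> * v p ^ (r - 1))"
    and "Fy = of_nat r * (\<beta> * u p ^ (r - 1) - \<delta> * v p ^ (r - 1))"
  \<comment> \<open>Half of the Jacobian minus half of r B F, where F is the form. By Euler's
    identity x F_x + y F_y = r F, this shift removes the denominator 2.\<close>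
  define M where "M = of_int (C * y) * Fx - of_int (A * x + B * y) * Fy"
  have "M \<in> \<int>" unfolding M_def Fx_def Fy_def by (intro Ints_diff Ints_mult gradient_Ints Ints_of_int)
  then obtain m where m: "M = of_int m" by (auto elim: Ints_cases)
  define U V where "U = u p ^ (r - 1)" and "V = v p ^ (r - 1)"
  have U: "u p ^ r = u p * U" and V: "v p ^ r = v p * V"
    using r3 by (simp_all add: U_def V_def power_eq_if)
  define X Y :: complex where "X = of_int x" and "Y = of_int y"
  have up: "u p = \<alpha> * X + \<beta> * Y" "v p = \<gamma> * X + \<delta> * Y" by (auto simp: u_def v_def p X_def Y_def)
  have "\<kappa> * M = of_nat r * (\<beta> * \<delta> * Y * (\<alpha> * U - \<gamma> * V) -
      (\<alpha> * \<gamma> * X + (\<alpha> * \<delta> + \<beta> * \<gamma>) * Y) * (\<beta> * U - \<delta> * V))"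
    unfolding quad by (simp add: M_def Fx_def Fy_def U_def V_def X_def Y_def algebra_simps)
  also have "\<dots> = of_nat r * (\<alpha> * \<delta> * (v p * V) - \<beta> * \<gamma> * (u p * U))"
    unfolding up by (simp add: algebra_simps)
  finally have M: "M = of_nat r * (w * v p ^ r - w' * u p ^ r)"
    using kappa_nonzero by (simp add: w_def w'_def U V field_simps)
  have 1: "of_nat r * (w - w') * u p ^ r = of_int m + of_int (int r * form_val p) * w"
    unfolding m[symmetric] M by (simp add: form_val algebra_simps)
  have 2: "of_nat r * (w - w') * v p ^ r = of_int m + of_int (int r * form_val p) * w'"
    unfolding m[symmetric] M by (simp add: form_val algebra_simps)
  show ?thesis unfolding conj_pair_def using 1 2 by blast
qed

definition pade_form :: "nat \<Rightarrow> int \<times> int \<Rightarrow> int \<times> int \<Rightarrow> complex" where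
  "pade_form n p q = u p * v q * padeA r n (u p ^ r) (v p ^ r) -
     v p * u q * padeA r n (v p ^ r) (u p ^ r)"

text \<open>r^(2n) clears the denominators of the Pade coefficients, (r (w - w'))^n turns the powers
  of u^r and v^r into conjugates, and 1/\<kappa> does so for the cross products. The result is a
  nonzero difference of conjugates, at least |w - w'|; multiplying by |\<kappa>| gives |j|.\<close>

lemma pade_form_lower_bound:
  assumes "pade_form n p q \<noteq> 0"
  shows "cmod jac \<le> (real r ^ 3 * cmod (w - w')) ^ n * cmod (pade_form n p q)"
proof -
  define s where "s = of_nat r * (w - w')"
  have "\<forall>m. \<exists>k :: int. m \<le> n \<longrightarrow> of_int k = real r ^ (2 * n) * pade_coeff r n m"
  proof
    fix m
    have "real r ^ (2 * n) * pade_coeff r n m \<in> \<int>" if "m \<le> n"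
      using pade_coeff_Ints[OF _ that] r3 by simp
    then show "\<exists>k :: int. m \<le> n \<longrightarrow> of_int k = real r ^ (2 * n) * pade_coeff r n m"
      by (metis Ints_cases)
  qed
  then obtain K :: "nat \<Rightarrow> int" where
    K: "\<And>m. m \<le> n \<Longrightarrow> of_int (K m) = real r ^ (2 * n) * pade_coeff r n m" by metis
  have Kc: "of_int (K m) = of_nat r ^ (2 * n) * complex_of_real (pade_coeff r n m)" if "m \<le> n" for m
  proof -
    have "complex_of_real (of_int (K m)) = of_nat r ^ (2 * n) * complex_of_real (pade_coeff r n m)"
      unfolding K[OF that] by simp
    then show ?thesis by simp
  qed
  define P where "P X Y = (\<Sum>m\<le>n. of_int (K m) * (s * Y) ^ m * (s * X) ^ (n - m))" for X Y :: complex
  have P: "P X Y = of_nat r ^ (2 * n) * s ^ n * padeA r n X Y" for X Y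
    unfolding P_def padeA_def sum_distrib_left
  proof (rule sum.cong[OF refl])
    fix m assume m: "m \<in> {..n}"
    then have "s ^ n = s ^ m * s ^ (n - m)" by (simp add: power_add[symmetric])
    then show "of_int (K m) * (s * Y) ^ m * (s * X) ^ (n - m) =
        of_nat r ^ (2 * n) * s ^ n * (of_real (pade_coeff r n m) * Y ^ m * X ^ (n - m))"
      using m by (simp add: Kc power_mult_distrib mult_ac)
  qed
  note cp = conj_pair_mult[OF w_sum w_prod] conj_pair_power[OF w_sum w_prod]
  have cPP: "conj_pair w w' (s * u p ^ r) (s * v p ^ r)"
    unfolding s_def by (rule power_pair)
  have cPP': "conj_pair w w' (s * v p ^ r) (s * u p ^ r)"
    by (rule conj_pair_swap[OF w_sum cPP])
  have "conj_pair w w' (P (u p ^ r) (v p ^ r)) (P (v p ^ r) (u p ^ r))"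
    unfolding P_def by (intro conj_pair_sum cp conj_pair_of_int cPP cPP')
  then have "conj_pair w w' (u p * v q / \<kappa> * P (u p ^ r) (v p ^ r)) (v p * u q / \<kappa> * P (v p ^ r) (u p ^ r))"
    by (intro cp cross_pair)
  moreover have diff: "u p * v q / \<kappa> * P (u p ^ r) (v p ^ r) - v p * u q / \<kappa> * P (v p ^ r) (u p ^ r) =
      of_nat r ^ (2 * n) * s ^ n * pade_form n p q / \<kappa>"
    unfolding P pade_form_def by (simp add: algebra_simps diff_divide_distrib)
  moreover have "of_nat r ^ (2 * n) * s ^ n * pade_form n p q / \<kappa> \<noteq> 0"
    using assms kappa_nonzero w_diff_nonzero r3 by (simp add: s_def)
  ultimately have "cmod (w - w') \<le> cmod (of_nat r ^ (2 * n) * s ^ n * pade_form n p q / \<kappa>)"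
    using conj_pair_diff_norm[of w w' "u p * v q / \<kappa> * P (u p ^ r) (v p ^ r)"] by fastforce
  also have "\<dots> = (real r ^ 3 * cmod (w - w')) ^ n * cmod (pade_form n p q) / cmod \<kappa>"
    by (simp add: s_def norm_mult norm_divide norm_power power_mult_distrib power_mult[symmetric]
        power_add[symmetric])
  finally have "cmod \<kappa> * cmod (w - w') \<le> (real r ^ 3 * cmod (w - w')) ^ n * cmod (pade_form n p q)"
    using kappa_nonzero by (simp add: field_simps)
  then show ?thesis by (simp only: w_diff[symmetric] norm_mult)
qed

end

section \<open>The gap argument\<close>

lemma padeA_scale: "padeA r n (c * X) (c * Y) = c ^ n * padeA r n X Y"
  unfolding padeA_def sum_distrib_left
proof (rule sum.cong[OF refl])
  fix m assume "m \<in> {..n}"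
  then have "c ^ n = c ^ m * c ^ (n - m)" by (simp add: power_add[symmetric])
  then show "of_real (pade_coeff r n m) * (c * Y) ^ m * (c * X) ^ (n - m) =
      c ^ n * (of_real (pade_coeff r n m) * Y ^ m * X ^ (n - m))"
    by (simp add: power_mult_distrib mult_ac)
qed

text \<open>The alternative \<open>y \<le> h V (G x)^m\<close> at step \<open>n\<close> contradicts the bound of step \<open>n - 1\<close>;
  eliminating \<open>y\<close> from the two inequalities leaves an inequality between \<open>r\<close>-th powers.\<close>

lemma gap_step:
  fixes x y V h G K \<Omega> :: real
  assumes "r \<ge> 6" and pos: "x > 0" "y > 0" "V > 0" "h \<ge> 1" "G \<ge> 1" "\<Omega> > 0"
    and K: "K = 9 * h\<^sup>2 * G" and V: "V ^ r * \<Omega> = x * y"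
    and large: "K ^ r \<le> x ^ (r - 2)" "K < x" "9 * h \<le> x" "729 * h\<^sup>2 < \<Omega>"
    and prev: "x ^ Suc k \<le> 9 * h * V * K ^ k" and alt: "y \<le> h * V * (G * x) ^ (k + 2)"
  shows False
proof -
  have K0: "K > 0" using pos by (simp add: K)
  obtain l where l: "r = l + 6" using assms(1) by (metis add.commute le_iff_add)
  define R where "R = r - 1"
  have R: "r = Suc R" "R = l + 5" by (auto simp: R_def l)
  have i: "\<Omega> * (x ^ Suc k) ^ r \<le> (9 * h * K ^ k) ^ r * (x * y)"
  proof -
    have "(x ^ Suc k) ^ r \<le> (9 * h * K ^ k * V) ^ r"
      using prev pos by (intro power_mono) (auto simp: mult_ac)
    also have "\<dots> = (9 * h * K ^ k) ^ r * V ^ r" by (rule power_mult_distrib)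
    finally have "\<Omega> * (x ^ Suc k) ^ r \<le> \<Omega> * ((9 * h * K ^ k) ^ r * V ^ r)"
      using pos by (intro mult_left_mono) auto
    then show ?thesis unfolding V[symmetric] by (simp only: mult_ac)
  qed
  have ii: "\<Omega> * y ^ R \<le> (h * (G * x) ^ (k + 2)) ^ r * x"
  proof -
    have "y ^ r \<le> (h * (G * x) ^ (k + 2) * V) ^ r"
      using alt pos by (intro power_mono) (auto simp: mult_ac)
    also have "\<dots> = (h * (G * x) ^ (k + 2)) ^ r * V ^ r" by (rule power_mult_distrib)
    finally have "\<Omega> * y ^ r \<le> \<Omega> * ((h * (G * x) ^ (k + 2)) ^ r * V ^ r)"
      using pos by (intro mult_left_mono) auto
    also have "\<dots> = (h * (G * x) ^ (k + 2)) ^ r * (V ^ r * \<Omega>)" by (simp only: mult_ac)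
    finally have "\<Omega> * y ^ r \<le> (h * (G * x) ^ (k + 2)) ^ r * (x * y)" unfolding V .
    moreover have "y ^ r = y ^ R * y" unfolding R(1) by (rule power_Suc2)
    ultimately have "(\<Omega> * y ^ R) * y \<le> ((h * (G * x) ^ (k + 2)) ^ r * x) * y"
      by (simp only: mult.assoc)
    then show ?thesis using pos(2) by simp
  qed
  \<comment> \<open>\<open>i\<close> is linear in y and \<open>ii\<close> bounds y^(r-1), so in the
    product of the (r-1)-st power of \<open>i\<close> with \<open>ii\<close> the y's cancel; r-th
    powers remain and the root can be taken.\<close>
  have "(\<Omega> * (x ^ Suc k) ^ r) ^ R * (\<Omega> * y ^ R) \<le>
      ((9 * h * K ^ k) ^ r * (x * y)) ^ R * ((h * (G * x) ^ (k + 2)) ^ r * x)"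
    by (rule mult_mono[OF power_mono[OF i] ii]) (use pos K0 in auto)
  also have "(\<Omega> * (x ^ Suc k) ^ r) ^ R * (\<Omega> * y ^ R) = (\<Omega> * (x ^ Suc k) ^ R) ^ r * y ^ R"
  proof -
    have "((x ^ Suc k) ^ r) ^ R = ((x ^ Suc k) ^ R) ^ r" by (simp only: power_mult[symmetric] mult_ac)
    then show ?thesis unfolding power_mult_distrib by (simp add: R(1))
  qed
  also have "((9 * h * K ^ k) ^ r * (x * y)) ^ R * ((h * (G * x) ^ (k + 2)) ^ r * x) =
      ((9 * h * K ^ k) ^ R * (h * (G * x) ^ (k + 2)) * x) ^ r * y ^ R"
  proof -
    have "(b ^ r * (x * y)) ^ R * (c ^ r * x) = (b ^ R * c * x) ^ r * y ^ R" for b c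
    proof -
      have "(b ^ r) ^ R = (b ^ R) ^ r" by (simp only: power_mult[symmetric] mult.commute)
      then have "(b ^ r * (x * y)) ^ R * (c ^ r * x) = (b ^ R) ^ r * (x ^ R * y ^ R) * (c ^ r * x)"
        by (simp only: power_mult_distrib)
      also have "\<dots> = (b ^ R) ^ r * c ^ r * (x ^ R * x) * y ^ R" by (simp only: mult_ac)
      also have "x ^ R * x = x ^ r" by (simp add: R(1))
      finally show ?thesis by (simp only: power_mult_distrib)
    qed
    then show ?thesis .
  qed
  finally have "(\<Omega> * (x ^ Suc k) ^ R) ^ r \<le> ((9 * h * K ^ k) ^ R * (h * (G * x) ^ (k + 2)) * x) ^ r"
    using pos by simp
  then have root: "\<Omega> * (x ^ Suc k) ^ R \<le> (9 * h * K ^ k) ^ R * (h * (G * x) ^ (k + 2)) * x"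
    using pos K0 by (subst (asm) power_mono_iff) (auto simp: R(1))
  have "1 \<le> 9 * h\<^sup>2" using one_le_power[OF pos(4), of 2] by linarith
  then have GK: "G \<le> K" using mult_right_mono[of 1 "9 * h\<^sup>2" G] pos unfolding K by simp
  have "(9 * h * K ^ k) ^ R * (h * (G * x) ^ (k + 2)) * x =
      ((9 * h) ^ R * h * x ^ 3 * (G ^ 2 * (x ^ k * (K ^ k) ^ R))) * G ^ k"
    by (simp add: power_mult_distrib power_add power2_eq_square power3_eq_cube mult_ac)
  also have "\<dots> \<le> ((9 * h) ^ R * h * x ^ 3 * (G ^ 2 * (x ^ k * (K ^ k) ^ R))) * K ^ k"
    using GK pos K0 by (intro mult_left_mono power_mono) auto
  also have "\<dots> = ((9 * h) ^ R * h * x ^ 3 * G ^ 2) * (K ^ r * x) ^ k"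
  proof -
    have "(K ^ k) ^ R * K ^ k = (K ^ r) ^ k"
      unfolding R(1) by (simp add: power_mult_distrib power_mult[symmetric] mult.commute)
    then show ?thesis by (simp add: power_mult_distrib mult_ac)
  qed
  \<comment> \<open>The condition K^r <= x^(r-2) is made for this place: all that is raised to the
    power k is absorbed into x^(r-1), and the dependence on k disappears.\<close>
  also have "\<dots> \<le> ((9 * h) ^ R * h * x ^ 3 * G ^ 2) * (x ^ (r - 2) * x) ^ k"
    using large(1) pos K0 by (intro mult_left_mono power_mono mult_right_mono) auto
  also have "x ^ (r - 2) * x = x ^ R" by (simp add: l R_def power_Suc2[symmetric] del: power_Suc)
  finally have "(9 * h * K ^ k) ^ R * (h * (G * x) ^ (k + 2)) * x \<le>
      ((9 * h) ^ R * h * x ^ 3 * G ^ 2) * (x ^ R) ^ k" .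
  with root have "\<Omega> * (x ^ Suc k) ^ R \<le> ((9 * h) ^ R * h * x ^ 3 * G ^ 2) * (x ^ R) ^ k"
    by (rule order_trans)
  then have "\<Omega> * (x ^ R * (x ^ k) ^ R) \<le> ((9 * h) ^ R * h * x ^ 3 * G ^ 2) * (x ^ R) ^ k"
    unfolding power_Suc power_mult_distrib[of x] .
  moreover have "(x ^ k) ^ R = (x ^ R) ^ k" by (simp only: power_mult[symmetric] mult.commute)
  ultimately have "(\<Omega> * x ^ R) * (x ^ R) ^ k \<le> ((9 * h) ^ R * h * x ^ 3 * G ^ 2) * (x ^ R) ^ k"
    by (simp only: mult.assoc)
  then have "\<Omega> * x ^ R \<le> (9 * h) ^ R * h * x ^ 3 * G ^ 2" using pos by simp
  \<comment> \<open>The factor 81 h^4 completes G^2 to K^2, which is below x^2. Then r - 6 factors 9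
    h are traded against x, and 9^5 h^6 = 81 h^4 729 h^2 is left.\<close>
  then have "\<Omega> * x ^ R * (81 * h ^ 4) \<le> (9 * h) ^ R * h * x ^ 3 * G ^ 2 * (81 * h ^ 4)"
    using pos by (intro mult_right_mono) auto
  also have "\<dots> = (9 * h) ^ R * h * x ^ 3 * K ^ 2"
    unfolding K by (simp add: power_mult_distrib power2_eq_square power4_eq_xxxx)
  also have "\<dots> \<le> (9 * h) ^ R * h * x ^ 3 * x ^ 2"
    using large(2) pos K0 by (intro mult_left_mono power_mono) auto
  also have "\<dots> = (9 * h) ^ l * ((9 * h) ^ 5 * h * x ^ 5)"
  proof -
    have x5: "x ^ 5 = x ^ 3 * x ^ 2" by (simp add: power_add[symmetric])
    show ?thesis unfolding R(2) power_add[of "9 * h"] x5 by (simp only: mult_ac)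
  qed
  also have "\<dots> \<le> x ^ l * ((9 * h) ^ 5 * h * x ^ 5)"
    using large(3) pos by (intro mult_right_mono power_mono) auto
  finally have le: "\<Omega> * x ^ R * (81 * h ^ 4) \<le> x ^ l * ((9 * h) ^ 5 * h * x ^ 5)" .
  have e9: "(9 * h) ^ 5 * h = 81 * h ^ 4 * (729 * h\<^sup>2)" by (simp add: power_mult_distrib eval_nat_numeral)
  from le have "(x ^ l * x ^ 5 * (81 * h ^ 4)) * \<Omega> \<le> (x ^ l * x ^ 5 * (81 * h ^ 4)) * (729 * h\<^sup>2)"
    unfolding e9 R(2) power_add by (simp only: mult_ac)
  then have "\<Omega> \<le> 729 * h\<^sup>2" using pos by (subst (asm) mult_le_cancel_left_pos) auto
  then show False using large(4) by simp
qed

text \<open>The bound \<open>P\<close> for all n is absurd because x > K. Its induction must allow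
  \<open>good\<close> to fail at every second index: it uses some m among k + 1 and k + 2, giving
  away a factor x / K for the larger one. One summand in \<open>E\<close> contributes at least 1;
  the first yields the next bound, the second is refuted by \<open>gap_step\<close>.\<close>

lemma gap_contradiction:
  fixes x y V h G K \<Omega> :: real
  assumes "r \<ge> 6" and pos: "x > 0" "y > 0" "V > 0" "h \<ge> 1" "G \<ge> 1" "\<Omega> > 0"
    and K: "K = 9 * h\<^sup>2 * G" and V: "V ^ r * \<Omega> = x * y"
    and large: "K ^ r \<le> x ^ (r - 2)" "K < x" "9 * h \<le> x" "729 * h\<^sup>2 < \<Omega>" and "x \<le> y"
    and E: "\<And>m. good m \<Longrightarrow> 2 \<le> V * (9 * h * K ^ m / x ^ Suc m + h * (G * x) ^ m / y)"
    and good: "good 0" "\<And>n. good n \<or> good (Suc n)"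
  shows False
proof -
  have K0: "K > 0" using pos by (simp add: K)
  have P: "x ^ Suc n \<le> 9 * h * V * K ^ n" for n
  proof (induction n)
    case 0
    have "2 \<le> V * (9 * h / x + h / y)" using E[OF good(1)] by simp
    also have "\<dots> \<le> V * (9 * h / x + h / x)"
      using pos \<open>x \<le> y\<close> by (intro mult_left_mono add_left_mono divide_left_mono) auto
    finally have "x \<le> 5 * h * V" using pos by (simp add: field_simps)
    moreover have "0 \<le> h * V" using pos by simp
    ultimately show ?case by simp
  next
    case (Suc k)
    obtain m where m: "good m" "m = Suc k \<or> m = Suc (Suc k)" using good(2)[of "Suc k"] by blast
    have "1 \<le> V * (9 * h * K ^ m / x ^ Suc m) \<or> 1 \<le> V * (h * (G * x) ^ m / y)"
      using E[OF m(1)] unfolding distrib_left by linarith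
    then show ?case
    proof
      assume "1 \<le> V * (9 * h * K ^ m / x ^ Suc m)"
      then have le: "x ^ Suc m \<le> 9 * h * V * K ^ m" using pos by (simp add: field_simps)
      from m(2) show ?thesis
      proof
        assume "m = Suc (Suc k)"
        then have "x ^ Suc (Suc k) * x \<le> 9 * h * V * K ^ Suc k * K"
          using le by (simp add: mult_ac)
        also have "\<dots> \<le> 9 * h * V * K ^ Suc k * x"
          using large(2) pos K0 by (intro mult_left_mono) auto
        finally show ?thesis by (rule mult_right_le_imp_le) (rule pos)
      qed (use le in simp)
    next
      assume "1 \<le> V * (h * (G * x) ^ m / y)"
      then have "y \<le> h * V * (G * x) ^ m" using pos by (simp add: field_simps)
      also have "\<dots> \<le> h * V * (G * x) ^ (k + 2)"
      proof (intro mult_left_mono power_increasing)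
        have "1 \<le> x" using large(3) pos by simp
        then show "1 \<le> G * x" using pos mult_mono[of 1 G 1 x] by simp
      qed (use m(2) pos in auto)
      finally show ?thesis
        using gap_step[OF assms(1) pos K V large Suc] by blast
    qed
  qed
  obtain n where n: "9 * h * V / x < (x / K) ^ n"
    using real_arch_pow[of "x / K" "9 * h * V / x"] large(2) K0 by auto
  have "(x / K) ^ n \<le> 9 * h * V / x"
    using P[of n] pos K0 by (simp add: field_simps)
  then show False using n by simp
qed

section \<open>Auxiliary numbers attached to two solutions\<close>

context diagonal_form
begin

text \<open>If both vanished, eliminating their second terms would leave \<open>u p * v q\<close>
  times the determinant of consecutive approximants at (u^r, v^r), and u^r differs from v^r since
  the form does not vanish at p.\<close>

lemma pade_form_nonzero:
  assumes "u p \<noteq> 0" "v q \<noteq> 0" "form_val p \<noteq> 0"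
  shows "pade_form n p q \<noteq> 0 \<or> pade_form (Suc n) p q \<noteq> 0"
proof (rule ccontr)
  assume "\<not> ?thesis"
  then have z: "pade_form n p q = 0" "pade_form (Suc n) p q = 0" by auto
  define X Y where "X = u p ^ r" and "Y = v p ^ r"
  have "u p * v q * (padeA r n X Y * padeA r (Suc n) Y X - padeA r (Suc n) X Y * padeA r n Y X) =
      pade_form n p q * padeA r (Suc n) Y X - pade_form (Suc n) p q * padeA r n Y X"
    by (simp add: pade_form_def X_def Y_def algebra_simps)
  moreover have "X \<noteq> Y" using assms(3) form_val[of p] by (auto simp: X_def Y_def)
  moreover have "X \<noteq> 0" using assms(1) by (simp add: X_def)
  ultimately show False
    using padeA_determinant_nonzero[of r X Y n] r3 assms z by simp
qed

text \<open>Writing v q / u q as 1 plus an error splits the number into the Pade remainder at v p /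
  u p and that error times a numerator: p enters through a high power of its distance to 1, q only
  linearly.\<close>

lemma pade_form_upper_bound:
  assumes nz: "u p \<noteq> 0" "u q \<noteq> 0"
    and t: "real r * cmod (v p / u p - 1) \<le> b" "b \<le> 1"
    and T: "cmod ((v p / u p) ^ r) \<le> 3" and e: "cmod (v q / u q - 1) \<le> e"
  shows "cmod (pade_form n p q) \<le>
     cmod (u p) * cmod (u q) * (12 * cmod (u p) ^ r) ^ n * (3 * b ^ (2 * n + 1) + e)"
proof -
  define t where "t = v p / u p"
  define R where "R = padeA r n 1 (t ^ r) - t * padeA r n (t ^ r) 1"
  have vp: "v p = u p * t" using nz by (simp add: t_def)
  have A: "padeA r n (u p ^ r) (v p ^ r) = (u p ^ r) ^ n * padeA r n 1 (t ^ r)"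
    using padeA_scale[of r n "u p ^ r" 1 "t ^ r"] by (simp add: vp power_mult_distrib)
  have B: "padeA r n (v p ^ r) (u p ^ r) = (u p ^ r) ^ n * padeA r n (t ^ r) 1"
    using padeA_scale[of r n "u p ^ r" "t ^ r" 1] by (simp add: vp power_mult_distrib)
  have vq: "v q = u q * (1 + (v q / u q - 1))" using nz by simp
  have "pade_form n p q = u p * u q * (u p ^ r) ^ n * (R + (v q / u q - 1) * padeA r n 1 (t ^ r))"
    unfolding pade_form_def A B R_def using nz by (simp add: vp field_simps)
  then have "cmod (pade_form n p q) = cmod (u p) * cmod (u q) * (cmod (u p) ^ r) ^ n *
      cmod (R + (v q / u q - 1) * padeA r n 1 (t ^ r))"
    by (simp add: norm_mult norm_power)
  also have "\<dots> \<le> cmod (u p) * cmod (u q) * (cmod (u p) ^ r) ^ n *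
      (3 * 12 ^ n * b ^ (2 * n + 1) + e * 12 ^ n)"
  proof (intro mult_left_mono)
    have "cmod R \<le> 3 * 12 ^ n * (real r * cmod (t - 1)) ^ (2 * n + 1)"
      unfolding R_def using t r3 by (intro pade_remainder_bound) (auto simp: t_def)
    also have "\<dots> \<le> 3 * 12 ^ n * b ^ (2 * n + 1)"
      using t by (intro mult_left_mono power_mono) (auto simp: t_def)
    finally have 1: "cmod R \<le> 3 * 12 ^ n * b ^ (2 * n + 1)" .
    have "cmod (v q / u q - 1) * cmod (padeA r n 1 (t ^ r)) \<le> e * 12 ^ n"
      using e T r3 order_trans[OF norm_ge_zero e]
      by (intro mult_mono padeA_bound) (auto simp: t_def)
    then have 2: "cmod ((v q / u q - 1) * padeA r n 1 (t ^ r)) \<le> e * 12 ^ n"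
      by (simp only: norm_mult)
    show "cmod (R + (v q / u q - 1) * padeA r n 1 (t ^ r)) \<le> 3 * 12 ^ n * b ^ (2 * n + 1) + e * 12 ^ n"
      using norm_triangle_ineq[of R] 1 2 by (meson add_mono order_trans)
  qed auto
  also have "\<dots> = cmod (u p) * cmod (u q) * (12 * cmod (u p) ^ r) ^ n * (3 * b ^ (2 * n + 1) + e)"
    by (simp add: power_mult_distrib algebra_simps)
  finally show ?thesis .
qed

text \<open>In \<open>G\<close>, the 12 is the size of the approximants and r^3 |w - w'| the
  integrality factor; 9 h^2 is the square of the 3 h in the remainder's (3 h / |u|^r)^(2m +
  1).\<close>

lemma no_two_close_solutions:
  fixes h :: real
  defines "G \<equiv> 12 * real r ^ 3 * cmod (w - w')"
  assumes r6: "r \<ge> 6" and h: "h \<ge> 1"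
    and nz: "u p \<noteq> 0" "u q \<noteq> 0" "v q \<noteq> 0" "form_val p \<noteq> 0"
    and indep: "u p * v q \<noteq> v p * u q" and le: "cmod (u p) \<le> cmod (u q)"
    and cl: "real r * cmod (v p / u p - 1) \<le> 3 * h / cmod (u p) ^ r"
      "real r * cmod (v q / u q - 1) \<le> 3 * h / cmod (u q) ^ r"
    and T: "cmod ((v p / u p) ^ r) \<le> 3"
    and s: "1 \<le> cmod (w - w')"
    and large: "(9 * h\<^sup>2 * G) ^ r \<le> (cmod (u p) ^ r) ^ (r - 2)" "9 * h\<^sup>2 * G < cmod (u p) ^ r"
      "9 * h \<le> cmod (u p) ^ r" "729 * h\<^sup>2 < (cmod jac / 2) ^ r"
  shows False
\<comment> \<open>Halving |j| in \<open>V\<close> makes the lower bound 2, so that one of the two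
  terms is at least 1.\<close>
proof (rule gap_contradiction[where V = "cmod (u p) * cmod (u q) / (cmod jac / 2)"
      and good = "\<lambda>m. pade_form m p q \<noteq> 0" and y = "cmod (u q) ^ r", OF r6 _ _ _ h _ _ refl _ large])
  define x y where "x = cmod (u p) ^ r" and "y = cmod (u q) ^ r"
  have xy: "x > 0" "y > 0" using nz by (auto simp: x_def y_def)
  have jac: "cmod jac > 0" using jac_nonzero by (simp add: jac_def)
  show "0 < cmod (u p) ^ r" "0 < cmod (u q) ^ r" using nz by auto
  show "0 < cmod (u p) * cmod (u q) / (cmod jac / 2)" using nz jac by simp
  have "1 \<le> real r ^ 3" using r6 by simp
  then have "1 * 1 \<le> real r ^ 3 * cmod (w - w')" using s by (intro mult_mono) auto
  then show "1 \<le> G" unfolding G_def by simp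
  show "0 < (cmod jac / 2) ^ r" using jac by simp
  show "(cmod (u p) * cmod (u q) / (cmod jac / 2)) ^ r * (cmod jac / 2) ^ r = cmod (u p) ^ r * cmod (u q) ^ r"
    using jac by (simp add: power_mult_distrib[symmetric])
  show "cmod (u p) ^ r \<le> cmod (u q) ^ r" using le by (intro power_mono) auto
  show "pade_form 0 p q \<noteq> 0" using indep by (simp add: pade_form_def padeA_def pade_coeff_def)
  show "pade_form n p q \<noteq> 0 \<or> pade_form (Suc n) p q \<noteq> 0" for n
    by (rule pade_form_nonzero[OF nz(1,3,4)])
  fix m assume m: "pade_form m p q \<noteq> 0"
  have b1: "3 * h / x \<le> 1" using large(3) h xy by (simp add: x_def field_simps)
  have "real r * cmod (v q / u q - 1) \<le> real r * (h / y)"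
  proof -
    have "3 * h / y \<le> real r * (h / y)"
      using mult_right_mono[of 3 "real r" "h / y"] r6 h xy by simp
    then show ?thesis using cl(2) by (simp add: y_def)
  qed
  then have e: "cmod (v q / u q - 1) \<le> h / y"
    by (rule mult_left_le_imp_le) (use r6 in simp)
  have up: "cmod (pade_form m p q) \<le>
     cmod (u p) * cmod (u q) * (12 * x) ^ m * (3 * (3 * h / x) ^ (2 * m + 1) + h / y)"
    unfolding x_def by (rule pade_form_upper_bound[OF nz(1,2) cl(1) b1[unfolded x_def] T e])
  have "cmod jac \<le> (real r ^ 3 * cmod (w - w')) ^ m * cmod (pade_form m p q)"
    by (rule pade_form_lower_bound[OF m])
  also have "\<dots> \<le> (real r ^ 3 * cmod (w - w')) ^ m * (cmod (u p) * cmod (u q) * (12 * x) ^ m *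
      (3 * (3 * h / x) ^ (2 * m + 1) + h / y))"
    by (intro mult_left_mono up) auto
  also have "\<dots> = cmod (u p) * cmod (u q) * ((G * x) ^ m * (3 * (3 * h / x) ^ (2 * m + 1)) + h * (G * x) ^ m / y)"
    by (simp add: G_def power_mult_distrib algebra_simps)
  also have "(G * x) ^ m * (3 * (3 * h / x) ^ (2 * m + 1)) = 9 * h * (9 * h\<^sup>2 * G) ^ m / x ^ Suc m"
  proof -
    have "(3 * h / x) ^ (2 * m + 1) = (9 * h\<^sup>2) ^ m * (3 * h) / (x ^ m * x ^ Suc m)"
    proof -
      have "(3 * h / x) ^ (2 * m + 1) = ((3 * h)\<^sup>2) ^ m * (3 * h) / x ^ (2 * m + 1)"
        by (simp add: power_divide power_mult)
      also have "x ^ (2 * m + 1) = x ^ m * x ^ Suc m" by (simp add: power_add[symmetric] mult_2)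
      finally show ?thesis by (simp add: power_mult_distrib)
    qed
    then show ?thesis using xy by (simp add: power_mult_distrib)
  qed
  finally have le: "cmod jac \<le> cmod (u p) * cmod (u q) *
      (9 * h * (9 * h\<^sup>2 * G) ^ m / x ^ Suc m + h * (G * x) ^ m / y)" .
  have "2 \<le> c / (J / 2) * b" if "J \<le> c * b" "J > 0" for b c J :: real
    using that by (simp add: field_simps)
  from this[OF le jac] show "2 \<le> cmod (u p) * cmod (u q) / (cmod jac / 2) *
      (9 * h * (9 * h\<^sup>2 * G) ^ m / (cmod (u p) ^ r) ^ Suc m +
       h * (G * cmod (u p) ^ r) ^ m / cmod (u q) ^ r)"
    unfolding x_def y_def .
qed

section \<open>Size of w - w' against the Jacobian\<close>

lemma w_diff_norm_ge_1: "1 \<le> cmod (w - w')"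
proof -
  have "B\<^sup>2 - 4 * A * C \<noteq> 0"
  proof
    assume "B\<^sup>2 - 4 * A * C = 0"
    then have "(w - w')\<^sup>2 = 0" using w_diff_sq by (simp only: of_int_0)
    then show False using w_diff_nonzero by simp
  qed
  then have "1 \<le> \<bar>real_of_int (B\<^sup>2 - 4 * A * C)\<bar>" by linarith
  also have "\<dots> = cmod (w - w') ^ 2" unfolding norm_power[symmetric] w_diff_sq by (simp only: norm_of_int)
  finally show ?thesis by (intro power2_le_imp_le[of 1]) auto
qed

text \<open>\<open>E\<close> times the r-th power of any value of the quadratic form at integers is
  a product of conjugates, hence an integer. The values A, C, A + B + C are coprime, so are their
  r-th powers, and Bezout makes \<open>E\<close> itself an integer. Now |E| >= 1 bounds |\<kappa>|
  from below and, as |j| = |\<kappa>| |w - w'|, bounds |w - w'| from above.\<close>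

lemma w_diff_norm_bound:
  assumes "gcd (gcd A C) B = 1"
  shows "cmod (w - w') ^ (r - 2) \<le> real r ^ 2 * cmod jac ^ r"
proof -
  define E where "E = (of_nat r * (w - w'))\<^sup>2 * \<kappa> ^ r"
  have EQ: "E * of_int (A * x\<^sup>2 + B * x * y + C * y\<^sup>2) ^ r \<in> \<int>" for x y
  proof -
    have "u (x, y) * v (x, y) = \<alpha> * \<gamma> * of_int (x\<^sup>2) + (\<alpha> * \<delta> + \<beta> * \<gamma>) * of_int (x * y) +
        \<beta> * \<delta> * of_int (y\<^sup>2)"
      by (simp add: u_def v_def power2_eq_square algebra_simps)
    also have "\<dots> = \<kappa> * of_int (A * x\<^sup>2 + B * x * y + C * y\<^sup>2)"
      unfolding quad by (simp add: algebra_simps)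
    finally have uv: "u (x, y) * v (x, y) = \<kappa> * of_int (A * x\<^sup>2 + B * x * y + C * y\<^sup>2)" .
    have "E * of_int (A * x\<^sup>2 + B * x * y + C * y\<^sup>2) ^ r =
        (of_nat r * (w - w'))\<^sup>2 * (u (x, y) * v (x, y)) ^ r"
      unfolding uv by (simp only: E_def power_mult_distrib mult.assoc)
    also have "\<dots> = (of_nat r * (w - w') * u (x, y) ^ r) * (of_nat r * (w - w') * v (x, y) ^ r)"
      by (simp only: power_mult_distrib power2_eq_square mult_ac)
    also have "\<dots> \<in> \<int>" by (rule conj_pair_norm_Ints[OF w_sum w_prod power_pair])
    finally show ?thesis .
  qed
  have gcd_Ints: "E * of_int (gcd k l) \<in> \<int>" if "E * of_int k \<in> \<int>" "E * of_int l \<in> \<int>" for k l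
  proof -
    obtain c d where "c * k + d * l = gcd k l" using bezout_int[of k l] by auto
    then have "E * of_int (gcd k l) = of_int c * (E * of_int k) + of_int d * (E * of_int l)"
      by (metis (no_types, opaque_lifting) distrib_left mult.left_commute of_int_add of_int_mult)
    also have "\<dots> \<in> \<int>"
      by (rule Ints_add[OF Ints_mult[OF Ints_of_int that(1)] Ints_mult[OF Ints_of_int that(2)]])
    finally show ?thesis .
  qed
  have "E * of_int (A ^ r) \<in> \<int>" "E * of_int (C ^ r) \<in> \<int>" "E * of_int ((A + B + C) ^ r) \<in> \<int>"
    using EQ[of 1 0] EQ[of 0 1] EQ[of 1 1] by simp_all
  then have "E * of_int (gcd (gcd (A ^ r) (C ^ r)) ((A + B + C) ^ r)) \<in> \<int>"
    by (intro gcd_Ints)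
  moreover have "gcd (gcd A C) (A + B + C) = 1"
  proof -
    have "d dvd B" if "d dvd A" "d dvd C" "d dvd A + B + C" for d
      using that by (metis add.commute dvd_add_right_iff)
    then have "gcd (gcd A C) (A + B + C) dvd gcd (gcd A C) B"
      by (meson dvd_trans gcd_dvd1 gcd_dvd2 gcd_greatest)
    then show ?thesis using assms by simp
  qed
  then have "gcd (gcd (A ^ r) (C ^ r)) ((A + B + C) ^ r) = 1"
    by simp
  ultimately have "E \<in> \<int>" by (metis of_int_1 mult.right_neutral)
  moreover have "E \<noteq> 0" using w_diff_nonzero kappa_nonzero r3 by (simp add: E_def)
  ultimately have "1 \<le> cmod E" by (auto elim!: Ints_cases)
  also have "cmod E = real r ^ 2 * (cmod (w - w') ^ 2 * cmod \<kappa> ^ r)"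
    by (simp add: E_def norm_mult norm_power power_mult_distrib)
  finally have "cmod (w - w') ^ (r - 2) * 1 \<le>
      cmod (w - w') ^ (r - 2) * (real r ^ 2 * (cmod (w - w') ^ 2 * cmod \<kappa> ^ r))"
    by (intro mult_left_mono) auto
  also have "\<dots> = real r ^ 2 * (cmod \<kappa> * cmod (w - w')) ^ r"
  proof -
    have "r = (r - 2) + 2" using r3 by simp
    then have "cmod (w - w') ^ r = cmod (w - w') ^ (r - 2) * cmod (w - w') ^ 2"
      by (metis power_add)
    then show ?thesis by (simp add: power_mult_distrib)
  qed
  finally show ?thesis by (simp add: w_diff[symmetric] norm_mult)
qed

end

section \<open>Roots of unity, discriminant and size estimates\<close>

lemma exp_minus_1_norm_le:
  fixes y :: complex
  assumes "cmod y \<le> 1 / 6"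
  shows "cmod (exp y - 1) \<le> 3 / 2 * cmod y"
proof -
  have "cmod (exp y - (\<Sum>i\<le>0. y ^ i / fact i)) \<le> exp (cmod y) * (cmod y ^ Suc 0) / fact 0"
    by (rule Taylor_exp_field)
  then have "cmod (exp y - 1) \<le> exp (cmod y) * cmod y" by simp
  also have "exp (cmod y) \<le> 1 + cmod y + (cmod y)\<^sup>2"
    using assms by (intro exp_bound) auto
  also have "\<dots> \<le> 3 / 2"
  proof -
    have "(cmod y)\<^sup>2 \<le> (1 / 6)\<^sup>2" using assms by (intro power_mono) auto
    then show ?thesis using assms by (simp add: power2_eq_square)
  qed
  finally show ?thesis by (simp add: mult_right_mono)
qed

text \<open>\<zeta> t is the principal r-th root of t^r; the 3 is 2 from the logarithm times 3/2
  from the exponential. A real t^r is positive here, so its principal root is real, which the case D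
  > 0 exploits.\<close>

lemma near_root_of_unity:
  fixes t :: complex
  assumes r: "r \<ge> 3" and t: "cmod (t ^ r - 1) \<le> 1 / 4"
  obtains \<zeta> where "\<zeta> ^ r = 1" "real r * cmod (\<zeta> * t - 1) \<le> 3 * cmod (t ^ r - 1)"
    "t ^ r \<in> \<real> \<Longrightarrow> \<zeta> * t \<in> \<real>"
proof -
  have t0: "t \<noteq> 0" using t r by (auto simp: power_0_left)
  define y where "y = Ln (t ^ r) / of_nat r"
  have "cmod (Ln (1 + (t ^ r - 1))) \<le> 2 * cmod (t ^ r - 1)" using t by (intro norm_Ln_le) auto
  then have y: "real r * cmod y \<le> 2 * cmod (t ^ r - 1)" using r by (simp add: y_def norm_divide)
  have "3 * cmod y \<le> real r * cmod y" using r by (intro mult_right_mono) auto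
  then have "cmod y \<le> 1 / 6" using y t by simp
  then have e: "cmod (exp y - 1) \<le> 3 / 2 * cmod y" by (rule exp_minus_1_norm_le)
  have ey: "exp y ^ r = t ^ r" using r t0 by (simp add: y_def exp_of_nat_mult[symmetric])
  show thesis
  proof (rule that[of "exp y / t"])
    show "(exp y / t) ^ r = 1" using ey t0 by (simp add: power_divide)
    have "real r * cmod (exp y - 1) \<le> real r * (3 / 2 * cmod y)" using e by (intro mult_left_mono) auto
    then show "real r * cmod (exp y / t * t - 1) \<le> 3 * cmod (t ^ r - 1)" using y t0 by simp
    assume "t ^ r \<in> \<real>"
    then obtain c where c: "t ^ r = of_real c" by (auto elim: Reals_cases)
    have "cmod (of_real (c - 1)) \<le> 1 / 4" using t unfolding c by simp
    then have "c > 0" unfolding norm_of_real by linarith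
    then have "y \<in> \<real>" unfolding y_def c by (simp add: Ln_of_real)
    then show "exp y / t * t \<in> \<real>" using t0 by (simp add: exp_in_Reals)
  qed
qed

lemma power_minus_one_factorization:
  fixes r :: nat
  defines "z \<equiv> \<lambda>k. cis (2 * pi * real k / real r)"
  assumes "r > 0"
  shows "monom 1 r - 1 = (\<Prod>k<r. [:- z k, 1:])"
proof -
  have bij: "bij_betw z {..<r} {x. x ^ r = 1}"
    unfolding z_def using assms(2) by (rule Complex.bij_betw_roots_unity)
  define p where "p = (monom 1 r - 1 :: complex poly)"
  define q where "q = (\<Prod>k<r. [:- z k, 1:])"
  have root: "poly p (z k) = 0" "poly q (z k) = 0" if "k < r" for k
    using bij that by (auto simp: p_def q_def poly_monom poly_prod bij_betw_def)
  have degq: "degree q = r" and lq: "coeff q r = 1"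
  proof -
    show "degree q = r" by (simp add: q_def degree_prod_sum_eq)
    moreover have "lead_coeff q = 1" by (simp add: q_def lead_coeff_prod)
    ultimately show "coeff q r = 1" by simp
  qed
  have "p - q = 0"
  proof (rule ccontr)
    assume nz: "p - q \<noteq> 0"
    have degp: "degree p \<le> r" unfolding p_def by (intro degree_diff_le degree_monom_le) simp
    have "coeff (p - q) r = 0" using assms(2) lq by (simp add: p_def)
    moreover have "degree (p - q) \<le> r" using degp degq by (intro degree_diff_le) auto
    ultimately have "degree (p - q) < r" using nz by (metis leading_coeff_0_iff le_neq_implies_less)
    moreover have "card (z ` {..<r}) \<le> card {x. poly (p - q) x = 0}"
      using root by (intro card_mono poly_roots_finite nz) auto
    moreover have "card (z ` {..<r}) = r"
      using bij_betw_imp_inj_on[OF bij] by (simp add: card_image)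
    ultimately show False using card_poly_roots_bound[OF nz] by simp
  qed
  then show ?thesis by (simp add: p_def q_def)
qed

lemma power_diff_factorization:
  fixes X Y :: complex
  assumes "r > 0"
  shows "X ^ r - Y ^ r = (\<Prod>k<r. X - cis (2 * pi * real k / real r) * Y)"
proof (cases "Y = 0")
  case True
  then show ?thesis using assms by simp
next
  case False
  have "(X / Y) ^ r - 1 = poly (monom 1 r - 1) (X / Y)" by (simp add: poly_monom)
  also have "\<dots> = (\<Prod>k<r. X / Y - cis (2 * pi * real k / real r))"
    unfolding power_minus_one_factorization[OF assms] poly_prod by simp
  finally have "Y ^ r * ((X / Y) ^ r - 1) = (\<Prod>k<r. Y * (X / Y - cis (2 * pi * real k / real r)))"
    by (simp add: prod.distrib)
  then show ?thesis using False by (simp add: power_divide algebra_simps)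
qed

text \<open>The product is the derivative r z^(r-1) of z^r - 1 at a root z.\<close>

lemma prod_root_of_unity_differences:
  fixes r :: nat
  defines "z \<equiv> \<lambda>k. cis (2 * pi * real k / real r)"
  assumes "i < r"
  shows "cmod (\<Prod>j\<in>{..<r} - {i}. z i - z j) = real r"
proof -
  have r: "r > 0" using assms(2) by simp
  define q where "q = (\<Prod>j\<in>{..<r} - {i}. [:- z j, 1:])"
  have "monom 1 r - 1 = [:- z i, 1:] * q"
    unfolding power_minus_one_factorization[OF r] q_def z_def
    using assms(2) by (intro prod.remove) auto
  then have "pderiv (monom 1 r - 1) = [:- z i, 1:] * pderiv q + q * pderiv [:- z i, 1:]"
    by (simp only: pderiv_mult)
  then have "poly (pderiv (monom 1 r - 1)) (z i) = poly q (z i)"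
    by (simp add: pderiv_pCons)
  then have "poly q (z i) = of_nat r * z i ^ (r - 1)"
    by (simp add: pderiv_diff pderiv_monom poly_monom)
  moreover have "cmod (z i) = 1" by (simp add: z_def)
  ultimately have "cmod (poly q (z i)) = real r" by (simp add: norm_mult norm_power)
  then show ?thesis by (simp add: q_def poly_prod)
qed

section \<open>The discriminant in terms of the Jacobian\<close>

context diagonal_form
begin

text \<open>The linear factors are u - z v with z^r = 1, and two of them have determinant -(z - z')
  j; each ordered pair contributes |j|, and the differences of roots contribute r for each
  root.\<close>

lemma form_disc_norm: "cmod (form_disc r a) = (cmod jac ^ (r - 1) * real r) ^ r"
proof -
  define z where "z k = cis (2 * pi * real k / real r)" for k
  define P Q where "P k = \<alpha> - z k * \<gamma>" and "Q k = z k * \<delta> - \<beta>" for k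
  have r0: "r > 0" using r3 by simp
  have "linear_factorization r a P Q"
    unfolding linear_factorization_def form power_diff_factorization[OF r0]
    by (auto simp: P_def Q_def z_def algebra_simps)
  moreover obtain x y where "binary_form r a x y \<noteq> (0 :: complex)"
  proof -
    have "binary_form r a (\<delta> :: complex) (- \<gamma>) = jac ^ r"
      using r0 by (simp add: form jac_def algebra_simps)
    then show ?thesis using that[of \<delta> "- \<gamma>"] jac_nonzero by (simp add: jac_def)
  qed
  ultimately have fd: "form_disc r a = factor_disc r P Q" by (rule form_disc_eq)
  have PQ: "P i * Q j - P j * Q i = - jac * (z i - z j)" for i j
    by (simp add: P_def Q_def jac_def algebra_simps)
  have "cmod (factor_disc r P Q) = cmod (factor_disc r P Q * (\<Prod>j<r. \<Prod>i<j. - 1))"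
    by (simp add: norm_mult prod_norm[symmetric] norm_power del: prod_constant)
  also have "\<dots> = (\<Prod>i<r. cmod (\<Prod>j\<in>{..<r} - {i}. - jac * (z i - z j)))"
    unfolding factor_disc_symmetric PQ by (simp add: prod_norm)
  also have "\<dots> = (\<Prod>i<r. cmod jac ^ (r - 1) * real r)"
  proof (rule prod.cong[OF refl])
    fix i assume "i \<in> {..<r}"
    then show "cmod (\<Prod>j\<in>{..<r} - {i}. - jac * (z i - z j)) = cmod jac ^ (r - 1) * real r"
      using prod_root_of_unity_differences[of i r]
      unfolding prod.distrib norm_mult by (simp add: z_def norm_power)
  qed
  finally show ?thesis by (simp add: fd)
qed

lemma normalized_disc_eq:
  assumes "h \<ge> 1"
  shows "normalized_disc r a h = ((cmod jac / 2) ^ r / real h ^ 2) ^ (r - 1)"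
proof -
  have e: "r\<^sup>2 - r = r * (r - 1)" "2 * r - 2 = 2 * (r - 1)"
    by (simp_all add: power2_eq_square diff_mult_distrib2)
  have "(cmod jac ^ (r - 1)) ^ r = (cmod jac ^ r) ^ (r - 1)"
    by (simp only: power_mult[symmetric] mult.commute)
  then have "(cmod jac ^ (r - 1) * real r) ^ r = (cmod jac ^ r) ^ (r - 1) * real r ^ r"
    by (simp only: power_mult_distrib)
  moreover have "real r ^ r > 0" using r3 by simp
  ultimately have "normalized_disc r a h =
      (cmod jac ^ r) ^ (r - 1) / (2 ^ (r * (r - 1)) * real h ^ (2 * (r - 1)))"
    unfolding normalized_disc_def form_disc_norm e by simp
  then show ?thesis by (simp add: power_divide power_mult power_mult_distrib)
qed

end

section \<open>Consequences of the discriminant hypothesis\<close>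

lemma ln_bounds_from_hypothesis:
  fixes r :: nat and \<Omega> h :: real
  defines "q \<equiv> (real r)\<^sup>2 - 5 * real r - 2"
  assumes r: "r \<ge> 7" and h: "h \<ge> 1" and "\<Omega> > 0"
    and hyp: "(\<Omega> / h\<^sup>2) ^ (r - 1) \<ge>
      real r powr (13 * (real r)\<^sup>2 * (real r - 1) / q) *
      h powr (4 * (real r - 1) * ((real r)\<^sup>2 - real r + 2) / q)"
  shows "q * ln \<Omega> \<ge> 13 * (real r)\<^sup>2 * ln (real r) + (6 * (real r)\<^sup>2 - 14 * real r + 4) * ln h"
proof -
  have r7: "real r \<ge> 7" using r by simp
  have q: "q > 0"
  proof -
    have "7 * real r \<le> real r * real r" using r7 by (intro mult_right_mono) auto
    then show ?thesis unfolding q_def power2_eq_square using r7 by linarith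
  qed
  have pos: "0 < real r powr (13 * (real r)\<^sup>2 * (real r - 1) / q)"
    "0 < h powr (4 * (real r - 1) * ((real r)\<^sup>2 - real r + 2) / q)" "0 < \<Omega> / h\<^sup>2"
    using r h \<open>\<Omega> > 0\<close> by auto
  have "ln (real r powr (13 * (real r)\<^sup>2 * (real r - 1) / q) *
      h powr (4 * (real r - 1) * ((real r)\<^sup>2 - real r + 2) / q)) \<le> ln ((\<Omega> / h\<^sup>2) ^ (r - 1))"
    using hyp pos by (subst ln_le_cancel_iff) auto
  also have "ln ((\<Omega> / h\<^sup>2) ^ (r - 1)) = (real r - 1) * (ln \<Omega> - 2 * ln h)"
    using pos h r \<open>\<Omega> > 0\<close> by (simp add: ln_realpow ln_div of_nat_diff)
  also have "ln (real r powr (13 * (real r)\<^sup>2 * (real r - 1) / q) *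
      h powr (4 * (real r - 1) * ((real r)\<^sup>2 - real r + 2) / q)) =
      (real r - 1) * ((13 * (real r)\<^sup>2 * ln (real r) + 4 * ((real r)\<^sup>2 - real r + 2) * ln h) / q)"
    using pos r h by (simp add: ln_mult ln_powr algebra_simps add_divide_distrib diff_divide_distrib)
  finally have "(13 * (real r)\<^sup>2 * ln (real r) + 4 * ((real r)\<^sup>2 - real r + 2) * ln h) / q \<le> ln \<Omega> - 2 * ln h"
    by (rule mult_left_le_imp_le) (use r in simp)
  \<comment> \<open>The common factor r - 1 is gone. Moving 2 q ln h across gives ln h the
    coefficient 4 (r^2 - r + 2) + 2 q = 6 r^2 - 14 r + 4.\<close>
  then have "13 * (real r)\<^sup>2 * ln (real r) + 4 * ((real r)\<^sup>2 - real r + 2) * ln h \<le> (ln \<Omega> - 2 * ln h) * q"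
    using q by (simp add: pos_divide_le_eq)
  then show ?thesis by (simp add: q_def algebra_simps)
qed

text \<open>Uses \<open>2^8 \<le> r^3\<close> and \<open>216 \<le> r^3\<close> to absorb the numerical constants into powers of \<open>r\<close>.\<close>

lemma size_estimates:
  fixes r :: nat and \<Omega> h s x :: real
  defines "q \<equiv> (real r)\<^sup>2 - 5 * real r - 2" and "G \<equiv> 12 * real r ^ 3 * s"
  assumes r: "r \<ge> 7" and h: "h \<ge> 1" and \<Omega>: "\<Omega> > 0" and s: "s \<ge> 1"
    and ln\<Omega>: "q * ln \<Omega> \<ge> 13 * (real r)\<^sup>2 * ln (real r) + (6 * (real r)\<^sup>2 - 14 * real r + 4) * ln h"
    and sb: "s ^ (r - 2) \<le> real r ^ 2 * (2 ^ r * \<Omega>)"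
    and x: "x > 0" "\<Omega> \<le> 4 * x\<^sup>2"
  shows "(9 * h\<^sup>2 * G) ^ r \<le> x ^ (r - 2)" "9 * h\<^sup>2 * G < x" "9 * h \<le> x"
proof -
  define R where "R = real r"
  have R: "R \<ge> 7" using r by (simp add: R_def)
  define l k L m where "l = ln R" and "k = ln h" and "L = ln \<Omega>" and "m = ln s"
  have k: "k \<ge> 0" using h by (simp add: k_def)
  have q: "q = R\<^sup>2 - 5 * R - 2" by (simp add: q_def R_def)
  have q0: "q > 0"
  proof -
    have "7 * R \<le> R * R" using R by (intro mult_right_mono) auto
    then show ?thesis unfolding q power2_eq_square using R by linarith
  qed
  have l0: "l > 0" using R by (simp add: l_def)
  have c2: "8 * ln 2 \<le> 3 * l" and c216: "ln 216 \<le> 3 * l"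
  proof -
    have R3: "(7::real) ^ 3 \<le> R ^ 3" using R by (intro power_mono) auto
    have e: "3 * l = ln (R ^ 3)" using R by (simp add: l_def ln_realpow)
    have "8 * ln 2 = ln ((2::real) ^ 8)" by (simp only: ln_realpow)
    then show "8 * ln 2 \<le> 3 * l" unfolding e using R3 R by simp
    show "ln 216 \<le> 3 * l" unfolding e using R3 R by simp
  qed
  have L: "q * L \<ge> 13 * R\<^sup>2 * l + (6 * R\<^sup>2 - 14 * R + 4) * k"
    using ln\<Omega> by (simp add: L_def l_def k_def R_def)
  have m: "(R - 2) * m \<le> 2 * l + R * ln 2 + L"
  proof -
    have "ln (s ^ (r - 2)) \<le> ln (real r ^ 2 * (2 ^ r * \<Omega>))"
      using sb s \<Omega> r by (subst ln_le_cancel_iff) auto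
    also have "\<dots> = 2 * l + R * ln 2 + L"
      using \<Omega> r by (simp add: ln_mult ln_realpow l_def L_def R_def)
    finally show ?thesis using s r by (simp add: ln_realpow m_def R_def of_nat_diff)
  qed
  have lx: "L \<le> 2 * ln 2 + 2 * ln x"
  proof -
    have "L \<le> ln (4 * x\<^sup>2)" unfolding L_def using x \<Omega> by (subst ln_le_cancel_iff) auto
    also have "4 * x\<^sup>2 = (2 * x) ^ 2" by (simp add: power2_eq_square)
    also have "ln ((2 * x) ^ 2) = 2 * (ln 2 + ln x)" using x by (subst ln_realpow) (simp_all add: ln_mult)
    finally show ?thesis by simp
  qed
  \<comment> \<open>In this variable the differences of polynomials below have nonnegative
    coefficients.\<close>
  define t where "t = R - 7"
  have t: "t \<ge> 0" "R = t + 7" using R by (auto simp: t_def)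
  \<comment> \<open>What the target needs after multiplication by 2 (R - 2): eliminating m costs 2 R
    L and ln x supplies (R - 2)^2 L, whence R^2 - 6 R + 4; the terms in l add up to 51/4 R^2 - 20
    R.\<close>
  have main: "4 * R * (R - 2) * k + (51 / 4 * R\<^sup>2 - 20 * R) * l \<le> (R\<^sup>2 - 6 * R + 4) * L"
  proof -
    define P where "P = R\<^sup>2 - 6 * R + 4"
    have P0: "P \<ge> 0" using t unfolding P_def by (simp add: power2_eq_square algebra_simps)
    have "q * (51 / 4 * R\<^sup>2 - 20 * R) \<le> P * (13 * R\<^sup>2)"
    proof -
      have "P * (13 * R\<^sup>2) - q * (51 / 4 * R\<^sup>2 - 20 * R) =
          R * (1 / 4 * t ^ 3 + 11 * t ^ 2 + 379 / 4 * t + 170)"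
        unfolding P_def q t(2) by algebra
      moreover have "0 \<le> R * (1 / 4 * t ^ 3 + 11 * t ^ 2 + 379 / 4 * t + 170)" using t R by simp
      ultimately show ?thesis by linarith
    qed
    then have 1: "q * (51 / 4 * R\<^sup>2 - 20 * R) * l \<le> P * (13 * R\<^sup>2) * l"
      using l0 by (intro mult_right_mono) auto
    have "q * (4 * R * (R - 2)) \<le> P * (6 * R\<^sup>2 - 14 * R + 4)"
    proof -
      have "P * (6 * R\<^sup>2 - 14 * R + 4) - q * (4 * R * (R - 2)) =
          2 * (t + 5) * (t ^ 3 + 12 * t ^ 2 + 43 * t + 52)"
        unfolding P_def q t(2) by algebra
      moreover have "0 \<le> 2 * (t + 5) * (t ^ 3 + 12 * t ^ 2 + 43 * t + 52)" using t by simp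
      ultimately show ?thesis by linarith
    qed
    then have 2: "q * (4 * R * (R - 2)) * k \<le> P * (6 * R\<^sup>2 - 14 * R + 4) * k"
      using k by (intro mult_right_mono) auto
    have "P * (13 * R\<^sup>2 * l + (6 * R\<^sup>2 - 14 * R + 4) * k) \<le> P * (q * L)"
      using L P0 by (intro mult_left_mono) auto
    then have "q * (4 * R * (R - 2) * k + (51 / 4 * R\<^sup>2 - 20 * R) * l) \<le> q * (P * L)"
      using 1 2 by (simp add: algebra_simps)
    then show ?thesis using q0 by (simp add: P_def)
  qed
  have lnK: "R * (ln 108 + 2 * k + 3 * l + m) \<le> (R - 2) * ln x"
  proof -
    have "ln (108::real) + ln 2 = ln 216" using ln_mult[of "108::real" 2] by simp
    then have c108: "ln 108 \<le> 3 * l - ln 2" using c216 by linarith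
    have "2 * R * ((R - 2) * m) \<le> 2 * R * (2 * l + R * ln 2 + L)"
      using m R by (intro mult_left_mono) auto
    also have "\<dots> \<le> 2 * R * (2 * l + R * (3 / 8 * l) + L)"
      using c2 R by (intro mult_left_mono add_right_mono add_left_mono) auto
    finally have A: "2 * R * ((R - 2) * m) \<le> 2 * R * (2 * l + R * (3 / 8 * l) + L)" .
    have B: "2 * (R - 2) * R * ln 108 \<le> 2 * (R - 2) * R * (3 * l - ln 2)"
      using c108 R by (intro mult_left_mono) auto
    have C: "(R - 2) * (R - 2) * L \<le> (R - 2) * (R - 2) * (2 * ln 2 + 2 * ln x)"
      using lx R by (intro mult_left_mono) auto
    have D: "0 \<le> 4 * (R - 2) * ln 2" using R by simp
    have "2 * (R - 2) * (R * (ln 108 + 2 * k + 3 * l + m)) \<le> 2 * (R - 2) * ((R - 2) * ln x)"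
    proof -
      have "2 * (R - 2) * ((R - 2) * y) - 2 * (R - 2) * (R * (c + 2 * k + 3 * l + m)) =
          (2 * R * (2 * l + R * (3 / 8 * l) + L) - 2 * R * ((R - 2) * m)) +
          (2 * (R - 2) * R * (3 * l - b) - 2 * (R - 2) * R * c) +
          ((R - 2) * (R - 2) * (2 * b + 2 * y) - (R - 2) * (R - 2) * L) +
          ((R\<^sup>2 - 6 * R + 4) * L - (4 * R * (R - 2) * k + (51 / 4 * R\<^sup>2 - 20 * R) * l)) +
          4 * (R - 2) * b" for b c y
        by (simp add: field_simps power2_eq_square)
      note this[of "ln x" "ln 108" "ln 2"]
      then show ?thesis using A B C D main by linarith
    qed
    then show ?thesis by (rule mult_left_le_imp_le) (use R in simp)
  qed
  define K where "K = 9 * h\<^sup>2 * G"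
  have K: "K = 108 * h\<^sup>2 * R ^ 3 * s" by (simp add: K_def G_def R_def)
  have K0: "K > 0" using h R s by (simp add: K)
  have "ln K = ln 108 + 2 * k + 3 * l + m"
    using h R s by (simp add: K ln_mult ln_realpow k_def l_def m_def)
  then have "ln (K ^ r) \<le> ln (x ^ (r - 2))"
    using lnK K0 x r by (simp add: ln_realpow R_def of_nat_diff)
  then have Kx: "K ^ r \<le> x ^ (r - 2)" using K0 x by (subst (asm) ln_le_cancel_iff) auto
  then show "(9 * h\<^sup>2 * G) ^ r \<le> x ^ (r - 2)" by (simp add: K_def)
  have Kh: "9 * h < K"
  proof -
    have "h \<le> h\<^sup>2" using h by (simp add: power2_eq_square)
    moreover have "1 * 1 \<le> R ^ 3 * s" using R s by (intro mult_mono) auto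
    ultimately have "h * 1 \<le> h\<^sup>2 * (R ^ 3 * s)" using h by (intro mult_mono) auto
    then show ?thesis unfolding K using h by (simp add: mult_ac)
  qed
  then have "1 < K" using h by linarith
  then have "1 < K ^ r" using r by (intro one_less_power) auto
  then have "1 < x ^ (r - 2)" using Kx by linarith
  then have "1 < x" using x r by (metis linorder_not_le power_le_one less_imp_le)
  then have "x ^ (r - 2) < x ^ r" using r by (intro power_strict_increasing) auto
  then have "K ^ r < x ^ r" using Kx by linarith
  then have "K < x" by (rule power_less_imp_less_base) (use x in simp)
  then show "9 * h\<^sup>2 * G < x" "9 * h \<le> x" using Kh by (auto simp: K_def)
qed

lemma omega_lower_bound:
  fixes r :: nat and \<Omega> h :: real
  defines "q \<equiv> (real r)\<^sup>2 - 5 * real r - 2"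
  assumes r: "r \<ge> 7" and h: "h \<ge> 1" and \<Omega>: "\<Omega> > 0"
    and ln\<Omega>: "q * ln \<Omega> \<ge> 13 * (real r)\<^sup>2 * ln (real r) + (6 * (real r)\<^sup>2 - 14 * real r + 4) * ln h"
  shows "729 * h\<^sup>2 < \<Omega>"
proof -
  define R where "R = real r"
  have R: "R \<ge> 7" using r by (simp add: R_def)
  have q: "q = R\<^sup>2 - 5 * R - 2" by (simp add: q_def R_def)
  have R2: "7 * R \<le> R\<^sup>2" unfolding power2_eq_square using R by (intro mult_right_mono) auto
  have q0: "q > 0" unfolding q using R2 R by linarith
  have "q * (13 * ln R) \<le> 13 * R\<^sup>2 * ln R"
    unfolding q using R by (simp add: algebra_simps)
  moreover have "q * (2 * ln h) \<le> (6 * R\<^sup>2 - 14 * R + 4) * ln h"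
  proof -
    have "q * 2 = 2 * R\<^sup>2 - 10 * R - 4" by (simp add: q)
    then have "q * 2 \<le> 6 * R\<^sup>2 - 14 * R + 4" using R2 R by linarith
    then have "q * 2 * ln h \<le> (6 * R\<^sup>2 - 14 * R + 4) * ln h"
      using h by (intro mult_right_mono) auto
    then show ?thesis by (simp only: mult.assoc)
  qed
  ultimately have "q * (13 * ln R + 2 * ln h) \<le> q * ln \<Omega>"
    using ln\<Omega> by (simp add: R_def distrib_left)
  then have "13 * ln R + 2 * ln h \<le> ln \<Omega>" using q0 by simp
  moreover have "ln (R ^ 13 * h\<^sup>2) = 13 * ln R + 2 * ln h"
    using R h by (simp add: ln_mult ln_realpow)
  ultimately have "R ^ 13 * h\<^sup>2 \<le> \<Omega>"
    using R h \<Omega> by (metis ln_le_cancel_iff mult_pos_pos zero_less_power less_le_trans zero_less_one zero_less_numeral)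
  moreover have "(7::real) ^ 13 \<le> R ^ 13" using R by (intro power_mono) auto
  then have "729 * h\<^sup>2 < R ^ 13 * h\<^sup>2" using h by (intro mult_strict_right_mono) auto
  ultimately show ?thesis by linarith
qed

section \<open>Counting solutions\<close>

lemma coprime_proportional:
  fixes x y z t :: int
  assumes "coprime x y" "coprime z t" "x * t = y * z"
  shows "(z, t) = (x, y) \<or> (z, t) = (- x, - y)"
proof -
  have "x dvd z" using assms by (metis coprime_dvd_mult_right_iff dvd_triv_left)
  moreover have "z dvd x" using assms by (metis coprime_dvd_mult_left_iff dvd_triv_right)
  moreover have "y dvd t" using assms
    by (metis coprime_commute coprime_dvd_mult_right_iff dvd_triv_left)
  moreover have "t dvd y" using assms
    by (metis coprime_commute coprime_dvd_mult_left_iff dvd_triv_right)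
  ultimately have "\<bar>z\<bar> = \<bar>x\<bar>" "\<bar>t\<bar> = \<bar>y\<bar>" by (auto intro: zdvd_antisym_abs)
  then show ?thesis using assms(3) by (auto simp: abs_eq_iff)
qed

text \<open>On \<open>L\<close> the map \<open>g\<close> is a function of \<open>f\<close>. Here
  \<open>f\<close> will be the nearby root of unity and \<open>g\<close> the class up to
  sign.\<close>

lemma card_image_factor:
  assumes "\<And>p q. p \<in> L \<Longrightarrow> q \<in> L \<Longrightarrow> f p = f q \<Longrightarrow> g p = g q"
    and "f ` L \<subseteq> V" "finite V"
  shows "finite (g ` L)" "card (g ` L) \<le> card V"
proof -
  define k where "k z = g (SOME p. p \<in> L \<and> f p = z)" for z
  have "g p = k (f p)" if "p \<in> L" for p
  proof -
    have "\<exists>q. q \<in> L \<and> f q = f p" using that by blast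
    then have "(SOME q. q \<in> L \<and> f q = f p) \<in> L \<and> f (SOME q. q \<in> L \<and> f q = f p) = f p"
      by (rule someI_ex)
    then show ?thesis using assms(1)[OF that] unfolding k_def by metis
  qed
  then have sub: "g ` L \<subseteq> k ` V" using assms(2) by auto
  then show "finite (g ` L)" using assms(3) by (meson finite_imageI finite_subset)
  have "card (g ` L) \<le> card (k ` V)" using sub assms(3) by (intro card_mono) auto
  also have "\<dots> \<le> card V" using assms(3) by (rule card_image_le)
  finally show "card (g ` L) \<le> card V" .
qed

lemma real_root_of_unity:
  fixes z :: complex
  assumes "z ^ r = 1" "z \<in> \<real>" "r > 0"
  shows "z = 1 \<or> (even r \<and> z = - 1)"
proof -
  obtain c where c: "z = of_real c" using assms(2) by (auto elim: Reals_cases)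
  have "c ^ r = 1" using assms(1) unfolding c by (metis of_real_eq_1_iff of_real_power)
  then have "\<bar>c\<bar> ^ r = 1" by (metis abs_1 power_abs)
  then have "\<bar>c\<bar> = 1" using assms(3) by (intro power_eq_imp_eq_base[of "\<bar>c\<bar>" r 1]) auto
  then have "c = 1 \<or> c = - 1" by linarith
  then show ?thesis using \<open>c ^ r = 1\<close> by (cases "even r") (auto simp: c)
qed

locale diagonal_form_large_disc = diagonal_form +
  fixes h :: nat
  assumes r7: "r \<ge> 7" and h1: "h \<ge> 1" and primitive: "gcd (gcd A C) B = 1"
    and disc_large: "normalized_disc r a h \<ge>
      real r powr (13 * (real r)\<^sup>2 * (real r - 1) / ((real r)\<^sup>2 - 5 * real r - 2)) *
      real h powr (4 * (real r - 1) * ((real r)\<^sup>2 - real r + 2) / ((real r)\<^sup>2 - 5 * real r - 2))"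
begin

definition \<Omega> :: real where "\<Omega> = (cmod jac / 2) ^ r"
definition large :: "int \<times> int \<Rightarrow> bool" where
  "large p \<longleftrightarrow> cmod jac / 2 \<le> (max (cmod (u p)) (cmod (v p)))\<^sup>2"
definition close :: "complex \<Rightarrow> int \<times> int \<Rightarrow> bool" where
  "close \<zeta> p \<longleftrightarrow> real r * cmod (\<zeta> * v p / u p - 1) \<le> 3 * real h / cmod (u p) ^ r"
definition solutions :: "(int \<times> int) set" where "solutions = primitive_solutions r a h"

lemma solutions_iff:
  "p \<in> solutions \<longleftrightarrow> coprime (fst p) (snd p) \<and> form_val p \<noteq> 0 \<and> \<bar>form_val p\<bar> \<le> int h"
  by (cases p) (auto simp: solutions_def primitive_solutions_def form_val_def)

lemma omega_pos: "\<Omega> > 0"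
  using jac_nonzero by (simp add: \<Omega>_def jac_def)

lemma ln_omega: "((real r)\<^sup>2 - 5 * real r - 2) * ln \<Omega> \<ge>
    13 * (real r)\<^sup>2 * ln (real r) + (6 * (real r)\<^sup>2 - 14 * real r + 4) * ln (real h)"
  using disc_large normalized_disc_eq[OF h1] h1 omega_pos r7
  by (intro ln_bounds_from_hypothesis) (auto simp: \<Omega>_def)

lemma omega_large: "729 * (real h)\<^sup>2 < \<Omega>"
  using ln_omega omega_pos r7 h1 by (intro omega_lower_bound) auto

lemma form_val_norm:
  assumes "p \<in> solutions"
  shows "cmod (u p ^ r - v p ^ r) \<le> real h"
proof -
  have "\<bar>form_val p\<bar> \<le> int h" using assms by (simp add: solutions_iff)
  then have "real_of_int \<bar>form_val p\<bar> \<le> real_of_int (int h)" by (simp only: of_int_le_iff)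
  then show ?thesis unfolding form_val[symmetric] norm_of_int by simp
qed

text \<open>Largeness concerns only the maximum of |u| and |v|. But |u^r - v^r| <= h, and h is at
  most half of M = max(|u|, |v|)^r because M^2 >= \<Omega> > 729 h^2; so |u|^r >= M / 2.\<close>

lemma large_size:
  assumes p: "p \<in> solutions" "large p"
  shows "u p \<noteq> 0" "\<Omega> \<le> 4 * (cmod (u p) ^ r)\<^sup>2"
proof -
  define M where "M = max (cmod (u p)) (cmod (v p)) ^ r"
  have M0: "M \<ge> 0" by (simp add: M_def le_max_iff_disj)
  have "\<Omega> \<le> ((max (cmod (u p)) (cmod (v p)))\<^sup>2) ^ r"
    unfolding \<Omega>_def using p(2) by (intro power_mono) (auto simp: large_def)
  also have "\<dots> = M\<^sup>2" by (simp only: M_def power_mult[symmetric] mult.commute)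
  finally have M: "\<Omega> \<le> M\<^sup>2" .
  have "(2 * real h)\<^sup>2 = 4 * (real h)\<^sup>2" by (simp add: power_mult_distrib)
  moreover have "0 \<le> (real h)\<^sup>2" by simp
  ultimately have "(2 * real h)\<^sup>2 \<le> M\<^sup>2" using omega_large M by linarith
  then have hM: "2 * real h \<le> M" using M0 by (rule power2_le_imp_le)
  have "M \<le> cmod (u p ^ r) + real h"
  proof -
    have "cmod (v p ^ r) \<le> cmod (u p ^ r) + cmod (u p ^ r - v p ^ r)"
      by (metis norm_minus_commute norm_triangle_sub)
    then have "cmod (v p ^ r) \<le> cmod (u p ^ r) + real h" using form_val_norm[OF p(1)] by simp
    then show ?thesis by (auto simp: M_def max_def norm_power)
  qed
  then have "M \<le> 2 * cmod (u p) ^ r" using hM by (simp add: norm_power)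
  then have "M\<^sup>2 \<le> (2 * cmod (u p) ^ r)\<^sup>2" using M0 by (rule power_mono)
  then show "\<Omega> \<le> 4 * (cmod (u p) ^ r)\<^sup>2" using M by (simp add: power_mult_distrib)
  then show "u p \<noteq> 0" using omega_pos r7 by (auto simp: power_0_left)
qed

lemma large_estimates:
  assumes p: "p \<in> solutions" "large p"
  defines "G \<equiv> 12 * real r ^ 3 * cmod (w - w')"
  shows "(9 * (real h)\<^sup>2 * G) ^ r \<le> (cmod (u p) ^ r) ^ (r - 2)"
    "9 * (real h)\<^sup>2 * G < cmod (u p) ^ r" "9 * real h \<le> cmod (u p) ^ r"
proof -
  have x: "cmod (u p) ^ r > 0" using large_size(1)[OF p] by simp
  have h: "real h \<ge> 1" using h1 by simp
  have "cmod (w - w') ^ (r - 2) \<le> real r ^ 2 * cmod jac ^ r" by (rule w_diff_norm_bound[OF primitive])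
  also have "cmod jac ^ r = 2 ^ r * \<Omega>" by (simp add: \<Omega>_def power_divide)
  finally have sb: "cmod (w - w') ^ (r - 2) \<le> real r ^ 2 * (2 ^ r * \<Omega>)" .
  note est = size_estimates[OF r7 h omega_pos w_diff_norm_ge_1 ln_omega sb x large_size(2)[OF p]]
  from est show "(9 * (real h)\<^sup>2 * G) ^ r \<le> (cmod (u p) ^ r) ^ (r - 2)"
    "9 * (real h)\<^sup>2 * G < cmod (u p) ^ r" "9 * real h \<le> cmod (u p) ^ r"
    unfolding G_def by blast+
qed

lemma large_ratio:
  assumes p: "p \<in> solutions" "large p"
  shows "cmod ((v p / u p) ^ r - 1) \<le> real h / cmod (u p) ^ r"
    "cmod ((v p / u p) ^ r - 1) \<le> 1 / 9" "v p \<noteq> 0"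
proof -
  have up: "u p \<noteq> 0" by (rule large_size(1)[OF p])
  have "(v p / u p) ^ r - 1 = - (u p ^ r - v p ^ r) / u p ^ r"
    using up by (simp add: power_divide field_simps)
  then have "cmod ((v p / u p) ^ r - 1) = cmod (u p ^ r - v p ^ r) / cmod (u p) ^ r"
    by (simp add: norm_divide norm_power norm_minus_commute)
  then show 1: "cmod ((v p / u p) ^ r - 1) \<le> real h / cmod (u p) ^ r"
    using form_val_norm[OF p(1)] by (simp add: divide_right_mono)
  also have "\<dots> \<le> 1 / 9" using large_estimates(3)[OF p] up by (simp add: field_simps)
  finally show 2: "cmod ((v p / u p) ^ r - 1) \<le> 1 / 9" .
  show "v p \<noteq> 0" using 2 r7 by (auto simp: power_0_left)
qed

lemma large_close:
  assumes p: "p \<in> solutions" "large p"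
  shows "\<exists>\<zeta>. \<zeta> ^ r = 1 \<and> close \<zeta> p \<and> ((v p / u p) ^ r \<in> \<real> \<longrightarrow> \<zeta> * v p / u p \<in> \<real>)"
proof -
  have "cmod ((v p / u p) ^ r - 1) \<le> 1 / 4" using large_ratio(2)[OF p] by simp
  then obtain \<zeta> where \<zeta>: "\<zeta> ^ r = 1" "real r * cmod (\<zeta> * (v p / u p) - 1) \<le> 3 * cmod ((v p / u p) ^ r - 1)"
    "(v p / u p) ^ r \<in> \<real> \<Longrightarrow> \<zeta> * (v p / u p) \<in> \<real>"
    using near_root_of_unity[of r "v p / u p"] r3 by blast
  have "real r * cmod (\<zeta> * (v p / u p) - 1) \<le> 3 * (real h / cmod (u p) ^ r)"
    using \<zeta>(2) large_ratio(1)[OF p] by linarith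
  then show ?thesis using \<zeta> by (auto simp: close_def intro!: exI[of _ \<zeta>])
qed

lemma cross_det: "u p * v q - v p * u q = jac * of_int (fst p * snd q - snd p * fst q)"
  by (simp add: u_def v_def jac_def algebra_simps)

lemma dependent_solutions:
  assumes "p \<in> solutions" "q \<in> solutions" "u p * v q = v p * u q"
  shows "q = p \<or> q = (- fst p, - snd p)"
proof -
  have "jac * of_int (fst p * snd q - snd p * fst q) = 0" using cross_det[of p q] assms(3) by simp
  then have "of_int (fst p * snd q - snd p * fst q) = (0 :: complex)"
    using jac_nonzero by (simp only: jac_def mult_eq_0_iff) simp
  then have "fst p * snd q = snd p * fst q" by (simp only: of_int_eq_0_iff)
  then show ?thesis
    using coprime_proportional[of "fst p" "snd p" "fst q" "snd q"] assms(1,2)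
    by (auto simp: solutions_iff prod_eq_iff)
qed

lemma not_large_dependent:
  assumes "\<not> large p" "\<not> large q"
  shows "u p * v q = v p * u q"
proof (rule ccontr)
  assume indep: "u p * v q \<noteq> v p * u q"
  define M N where "M = max (cmod (u p)) (cmod (v p))" and "N = max (cmod (u q)) (cmod (v q))"
  have MN: "M \<ge> 0" "N \<ge> 0" by (auto simp: M_def N_def max_def)
  define d where "d = fst p * snd q - snd p * fst q"
  have det: "u p * v q - v p * u q = jac * of_int d" unfolding d_def by (rule cross_det)
  then have "d \<noteq> 0" using indep by auto
  then have "1 \<le> \<bar>real_of_int d\<bar>" by linarith
  then have "cmod jac * 1 \<le> cmod jac * \<bar>real_of_int d\<bar>" by (intro mult_left_mono) auto
  also have "\<dots> = cmod (jac * of_int d)" by (simp only: norm_mult norm_of_int)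
  also have "\<dots> = cmod (u p * v q - v p * u q)" unfolding det ..
  also have "\<dots> \<le> cmod (u p) * cmod (v q) + cmod (v p) * cmod (u q)"
    by (metis norm_mult norm_triangle_ineq4)
  also have "\<dots> \<le> M * N + M * N"
    unfolding M_def N_def by (intro add_mono mult_mono) (auto simp: max_def)
  finally have le: "cmod jac / 2 \<le> M * N" by simp
  have "M\<^sup>2 < cmod jac / 2" "N\<^sup>2 < cmod jac / 2" using assms by (auto simp: large_def M_def N_def)
  moreover have "2 * (M * N) \<le> M\<^sup>2 + N\<^sup>2" using sum_squares_bound[of M N] by (simp add: mult.assoc)
  ultimately show False using le by linarith
qed

text \<open>Replacing (\<gamma>, \<delta>) by \<zeta> (\<gamma>, \<delta>) leaves the form unchanged
  because \<zeta>^r = 1, multiplies \<kappa> by \<zeta> and keeps A, B, C, w, w' and |j|. Both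
  ratios v / u are now close to 1, and the gap argument applies with the smaller |u| in the role of
  p.\<close>

lemma close_solutions_dependent:
  assumes p: "p \<in> solutions" "large p" and q: "q \<in> solutions" "large q"
    and \<zeta>: "\<zeta> ^ r = 1" "close \<zeta> p" "close \<zeta> q"
  shows "u p * v q = v p * u q"
proof -
  have z0: "\<zeta> \<noteq> 0" using \<zeta>(1) r3 by (auto simp: power_0_left)
  interpret Z: diagonal_form r a \<alpha> \<beta> "\<zeta> * \<gamma>" "\<zeta> * \<delta>" "\<zeta> * \<kappa>" A B C
  proof
    show "r \<ge> 3" by (rule r3)
    have "\<alpha> * (\<zeta> * \<delta>) - \<beta> * (\<zeta> * \<gamma>) = \<zeta> * (\<alpha> * \<delta> - \<beta> * \<gamma>)" by (simp add: algebra_simps)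
    then show "\<alpha> * (\<zeta> * \<delta>) - \<beta> * (\<zeta> * \<gamma>) \<noteq> 0" using jac_nonzero z0 by simp
    fix x y :: complex
    have "(\<zeta> * \<gamma> * x + \<zeta> * \<delta> * y) ^ r = (\<zeta> * (\<gamma> * x + \<delta> * y)) ^ r" by (simp add: algebra_simps)
    then show "binary_form r a x y = (\<alpha> * x + \<beta> * y) ^ r - (\<zeta> * \<gamma> * x + \<zeta> * \<delta> * y) ^ r"
      using \<zeta>(1) by (simp add: form power_mult_distrib)
  next
    show "\<alpha> * (\<zeta> * \<gamma>) = \<zeta> * \<kappa> * of_int A" "\<beta> * (\<zeta> * \<delta>) = \<zeta> * \<kappa> * of_int C"
      using quad(1,3) by (simp_all add: mult_ac)
    have "\<alpha> * (\<zeta> * \<delta>) + \<beta> * (\<zeta> * \<gamma>) = \<zeta> * (\<alpha> * \<delta> + \<beta> * \<gamma>)" by (simp add: algebra_simps)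
    then show "\<alpha> * (\<zeta> * \<delta>) + \<beta> * (\<zeta> * \<gamma>) = \<zeta> * \<kappa> * of_int B"
      by (simp add: quad(2))
  qed
  have "cmod \<zeta> ^ r = 1" using \<zeta>(1) by (metis norm_one norm_power)
  then have zn: "cmod \<zeta> = 1" using r3 by (intro power_eq_imp_eq_base[of "cmod \<zeta>" r 1]) auto
  have Zv: "Z.v x = \<zeta> * v x" for x
    unfolding Z.v_def v_def by (simp only: distrib_left mult_ac)
  have Zw: "Z.w = w" "Z.w' = w'" using z0 unfolding Z.w_def w_def Z.w'_def w'_def by simp_all
  have Zj: "cmod Z.jac = cmod jac"
  proof -
    have "Z.jac = \<zeta> * jac" unfolding Z.jac_def jac_def by (simp add: algebra_simps)
    then show ?thesis using zn by (simp add: norm_mult)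
  qed
  have main: False
    if p: "p \<in> solutions" "large p" and q: "q \<in> solutions" "large q"
      and cl: "close \<zeta> p" "close \<zeta> q" and indep: "u p * v q \<noteq> v p * u q"
      and le: "cmod (u p) \<le> cmod (u q)" for p q
  proof (rule Z.no_two_close_solutions[of "real h" p q, unfolded Zv Zw Zj])
    show "6 \<le> r" "1 \<le> real h" using r7 h1 by auto
    show "u p \<noteq> 0" "u q \<noteq> 0" "\<zeta> * v q \<noteq> 0"
      using large_size(1) large_ratio(3) p q z0 by auto
    show "form_val p \<noteq> 0" using p(1) by (simp add: solutions_iff)
    show "u p * (\<zeta> * v q) \<noteq> \<zeta> * v p * u q" using indep z0 by (simp add: mult_ac)
    show "cmod (u p) \<le> cmod (u q)" by (rule le)
    show "real r * cmod (\<zeta> * v p / u p - 1) \<le> 3 * real h / cmod (u p) ^ r"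
      "real r * cmod (\<zeta> * v q / u q - 1) \<le> 3 * real h / cmod (u q) ^ r"
      using cl by (auto simp: close_def)
    have "(\<zeta> * v p / u p) ^ r = 1 + ((v p / u p) ^ r - 1)"
      using \<zeta>(1) by (simp add: power_mult_distrib power_divide)
    then have "cmod ((\<zeta> * v p / u p) ^ r) \<le> 1 + cmod ((v p / u p) ^ r - 1)"
      by (metis norm_one norm_triangle_ineq)
    then show "cmod ((\<zeta> * v p / u p) ^ r) \<le> 3" using large_ratio(2)[OF p] by simp
    show "1 \<le> cmod (w - w')" by (rule w_diff_norm_ge_1)
    show "(9 * (real h)\<^sup>2 * (12 * real r ^ 3 * cmod (w - w'))) ^ r \<le> (cmod (u p) ^ r) ^ (r - 2)"
      "9 * (real h)\<^sup>2 * (12 * real r ^ 3 * cmod (w - w')) < cmod (u p) ^ r"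
      "9 * real h \<le> cmod (u p) ^ r"
      by (rule large_estimates[OF p])+
    show "729 * (real h)\<^sup>2 < (cmod jac / 2) ^ r" using omega_large by (simp add: \<Omega>_def)
  qed
  show ?thesis
  proof (rule ccontr)
    assume indep: "u p * v q \<noteq> v p * u q"
    then have "u q * v p \<noteq> v q * u p" by (simp add: mult.commute)
    then show False using main[OF p q \<zeta>(2,3) indep] main[OF q p \<zeta>(3,2)] by linarith
  qed
qed

text \<open>A fixed choice of root labels each large solution. The reality clause is carried along
  because for D > 0 labels of different solutions are compared.\<close>

definition nearest :: "int \<times> int \<Rightarrow> complex" where
  "nearest p = (SOME \<zeta>. \<zeta> ^ r = 1 \<and> close \<zeta> p \<and> ((v p / u p) ^ r \<in> \<real> \<longrightarrow> \<zeta> * v p / u p \<in> \<real>))"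

lemma nearest:
  assumes "p \<in> solutions" "large p"
  shows "nearest p ^ r = 1" "close (nearest p) p"
    "(v p / u p) ^ r \<in> \<real> \<Longrightarrow> nearest p * v p / u p \<in> \<real>"
  using someI_ex[OF large_close[OF assms]] unfolding nearest_def by blast+

text \<open>A large solution is determined up to sign by its label; the remaining solutions form at
  most one class, hence the + 1.\<close>

lemma num_solutions_bound:
  assumes "nearest ` {p \<in> solutions. large p} \<subseteq> V" "finite V" "card V \<le> n"
  shows "num_primitive_solutions r a h \<le> enat (n + 1)"
proof -
  define cls :: "int \<times> int \<Rightarrow> (int \<times> int) set" where "cls = (\<lambda>(x, y). {(x, y), (- x, - y)})"
  define L T where "L = {p \<in> solutions. large p}" and "T = {p \<in> solutions. \<not> large p}"
  have cls_eq: "cls p = cls q" if "p \<in> solutions" "q \<in> solutions" "u p * v q = v p * u q" for p q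
    using dependent_solutions[OF that] by (cases p) (auto simp: cls_def)
  have L: "finite (cls ` L)" "card (cls ` L) \<le> card V"
  proof -
    have dep: "cls p = cls q" if "p \<in> L" "q \<in> L" "nearest p = nearest q" for p q
    proof -
      have p: "p \<in> solutions" "large p" and q: "q \<in> solutions" "large q"
        using that by (auto simp: L_def)
      have "close (nearest p) q" using nearest(2)[OF q] that(3) by simp
      then show ?thesis
        by (intro cls_eq p q close_solutions_dependent[OF p q nearest(1,2)[OF p]])
    qed
    show "finite (cls ` L)" "card (cls ` L) \<le> card V"
      by (rule card_image_factor[of L nearest cls, OF dep assms(1)[folded L_def] assms(2)]; assumption)+
  qed
  have T: "finite (cls ` T)" "card (cls ` T) \<le> 1"
  proof -
    have "cls p = cls q" if "p \<in> T" "q \<in> T" for p q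
      using that not_large_dependent by (intro cls_eq) (auto simp: T_def)
    then have "\<exists>c. cls ` T \<subseteq> {c}" by (cases "T = {}") blast+
    then obtain c where "cls ` T \<subseteq> {c}" by blast
    then show "finite (cls ` T)" "card (cls ` T) \<le> 1"
      using card_mono[of "{c}" "cls ` T"] by (auto intro: finite_subset)
  qed
  have "solutions = L \<union> T" by (auto simp: L_def T_def)
  then have U: "cls ` solutions = cls ` L \<union> cls ` T" by (simp only: image_Un)
  have fin: "finite (cls ` solutions)" unfolding U using L T by simp
  have "card (cls ` solutions) \<le> card (cls ` L) + card (cls ` T)"
    unfolding U by (rule card_Un_le)
  then have "card (cls ` solutions) \<le> n + 1" using L(2) T(2) assms(3) by linarith
  then show ?thesis using fin
    unfolding num_primitive_solutions_def solutions_def[symmetric] cls_def[symmetric]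
    by (simp add: Let_def)
qed

lemma num_solutions_general: "num_primitive_solutions r a h \<le> enat (r + 1)"
proof (rule num_solutions_bound)
  show "nearest ` {p \<in> solutions. large p} \<subseteq> {z. z ^ r = 1}" using nearest(1) by auto
  show "finite {z :: complex. z ^ r = 1}" "card {z :: complex. z ^ r = 1} \<le> r"
    using finite_roots_unity[of r] card_roots_unity[of r] r3 by auto
qed

end

section \<open>The case D > 0\<close>

locale diagonal_form_real = diagonal_form_large_disc +
  assumes D_pos: "B\<^sup>2 - 4 * A * C > 0"
begin

lemma w_real: "w \<in> \<real>" "w' \<in> \<real>" "w - w' \<in> \<real>"
proof -
  define d where "d = B\<^sup>2 - 4 * A * C"
  have "d > 0" using D_pos by (simp add: d_def)
  then have "(w - w')\<^sup>2 = (of_real (sqrt (of_int d)))\<^sup>2"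
    unfolding w_diff_sq d_def[symmetric] of_real_power[symmetric] by simp
  then have "w - w' = of_real (sqrt (of_int d)) \<or> w - w' = - of_real (sqrt (of_int d))"
    by (rule power2_eq_iff[THEN iffD1])
  then show d: "w - w' \<in> \<real>" by auto
  have "w = (of_int B + (w - w')) / 2" "w' = (of_int B - (w - w')) / 2"
    using w_sum by (auto simp: field_simps)
  then show "w \<in> \<real>" "w' \<in> \<real>" using d
    by (metis Reals_add Reals_divide Reals_of_int Reals_numeral)
       (metis \<open>w' = (of_int B - (w - w')) / 2\<close> d Reals_diff Reals_divide Reals_of_int Reals_numeral)
qed

lemma conj_pair_real: "conj_pair w w' P P' \<Longrightarrow> P \<in> \<real> \<and> P' \<in> \<real>"
  using w_real by (auto simp: conj_pair_def)

lemma power_real: "u p ^ r \<in> \<real>" "v p ^ r \<in> \<real>"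
proof -
  have c: "of_nat r * (w - w') \<in> \<real>" "of_nat r * (w - w') \<noteq> 0"
    using w_real w_diff_nonzero r3 by auto
  have "of_nat r * (w - w') * u p ^ r \<in> \<real>" "of_nat r * (w - w') * v p ^ r \<in> \<real>"
    using conj_pair_real[OF power_pair] by auto
  moreover have "z \<in> \<real>" if "k * z \<in> \<real>" "k \<in> \<real>" "k \<noteq> 0" for k z :: complex
    using Reals_divide[OF that(1,2)] that(3) by simp
  ultimately show "u p ^ r \<in> \<real>" "v p ^ r \<in> \<real>" using c by blast+
qed

text \<open>With \<zeta> its label, \<zeta> v / u is real for each solution, and (v p / u p) (u q /
  v q) is real because \<kappa> cancels; so the quotient of two labels is a real r-th root of
  unity.\<close>

lemma nearest_ratio:
  assumes p: "p \<in> solutions" "large p" and q: "q \<in> solutions" "large q"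
  shows "nearest q = nearest p \<or> (even r \<and> nearest q = - nearest p)"
proof -
  have nz: "u p \<noteq> 0" "v p \<noteq> 0" "u q \<noteq> 0" "v q \<noteq> 0" "nearest p \<noteq> 0"
    using large_size(1) large_ratio(3) nearest(1)[OF p] p q r3 by (auto simp: power_0_left)
  have "(v x / u x) ^ r \<in> \<real>" for x using power_real by (auto simp: power_divide intro: Reals_divide)
  then have R: "nearest p * v p / u p \<in> \<real>" "nearest q * v q / u q \<in> \<real>"
    using nearest(3) p q by auto
  have X: "u p * v q / \<kappa> \<in> \<real>" "v p * u q / \<kappa> \<in> \<real>" using conj_pair_real[OF cross_pair] by auto
  have "nearest q / nearest p = (nearest q * v q / u q) / (nearest p * v p / u p) *
      ((v p * u q / \<kappa>) / (u p * v q / \<kappa>))"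
    using nz kappa_nonzero by (simp add: field_simps)
  also have "\<dots> \<in> \<real>"
    by (rule Reals_mult[OF Reals_divide[OF R(2) R(1)] Reals_divide[OF X(2) X(1)]])
  finally have "nearest q / nearest p = 1 \<or> (even r \<and> nearest q / nearest p = - 1)"
    using nearest(1) p q r3 by (intro real_root_of_unity) (auto simp: power_divide)
  then show ?thesis using nz(5) by (auto simp: field_simps)
qed

lemma num_solutions_real:
  shows "num_primitive_solutions r a h \<le> 3" and "odd r \<Longrightarrow> num_primitive_solutions r a h \<le> 2"
proof -
  obtain z where z: "nearest p = z \<or> (even r \<and> nearest p = - z)" if "p \<in> solutions" "large p" for p
    using nearest_ratio by metis
  have "num_primitive_solutions r a h \<le> enat (2 + 1)"
    by (rule num_solutions_bound[of "{z, - z}"]) (use z in \<open>auto simp: card_insert_if\<close>)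
  then show "num_primitive_solutions r a h \<le> 3" by (simp add: numeral_eq_enat eval_nat_numeral)
  assume "odd r"
  then have "num_primitive_solutions r a h \<le> enat (1 + 1)"
    by (intro num_solutions_bound[of "{z}"]) (use z in auto)
  then show "num_primitive_solutions r a h \<le> 2" by (simp add: numeral_eq_enat eval_nat_numeral)
qed

text \<open>A large solution makes \<open>u^r\<close> and \<open>v^r\<close> real of the same sign there, so the real zeros of \<open>u\<close> and
  of \<open>v\<close> give values of the form of opposite signs.\<close>

lemma definite_not_large:
  assumes def: "definite_form r a" and p: "p \<in> solutions" "large p"
  shows False
proof -
  have nz: "u p \<noteq> 0" "v p \<noteq> 0" using large_size(1) large_ratio(3) p by auto
  obtain X Y where XY: "u p ^ r = of_real X" "v p ^ r = of_real Y"
    using power_real[of p] by (auto elim!: Reals_cases)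
  have X0: "X \<noteq> 0" using XY(1) nz by auto
  have "complex_of_real (Y / X - 1) = (v p / u p) ^ r - 1"
    by (simp add: XY power_divide)
  then have "\<bar>Y / X - 1\<bar> \<le> 1 / 9" using large_ratio(2)[OF p] by (metis norm_of_real)
  then have "Y / X > 0" by linarith
  then have XY0: "X * Y > 0" by (auto simp: zero_less_divide_iff zero_less_mult_iff)
  have real_eq: "complex_of_real (binary_form r a x y) = binary_form r a (of_real x) (of_real y)" for x y
    by (simp add: binary_form_def)
  obtain x1 y1 where p1: "p = (x1, y1)" by (cases p)
  obtain \<omega> \<omega>' where \<omega>: "w = of_real \<omega>" "w' = of_real \<omega>'" using w_real by (auto elim!: Reals_cases)
  \<comment> \<open>Coefficients of the real linear form u(x, y) v(p) / \<kappa>; \<open>c1\<close>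
    and \<open>c2\<close> are those of v(x, y) u(p) / \<kappa>.\<close>
  define b1 b2 where "b1 = of_int A * of_int x1 + \<omega> * of_int y1" and "b2 = \<omega>' * of_int x1 + of_int C * of_int y1"
  define c1 c2 where "c1 = of_int A * of_int x1 + \<omega>' * of_int y1" and "c2 = \<omega> * of_int x1 + of_int C * of_int y1"
  have AC: "\<alpha> * \<gamma> / \<kappa> = of_int A" "\<beta> * \<delta> / \<kappa> = of_int C"
    using quad(1,3) kappa_nonzero by auto
  have Uv: "(\<alpha> * of_real x + \<beta> * of_real y) * v p / \<kappa> = of_real (b1 * x + b2 * y)" for x y
  proof -
    have "(\<alpha> * of_real x + \<beta> * of_real y) * v p / \<kappa> =
        (\<alpha> * \<gamma> / \<kappa> * of_int x1 + w * of_int y1) * of_real x + (w' * of_int x1 + \<beta> * \<delta> / \<kappa> * of_int y1) * of_real y"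
      using kappa_nonzero by (simp add: v_def p1 w_def w'_def field_simps)
    then show ?thesis unfolding AC \<omega> by (simp add: b1_def b2_def)
  qed
  have Vu: "(\<gamma> * of_real x + \<delta> * of_real y) * u p / \<kappa> = of_real (c1 * x + c2 * y)" for x y
  proof -
    have "(\<gamma> * of_real x + \<delta> * of_real y) * u p / \<kappa> =
        (\<alpha> * \<gamma> / \<kappa> * of_int x1 + w' * of_int y1) * of_real x + (w * of_int x1 + \<beta> * \<delta> / \<kappa> * of_int y1) * of_real y"
      using kappa_nonzero by (simp add: u_def p1 w_def w'_def field_simps)
    then show ?thesis unfolding AC \<omega> by (simp add: c1_def c2_def)
  qed
  have up: "u p = \<alpha> * of_real (of_int x1) + \<beta> * of_real (of_int y1)"
    and vp: "v p = \<gamma> * of_real (of_int x1) + \<delta> * of_real (of_int y1)"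
    by (auto simp: u_def v_def p1)
  define Q where "Q = b1 * of_int x1 + b2 * of_int y1"
  have uvQ: "u p * v p / \<kappa> = of_real Q"
    using Uv[of "of_int x1" "of_int y1"] unfolding up[symmetric] Q_def .
  then have Q: "u p * v p / \<kappa> = of_real Q" "v p * u p / \<kappa> = of_real Q"
    by (simp_all add: mult.commute)
  have Q': "Q = c1 * of_int x1 + c2 * of_int y1"
  proof -
    have "complex_of_real Q = of_real (c1 * of_int x1 + c2 * of_int y1)"
      using Vu[of "of_int x1" "of_int y1"] Q(2) by (simp only: vp[symmetric])
    then show ?thesis by (simp only: of_real_eq_iff)
  qed
  have Q0: "Q \<noteq> 0" using Q(1) nz kappa_nonzero by auto
  have ratio: "z = of_real (b / Q) * m"
    if "z * k / \<kappa> = of_real b" "m * k / \<kappa> = of_real Q" "k \<noteq> 0" for z m k b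
  proof -
    have m: "m \<noteq> 0" using that(2) Q0 by auto
    have "complex_of_real (b / Q) = (z * k / \<kappa>) / (m * k / \<kappa>)" by (simp only: of_real_divide that)
    also have "\<dots> = z / m" using that(3) kappa_nonzero by simp
    finally show ?thesis using m by simp
  qed
  \<comment> \<open>Dividing u(x, y) by u(p) and v(x, y) by v(p) makes the form diagonal over the
    reals.\<close>
  have F: "binary_form r a x y = ((b1 * x + b2 * y) / Q) ^ r * X - ((c1 * x + c2 * y) / Q) ^ r * Y" for x y :: real
  proof -
    have e1: "\<alpha> * of_real x + \<beta> * of_real y = of_real ((b1 * x + b2 * y) / Q) * u p"
      by (rule ratio[OF Uv Q(1) nz(2)])
    have e2: "\<gamma> * of_real x + \<delta> * of_real y = of_real ((c1 * x + c2 * y) / Q) * v p"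
      by (rule ratio[OF Vu Q(2) nz(1)])
    have "complex_of_real (binary_form r a x y) =
        of_real (((b1 * x + b2 * y) / Q) ^ r * X - ((c1 * x + c2 * y) / Q) ^ r * Y)"
      by (simp only: real_eq form e1 e2 power_mult_distrib XY of_real_diff of_real_mult of_real_power)
    then show ?thesis by (simp only: of_real_eq_iff)
  qed
  have ev: "even r"
  proof (rule ccontr)
    assume "odd r"
    then have "binary_form r a (- 1) 0 = - binary_form r a (1 :: real) 0"
      unfolding F by (simp add: power_minus_odd)
    moreover have "(1 :: real, 0 :: real) \<noteq> (0, 0)" "(- 1 :: real, 0 :: real) \<noteq> (0, 0)" by auto
    ultimately show False using def unfolding definite_form_def by (metis neg_0_less_iff_less neg_less_0_iff_less order_less_asym)
  qed
  \<comment> \<open>Real zeros of u and of v: at the first the form is -Y times an even power, at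
    the second X times one, and X Y > 0.\<close>
  have "(- b2, b1) \<noteq> (0, 0)" using Q0 by (auto simp: Q_def)
  moreover have "(- c2, c1) \<noteq> (0, 0)" using Q0 by (auto simp: Q')
  moreover have "binary_form r a (- b2) b1 = - (((c1 * (- b2) + c2 * b1) / Q) ^ r * Y)"
    unfolding F using r3 by (simp add: mult.commute power_0_left)
  moreover have "binary_form r a (- c2) c1 = ((b1 * (- c2) + b2 * c1) / Q) ^ r * X"
    unfolding F using r3 by (simp add: mult.commute power_0_left)
  moreover have "0 \<le> ((c1 * (- b2) + c2 * b1) / Q) ^ r" "0 \<le> ((b1 * (- c2) + b2 * c1) / Q) ^ r"
    using ev by (auto simp: zero_le_even_power)
  ultimately show False using def XY0 unfolding definite_form_def zero_less_mult_iff
    by (smt (verit) mult_nonneg_nonneg mult_nonneg_nonpos)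
qed

lemma num_solutions_definite: "definite_form r a \<Longrightarrow> num_primitive_solutions r a h \<le> 1"
  using num_solutions_bound[of "{}" 0] definite_not_large by (auto simp: one_enat_def)

end

theorem theorem1p3:
  fixes r h :: nat and a :: "nat \<Rightarrow> int" and \<alpha> \<beta> \<gamma> \<delta> :: complex
  assumes "r \<ge> 7" and "h \<ge> 1"
    and "algebraic \<alpha>" and "algebraic \<beta>" and "algebraic \<gamma>" and "algebraic \<delta>"
    and "\<alpha> * \<delta> - \<beta> * \<gamma> \<noteq> 0"
    and "\<And>x y :: complex.
      binary_form r a x y = (\<alpha> * x + \<beta> * y) ^ r - (\<gamma> * x + \<delta> * y) ^ r"
    and "normalized_disc r a h \<ge>
      real r powr (13 * (real r)\<^sup>2 * (real r - 1) / ((real r)\<^sup>2 - 5 * real r - 2)) *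
      real h powr (4 * (real r - 1) * ((real r)\<^sup>2 - real r + 2) / ((real r)\<^sup>2 - 5 * real r - 2))"
  shows "(quadratic_disc r \<alpha> \<beta> \<gamma> \<delta> < 0 \<longrightarrow>
            num_primitive_solutions r a h \<le> enat (2 * r)) \<and>
         (quadratic_disc r \<alpha> \<beta> \<gamma> \<delta> > 0 \<and> even r \<and> indefinite_form r a \<longrightarrow>
            num_primitive_solutions r a h \<le> 4) \<and>
         (quadratic_disc r \<alpha> \<beta> \<gamma> \<delta> > 0 \<and> odd r \<and> indefinite_form r a \<longrightarrow>
            num_primitive_solutions r a h \<le> 2) \<and>
         (quadratic_disc r \<alpha> \<beta> \<gamma> \<delta> > 0 \<and> definite_form r a \<longrightarrow>
            num_primitive_solutions r a h \<le> 1)"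
proof -
  have "\<exists>\<kappa> A B C. quadratic_rep r \<alpha> \<beta> \<gamma> \<delta> \<kappa> A B C"
    using assms by (intro quadratic_rep_exists[of r]) auto
  then obtain \<kappa> A B C where rep: "quadratic_rep r \<alpha> \<beta> \<gamma> \<delta> \<kappa> A B C" by blast
  \<comment> \<open>The bound on w - w' is available for coprime A, B, C; their common factor is
    moved into \<kappa>, whose r-th power stays rational.\<close>
  define g where "g = gcd (gcd A C) B"
  have g0: "g \<noteq> 0"
  proof
    assume "g = 0"
    then have "A = 0" "B = 0" "C = 0" by (auto simp: g_def)
    then show False using quadratic_rep_coeffs(4)[OF rep] assms(7) by simp
  qed
  define A' B' C' where "A' = A div g" and "B' = B div g" and "C' = C div g"
  have "g dvd A" "g dvd B" "g dvd C" unfolding g_def by (meson dvd_trans gcd_dvd1 gcd_dvd2)+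
  then have ABC: "A = g * A'" "B = g * B'" "C = g * C'" by (simp_all add: A'_def B'_def C'_def)
  have "g * gcd (gcd A' C') B' = gcd (gcd A C) B * 1"
  proof -
    have "gcd (gcd (g * A') (g * C')) (g * B') = g * gcd (gcd A' C') B'"
      using gcd_mult_distrib_int[of g A' C'] gcd_mult_distrib_int[of g "gcd A' C'" B']
      by (simp add: g_def)
    then show ?thesis by (simp add: ABC[symmetric])
  qed
  then have primitive: "gcd (gcd A' C') B' = 1" using g0 by (simp add: g_def[symmetric])
  have rep': "quadratic_rep r \<alpha> \<beta> \<gamma> \<delta> (\<kappa> * of_int g) A' B' C'"
    using rep unfolding quadratic_rep_def ABC
    by (auto simp: power_mult_distrib algebra_simps intro!: Rats_mult)
  interpret diagonal_form_large_disc r a \<alpha> \<beta> \<gamma> \<delta> "\<kappa> * of_int g" A' B' C' h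
    using assms quadratic_rep_coeffs[OF rep'] primitive by unfold_locales auto
  have sgn: "sgn (quadratic_disc r \<alpha> \<beta> \<gamma> \<delta>) = sgn (B'\<^sup>2 - 4 * A' * C')"
    by (rule sgn_quadratic_disc[OF rep' assms(7)])
  have "num_primitive_solutions r a h \<le> enat (2 * r)"
    using num_solutions_general assms(1) by (elim order_trans) simp
  moreover have "num_primitive_solutions r a h \<le> 4 \<and> (odd r \<longrightarrow> num_primitive_solutions r a h \<le> 2) \<and>
      (definite_form r a \<longrightarrow> num_primitive_solutions r a h \<le> 1)"
    if "quadratic_disc r \<alpha> \<beta> \<gamma> \<delta> > 0"
  proof -
    have "B'\<^sup>2 - 4 * A' * C' > 0" using sgn that by (metis sgn_1_pos)
    then interpret diagonal_form_real r a \<alpha> \<beta> \<gamma> \<delta> "\<kappa> * of_int g" A' B' C' h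
      by unfold_locales
    have "(3 :: enat) \<le> 4" by simp
    then have "num_primitive_solutions r a h \<le> 4" using num_solutions_real(1) order_trans by blast
    then show ?thesis using num_solutions_real(2) num_solutions_definite by blast
  qed
  ultimately show ?thesis by blast
qed

end
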